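(* Let $C(a,b)=a^4+36a^2b^2+432b^4$, $A(a,b)=(-3a^2-36b^2)C(a,b)$, $B(a,b)=(2a^5+72a^3b^2+864ab^4)C(a,b)$, and $H(a,b):=\max\{4|A(a,b)|^3,27|B(a,b)|^2\}$. For $X>0$ let $N_1(X)$ be the number of pairs $(a,b)\in\mathbb{Z}^2$ with $b>0$, $\gcd(a,b)=1$, $4A(a,b)^3+27B(a,b)^2\neq0$, no integer $m>1$ with $m^4\mid A(a,b)$ and $m^6\mid B(a,b)$, and $H(a,b)\le X$. Let $\mathcal{R}:=\{(u,v)\in\mathbb{R}^2: v>0,\ |A(u,v)|\le 4^{-1/3},\ |B(u,v)|\le 27^{-1/2}\}$, and for a prime $\ell$ let $r_\ell$ be the number of solutions of $t^4+36t^2+432\equiv0$ in $\mathbb{Z}/\ell\mathbb{Z}$. Then \[N_1(X)\sim\frac12\cdot\frac23\prod_{\ell\neq2,3}\Big(1-\frac{1}{\ell^2}-\frac{r_\ell(\ell-1)}{\ell^5}\Big)\operatorname{Area}(\mathcal{R})\,X^{1/9}\quad\text{as }X\to\infty.\] Moreover, the number of $\mathbb{Q}$-isomorphism classes of elliptic curves $E/\mathbb{Q}$ with naive height $\operatorname{ht}(E)\le X$ that have a $(2,3)$-entanglement of type $\mathbb{Z}/2\mathbb{Z}$ is $\gg X^{1/9}$.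
   Context: Every elliptic curve $E/\mathbb{Q}$ has a unique globally minimal short model $y^2=x^3+Ax+B$ with $A,B\in\mathbb{Z}$ and no integer $m>1$ with $m^4\mid A$, $m^6\mid B$; its naive height is $\operatorname{ht}(E)=\max\{4|A|^3,27|B|^2\}$. For $n\ge1$, $\mathbb{Q}(E[n])$ denotes the $n$-division field. $E$ has a $(2,3)$-entanglement of type $\mathbb{Z}/2\mathbb{Z}$ if $K:=\mathbb{Q}(E[2])\cap\mathbb{Q}(E[3])\neq\mathbb{Q}$ and $\operatorname{Gal}(K/\mathbb{Q})\cong\mathbb{Z}/2\mathbb{Z}$. *)

theory Defs
  imports
    "HOL-Analysis.Analysis"
    "HOL-Library.Landau_Symbols"
    "HOL-Number_Theory.Cong"
    "HOL-Algebra.Algebraic_Closure_Type"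
    "HOL-Algebra.Generated_Fields"
    "HOL-Algebra.QuotRing"
    "HOL-Algebra.Bij"
    "HOL-Algebra.Elementary_Groups"
begin

section \<open>Elliptic curves in Weierstrass form\<close>

text \<open>
  \<open>Weierstrass a1 a2 a3 a4 a6\<close> stands for the equation
  \<open>y^2 + a1 x y + a3 y = x^3 + a2 x^2 + a4 x + a6\<close>.
  An elliptic curve over a field is a curve given by such an equation with nonzero discriminant,
  the neutral element being the point at infinity.
\<close>

datatype 'a weierstrass =
  Weierstrass (wa1: 'a) (wa2: 'a) (wa3: 'a) (wa4: 'a) (wa6: 'a)

definition w_discriminant :: "'a::field weierstrass \<Rightarrow> 'a" where
  "w_discriminant E =
    (let b2 = wa1 E ^ 2 + 4 * wa2 E;
         b4 = 2 * wa4 E + wa1 E * wa3 E;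
         b6 = wa3 E ^ 2 + 4 * wa6 E;
         b8 = wa1 E ^ 2 * wa6 E + 4 * wa2 E * wa6 E - wa1 E * wa3 E * wa4 E
              + wa2 E * wa3 E ^ 2 - wa4 E ^ 2
     in - (b2 ^ 2) * b8 - 8 * b4 ^ 3 - 27 * b6 ^ 2 + 9 * b2 * b4 * b6)"

definition elliptic_curves :: "'a::field weierstrass set" where
  "elliptic_curves = {E. w_discriminant E \<noteq> 0}"

text \<open>
  Isomorphism over the base field: \<open>E'\<close> arises from \<open>E\<close> by a substitution
  \<open>x = u^2 x' + r\<close>, \<open>y = u^3 y' + s u^2 x' + t\<close> with \<open>u \<noteq> 0\<close>.
\<close>

definition w_isomorphic :: "'a::field weierstrass \<Rightarrow> 'a weierstrass \<Rightarrow> bool" where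
  "w_isomorphic E E' \<longleftrightarrow> (\<exists>u r s t. u \<noteq> 0 \<and>
     u * wa1 E' = wa1 E + 2 * s \<and>
     u ^ 2 * wa2 E' = wa2 E - s * wa1 E + 3 * r - s ^ 2 \<and>
     u ^ 3 * wa3 E' = wa3 E + r * wa1 E + 2 * t \<and>
     u ^ 4 * wa4 E' = wa4 E - s * wa3 E + 2 * r * wa2 E - (t + r * s) * wa1 E
                      + 3 * r ^ 2 - 2 * s * t \<and>
     u ^ 6 * wa6 E' = wa6 E + r * wa4 E + r ^ 2 * wa2 E + r ^ 3 - t * wa3 E - t ^ 2
                      - r * t * wa1 E)"

definition isomorphism_rel :: "('a::field weierstrass \<times> 'a weierstrass) set" where
  "isomorphism_rel =
    {(E, E'). E \<in> elliptic_curves \<and> E' \<in> elliptic_curves \<and> w_isomorphic E E'}"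


section \<open>Naive height\<close>

definition short_model :: "int \<Rightarrow> int \<Rightarrow> rat weierstrass" where
  "short_model A B = Weierstrass 0 0 0 (of_int A) (of_int B)"

definition minimal_pair :: "int \<Rightarrow> int \<Rightarrow> bool" where
  "minimal_pair A B \<longleftrightarrow> \<not> (\<exists>m::int. m > 1 \<and> m ^ 4 dvd A \<and> m ^ 6 dvd B)"

definition pair_height :: "int \<Rightarrow> int \<Rightarrow> int" where
  "pair_height A B = max (4 * \<bar>A\<bar> ^ 3) (27 * \<bar>B\<bar> ^ 2)"

text \<open>
  The description is proper for every elliptic curve over the rationals, since there is exactly
  one pair \<open>(A, B)\<close> as described.
\<close>

definition minimal_short_coeffs :: "rat weierstrass \<Rightarrow> int \<times> int" where
  "minimal_short_coeffs E =
    (THE (A, B). minimal_pair A B \<and> w_isomorphic E (short_model A B))"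

definition naive_height :: "rat weierstrass \<Rightarrow> int" where
  "naive_height E = (case minimal_short_coeffs E of (A, B) \<Rightarrow> pair_height A B)"


section \<open>The group law and torsion points\<close>

datatype 'a point = At_Infinity | Affine 'a 'a

fun on_curve :: "'a::field weierstrass \<Rightarrow> 'a point \<Rightarrow> bool" where
  "on_curve E At_Infinity \<longleftrightarrow> True"
| "on_curve E (Affine x y) \<longleftrightarrow>
     y ^ 2 + wa1 E * x * y + wa3 E * y = x ^ 3 + wa2 E * x ^ 2 + wa4 E * x + wa6 E"

text \<open>
  Chord and tangent addition. In the branch \<open>x1 = x2\<close> where the sum is not the point at
  infinity, two points of the curve coincide, so the slope \<open>l\<close> is that of the tangent.
\<close>

fun point_add :: "'a::field weierstrass \<Rightarrow> 'a point \<Rightarrow> 'a point \<Rightarrow> 'a point" where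
  "point_add E At_Infinity Q = Q"
| "point_add E (Affine x1 y1) At_Infinity = Affine x1 y1"
| "point_add E (Affine x1 y1) (Affine x2 y2) =
    (if x1 = x2 \<and> y1 + y2 + wa1 E * x2 + wa3 E = 0 then At_Infinity
     else
       let l = (if x1 = x2
                then (3 * x1 ^ 2 + 2 * wa2 E * x1 + wa4 E - wa1 E * y1)
                     / (2 * y1 + wa1 E * x1 + wa3 E)
                else (y2 - y1) / (x2 - x1));
           x3 = l ^ 2 + wa1 E * l - wa2 E - x1 - x2
       in Affine x3 (- (l * (x3 - x1) + y1) - wa1 E * x3 - wa3 E))"

definition point_mult :: "'a::field weierstrass \<Rightarrow> nat \<Rightarrow> 'a point \<Rightarrow> 'a point" where
  "point_mult E n P = (point_add E P ^^ n) At_Infinity"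

definition torsion_points :: "'a::field weierstrass \<Rightarrow> nat \<Rightarrow> 'a point set" where
  "torsion_points E n = {P. on_curve E P \<and> point_mult E n P = At_Infinity}"


section \<open>Division fields and entanglement\<close>

text \<open>
  The algebraic closure of the rationals is the type \<open>rat alg_closure\<close>, into which the rationals
  embed by \<open>to_ac\<close>. Number fields are subsets of it.
\<close>

abbreviation rationals_ac :: "rat alg_closure set" where
  "rationals_ac \<equiv> range to_ac"

definition division_field :: "rat weierstrass \<Rightarrow> nat \<Rightarrow> rat alg_closure set" where
  "division_field E n =
    generate_field ring_of_type_algebra
      (rationals_ac \<union>
       (\<Union>{{x, y} | x y. Affine x y \<in> torsion_points (map_weierstrass to_ac E) n}))"

text \<open>
  Automorphisms of \<open>K\<close> fixing \<open>F\<close> pointwise, as a subgroup of the group of bijections of \<open>K\<close>.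
\<close>

definition galois_group :: "'a::field set \<Rightarrow> 'a set \<Rightarrow> ('a \<Rightarrow> 'a) monoid" where
  "galois_group K F =
    (BijGroup K)\<lparr>carrier :=
      {\<sigma> \<in> Bij K.
         \<sigma> \<in> ring_iso (ring_of_type_algebra\<lparr>carrier := K\<rparr>) (ring_of_type_algebra\<lparr>carrier := K\<rparr>)
         \<and> (\<forall>x\<in>F. \<sigma> x = x)}\<rparr>"

definition has_entanglement_2_3_Z2 :: "rat weierstrass \<Rightarrow> bool" where
  "has_entanglement_2_3_Z2 E \<longleftrightarrow>
    (let K = division_field E 2 \<inter> division_field E 3
     in K \<noteq> rationals_ac \<and> galois_group K rationals_ac \<cong> integer_mod_group 2)"

definition entangled_class_count :: "real \<Rightarrow> nat" where
  "entangled_class_count x =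
    card {c \<in> elliptic_curves // isomorphism_rel.
            \<exists>E\<in>c. real_of_int (naive_height E) \<le> x \<and> has_entanglement_2_3_Z2 E}"


section \<open>The two-parameter family\<close>

definition C_form :: "'a::comm_ring_1 \<Rightarrow> 'a \<Rightarrow> 'a" where
  "C_form a b = a ^ 4 + 36 * a ^ 2 * b ^ 2 + 432 * b ^ 4"

definition A_form :: "'a::comm_ring_1 \<Rightarrow> 'a \<Rightarrow> 'a" where
  "A_form a b = (- 3 * a ^ 2 - 36 * b ^ 2) * C_form a b"

definition B_form :: "'a::comm_ring_1 \<Rightarrow> 'a \<Rightarrow> 'a" where
  "B_form a b = (2 * a ^ 5 + 72 * a ^ 3 * b ^ 2 + 864 * a * b ^ 4) * C_form a b"

definition H_form :: "int \<Rightarrow> int \<Rightarrow> int" where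
  "H_form a b = pair_height (A_form a b) (B_form a b)"

definition N1 :: "real \<Rightarrow> nat" where
  "N1 x = card {(a :: int, b :: int).
     b > 0 \<and> gcd a b = 1 \<and> 4 * A_form a b ^ 3 + 27 * B_form a b ^ 2 \<noteq> 0 \<and>
     minimal_pair (A_form a b) (B_form a b) \<and> real_of_int (H_form a b) \<le> x}"

definition region_R :: "(real \<times> real) set" where
  "region_R = {(u, v). v > 0 \<and> \<bar>A_form u v\<bar> \<le> 4 powr (- 1 / 3) \<and>
                       \<bar>B_form u v\<bar> \<le> 27 powr (- 1 / 2)}"

definition root_count :: "nat \<Rightarrow> nat" where
  "root_count l = card {t \<in> {0..<l}. [t ^ 4 + 36 * t ^ 2 + 432 = 0] (mod l)}"

definition euler_factor :: "nat \<Rightarrow> real" where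
  "euler_factor l = 1 - 1 / real l ^ 2 - real (root_count l) * (real l - 1) / real l ^ 5"

text \<open>Product over all primes other than 2 and 3; the remaining indices contribute 1.\<close>

definition euler_product :: real where
  "euler_product = prodinf (\<lambda>l. if Factorial_Ring.prime l \<and> l \<noteq> 2 \<and> l \<noteq> 3 then euler_factor l else 1)"

end

theory Submission
  imports Defs "HOL-Number_Theory.Number_Theory" "HOL-Real_Asymp.Real_Asymp"
begin

text \<open>
  Since \<open>A = - 3 (a^2 + 12 b^2) C\<close>, \<open>B = 2 a C^2\<close> and \<open>4 A^3 + 27 B^2 = - 186624 b^6 C^3\<close>, a coprime pair
  is minimal iff \<open>2\<close> and \<open>3\<close> do not divide \<open>a\<close> and no fourth power of a prime \<open>\<ge> 5\<close> divides \<open>C\<close>. The pairs satisfying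
  finitely many of these local conditions are counted by tiling the region with squares. For the
  remaining primes \<open>p\<close>, the pairs with \<open>p^4 dvd C\<close> lie on at most four lattices of index \<open>p^4\<close>, and as soon
  as \<open>p^4\<close> exceeds the area of the box such a lattice contains at most one primitive pair; the total
  contribution is negligible because \<open>C\<close> has degree only 4.

  The invariant \<open>j = ((a^2 + 12 b^2) / b^2)^3\<close> is a cube, so the resolvent cubic of the 3-division polynomial has
  a rational root and \<open>\<rat>(E[3])\<close> is a tower of quadratic extensions starting with \<open>\<rat>(\<surd>C)\<close>, which is
  also contained in \<open>\<rat>(E[2])\<close> because the discriminant is a square times \<open>C\<close>. A cubic without a
  root in \<open>\<rat>(\<surd>C)\<close> acquires none in such a tower, hence the two fields meet in exactly \<open>\<rat>(\<surd>C)\<close>. The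
  congruences \<open>5 dvd a\<close> and \<open>\<not> 5 dvd b\<close> force \<open>C\<close> to be a nonsquare and keep a positive density.
\<close>

text \<open>\<open>A_form\<close> and \<open>B_form\<close> have degrees 6 and 9, so the height has
  degree 18: pairs of height at most x are the integer points of a fixed region dilated by T =
  x^(1/18), and x^(1/9) is T^2. The factors 1/2 and 2/3 are the densities of odd \<open>a\<close>
  and of \<open>a\<close> prime to 3. The obstacle is the passage from finitely many primes to all
  of them. In a box of side N a lattice of index p^4 is counted up to an error of size N, while p^4
  may divide C for p up to 5 N; that many errors of size N are as large as the main term. Hence the
  split at p^2 = N: below it there are at most sqrt N values of p, and above it one primitive pair
  per lattice leaves only O(N) in total. The field theory avoids degrees of extensions: it works
  with explicit coordinates on 1, c and on 1, e, e^2, and with the fact that a root of a cubic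
  cannot first appear in a tower of square roots. Distinct pairs with a, b > 0 give nonisomorphic
  curves, because minimal models are unique and j together with coprimality recovers a and
  b.\<close>

hide_const (open) Divisibility.prime

section \<open>Counting solutions of periodic conditions\<close>

lemmas poly_simps = algebra_simps power_numeral_reduce

definition periodic2 :: "nat \<Rightarrow> (nat \<Rightarrow> nat \<Rightarrow> bool) \<Rightarrow> bool" where
  "periodic2 m P \<longleftrightarrow> (\<forall>a b. P a b \<longleftrightarrow> P (a mod m) (b mod m))"

definition period_count :: "(nat \<Rightarrow> nat \<Rightarrow> bool) \<Rightarrow> nat \<Rightarrow> nat" where
  "period_count P m = card {(a, b). a < m \<and> b < m \<and> P a b}"

lemma periodic2_mult:
  assumes "periodic2 m P"
  shows "periodic2 (m * n) P"
proof -
  have *: "P a b \<longleftrightarrow> P (a mod m) (b mod m)" for a b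
    using assms unfolding periodic2_def by blast
  have "P a b \<longleftrightarrow> P (a mod (m * n)) (b mod (m * n))" for a b
    by (subst *, subst (2) *) (simp add: mod_mod_cancel)
  then show ?thesis unfolding periodic2_def by blast
qed

lemma bij_betw_mod_mod:
  fixes m n :: nat
  assumes "coprime m n" "m > 0" "n > 0"
  shows "bij_betw (\<lambda>x. (x mod m, x mod n)) {..<m * n} ({..<m} \<times> {..<n})"
proof -
  have inj: "inj_on (\<lambda>x. (x mod m, x mod n)) {..<m * n}"
  proof (rule inj_onI)
    fix x y assume xy: "x \<in> {..<m * n}" "y \<in> {..<m * n}" "(x mod m, x mod n) = (y mod m, y mod n)"
    then have "[x = y] (mod m)" "[x = y] (mod n)" by (auto simp: cong_def)
    then have "[x = y] (mod m * n)"
      using assms(1) by (simp add: coprime_cong_mult_nat)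
    then show "x = y" using xy by (auto simp: cong_def)
  qed
  moreover have "(\<lambda>x. (x mod m, x mod n)) ` {..<m * n} = {..<m} \<times> {..<n}"
    using assms by (intro card_subset_eq) (auto simp: card_image[OF inj])
  ultimately show ?thesis by (simp add: bij_betw_def)
qed

text \<open>Chinese remainder theorem in each coordinate: a pair modulo \<open>m * n\<close> is a
  pair modulo \<open>m\<close> together with a pair modulo \<open>n\<close>, and each condition sees
  only its own component.\<close>

lemma period_count_mult:
  assumes "coprime m n" "m > 0" "n > 0" "periodic2 m P" "periodic2 n Q"
  shows "period_count (\<lambda>a b. P a b \<and> Q a b) (m * n) = period_count P m * period_count Q n"
proof -
  let ?f = "\<lambda>x. (x mod m, x mod n)"
  let ?g = "\<lambda>(a, b). ((a mod m, b mod m), (a mod n, b mod n))"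
  let ?S = "{(a, b). a < m * n \<and> b < m * n \<and> P a b \<and> Q a b}"
  let ?T = "{(a, b). a < m \<and> b < m \<and> P a b} \<times> {(a, b). a < n \<and> b < n \<and> Q a b}"
  have P: "P a b \<longleftrightarrow> P (a mod m) (b mod m)" and Q: "Q a b \<longleftrightarrow> Q (a mod n) (b mod n)" for a b
    using assms unfolding periodic2_def by blast+
  have bij: "bij_betw ?f {..<m * n} ({..<m} \<times> {..<n})"
    by (rule bij_betw_mod_mod) fact+
  have "bij_betw ?g ?S ?T"
    unfolding bij_betw_def
  proof
    show "inj_on ?g ?S"
    proof (rule inj_onI, clarsimp)
      fix a b c d
      assume "a < m * n" "b < m * n" "c < m * n" "d < m * n"
        "a mod m = c mod m" "b mod m = d mod m" "a mod n = c mod n" "b mod n = d mod n"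
      then show "a = c \<and> b = d"
        using inj_onD[OF bij_betw_imp_inj_on[OF bij], of a c] inj_onD[OF bij_betw_imp_inj_on[OF bij], of b d]
        by auto
    qed
    show "?g ` ?S = ?T"
    proof (intro equalityI subsetI)
      fix x assume "x \<in> ?g ` ?S"
      then show "x \<in> ?T" using assms(2,3) P Q by auto
    next
      fix x assume "x \<in> ?T"
      then obtain a b c d where x: "x = ((a, b), (c, d))"
        "a < m" "b < m" "P a b" "c < n" "d < n" "Q c d" by auto
      have "(a, c) \<in> ?f ` {..<m * n}" "(b, d) \<in> ?f ` {..<m * n}"
        using bij x by (auto simp: bij_betw_def)
      then obtain u v where "u < m * n" "a = u mod m" "c = u mod n"
        "v < m * n" "b = v mod m" "d = v mod n" by auto
      then show "x \<in> ?g ` ?S" using x P[of u v] Q[of u v] by (auto intro!: image_eqI[of _ _ "(u, v)"])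
    qed
  qed
  from bij_betw_same_card[OF this] show ?thesis
    unfolding period_count_def by (simp add: card_cartesian_product)
qed

text \<open>Periodicity and count share one induction, since adding a prime through
  \<open>period_count_mult\<close> uses the period of the conditions collected so far.\<close>

lemma period_count_prod:
  assumes "finite ps" "\<And>p. p \<in> ps \<Longrightarrow> prime p" "\<And>p. p \<in> ps \<Longrightarrow> periodic2 (p ^ k) (G p)"
  shows "periodic2 (\<Prod>p\<in>ps. p ^ k) (\<lambda>a b. \<forall>p\<in>ps. G p a b) \<and>
    period_count (\<lambda>a b. \<forall>p\<in>ps. G p a b) (\<Prod>p\<in>ps. p ^ k) = (\<Prod>p\<in>ps. period_count (G p) (p ^ k))"
  using assms
proof (induction ps rule: finite_induct)
  case empty
  then show ?case by (auto simp: periodic2_def period_count_def)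
next
  case (insert q ps)
  let ?M = "\<Prod>p\<in>ps. p ^ k"
  have IH: "periodic2 ?M (\<lambda>a b. \<forall>p\<in>ps. G p a b)"
    "period_count (\<lambda>a b. \<forall>p\<in>ps. G p a b) ?M = (\<Prod>p\<in>ps. period_count (G p) (p ^ k))"
    using insert by auto
  have q: "prime q" "periodic2 (q ^ k) (G q)" using insert by auto
  have cop: "coprime (q ^ k) ?M"
  proof (rule prod_coprime_right)
    fix p assume p: "p \<in> ps"
    then have "p \<noteq> q" "prime p" using insert by auto
    then show "coprime (q ^ k) (p ^ k)" using q(1) primes_coprime by auto
  qed
  have pos: "q ^ k > 0" "?M > 0"
    using q(1) insert.prems(1) by (auto simp: prime_gt_0_nat intro!: prod_pos)
  have "periodic2 (q ^ k * ?M) (G q)" "periodic2 (?M * q ^ k) (\<lambda>a b. \<forall>p\<in>ps. G p a b)"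
    using periodic2_mult q(2) IH(1) by blast+
  then have "periodic2 (q ^ k * ?M) (\<lambda>a b. G q a b \<and> (\<forall>p\<in>ps. G p a b))"
    unfolding periodic2_def by (simp add: mult.commute)
  moreover have "period_count (\<lambda>a b. G q a b \<and> (\<forall>p\<in>ps. G p a b)) (q ^ k * ?M)
      = period_count (G q) (q ^ k) * (\<Prod>p\<in>ps. period_count (G p) (p ^ k))"
    using period_count_mult[OF cop pos q(2) IH(1)] IH(2) by simp
  ultimately show ?case using insert by simp
qed

text \<open>Blocks open on the left and closed on the right tile the positive integers, in step with
  the half-open cells used for the region.\<close>

lemma bij_betw_mod_block:
  fixes M :: nat
  assumes "M > 0"
  shows "bij_betw (\<lambda>x. x mod M) {i * M<..(i + 1) * M} {..<M}"
proof -
  have inj: "inj_on (\<lambda>x. x mod M) {i * M<..(i + 1) * M}"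
  proof (rule linorder_inj_onI')
    fix x y assume xy: "x \<in> {i * M<..(i + 1) * M}" "y \<in> {i * M<..(i + 1) * M}" "x < y"
    then have "y - x < M" "y - x > 0" by auto
    then have "\<not> M dvd y - x" by (meson nat_dvd_not_less)
    then show "x mod M \<noteq> y mod M" using xy(3) by (metis less_imp_le_nat mod_eq_dvd_iff_nat)
  qed
  moreover have "(\<lambda>x. x mod M) ` {i * M<..(i + 1) * M} = {..<M}"
  proof (rule card_subset_eq)
    show "card ((\<lambda>x. x mod M) ` {i * M<..(i + 1) * M}) = card {..<M}"
      by (subst card_image[OF inj]) simp
  qed (use assms in auto)
  ultimately show ?thesis by (simp add: bij_betw_def)
qed

lemma card_block:
  assumes "periodic2 M P" "M > 0"
  shows "card {(a, b). i * M < a \<and> a \<le> (i + 1) * M \<and> j * M < b \<and> b \<le> (j + 1) * M \<and> P a b}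
    = period_count P M"
proof -
  let ?g = "map_prod (\<lambda>x. x mod M) (\<lambda>x. x mod M)"
  have "bij_betw ?g ({i * M<..(i + 1) * M} \<times> {j * M<..(j + 1) * M}) ({..<M} \<times> {..<M})"
    using bij_betw_mod_block[OF assms(2)] by (intro bij_betw_map_prod) auto
  moreover have "P a b \<longleftrightarrow> P (a mod M) (b mod M)" for a b
    using assms(1) unfolding periodic2_def by blast
  ultimately have "bij_betw ?g
     {x \<in> {i * M<..(i + 1) * M} \<times> {j * M<..(j + 1) * M}. case x of (a, b) \<Rightarrow> P a b}
     {x \<in> {..<M} \<times> {..<M}. case x of (a, b) \<Rightarrow> P a b}"
    by (intro bij_betw_Collect) auto
  moreover have "{x \<in> {i * M<..(i + 1) * M} \<times> {j * M<..(j + 1) * M}. case x of (a, b) \<Rightarrow> P a b} =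
      {(a, b). i * M < a \<and> a \<le> (i + 1) * M \<and> j * M < b \<and> b \<le> (j + 1) * M \<and> P a b}"
    "{x \<in> {..<M} \<times> {..<M}. case x of (a, b) \<Rightarrow> P a b} = {(a, b). a < M \<and> b < M \<and> P a b}"
    by auto
  ultimately show ?thesis
    unfolding period_count_def by (metis (no_types, lifting) bij_betw_same_card)
qed

section \<open>Roots of the quartic modulo prime powers\<close>

text \<open>C on natural numbers, where residues are counted. \<open>quartic_poly\<close> is the
  dehomogenisation C(t, 1) over the integers, where differences factor.\<close>

definition quartic :: "nat \<Rightarrow> nat \<Rightarrow> nat" where
  "quartic a b = a ^ 4 + 36 * a ^ 2 * b ^ 2 + 432 * b ^ 4"

definition quartic_poly :: "int \<Rightarrow> int" where
  "quartic_poly t = t ^ 4 + 36 * t ^ 2 + 432"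

text \<open>The polynomial is even, so both t - t' and t + t' split off. This drives the uniqueness
  of lifted roots as well as the bound on their number.\<close>

lemma quartic_poly_diff:
  "quartic_poly t - quartic_poly t' = (t - t') * ((t + t') * (t ^ 2 + t' ^ 2 + 36))"
  unfolding quartic_poly_def by (simp add: poly_simps)

text \<open>The derivative is 4 t (t^2 + 18), and the quartic is congruent to 432 = 2^4 * 3^3 modulo
  t and to 108 = 2^2 * 3^3 modulo t^2 + 18. A multiple root modulo p thus requires p = 2 or p =
  3.\<close>

lemma quartic_poly_deriv_unit:
  fixes p :: int
  assumes "prime p" "p \<noteq> 2" "p \<noteq> 3" "p dvd quartic_poly t"
  shows "\<not> p dvd 4 * t ^ 3 + 72 * t"
proof
  assume "p dvd 4 * t ^ 3 + 72 * t"
  then have d: "p dvd 2 * 2 * t * (t ^ 2 + 18)" by (simp add: poly_simps)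
  have not2: "\<not> p dvd 2" and not3: "\<not> p dvd 3"
    using assms(1-3) primes_dvd_imp_eq[of p 2] primes_dvd_imp_eq[of p 3] by auto
  from d have "p dvd 2 \<or> p dvd t \<or> p dvd t ^ 2 + 18" using assms(1) by (meson prime_dvd_multD)
  moreover have nd: "\<not> p dvd 2 ^ i * 3 ^ j" for i j
    using not2 not3 assms(1) by (meson prime_dvd_multD prime_dvd_power)
  moreover have "\<not> p dvd t"
  proof
    assume "p dvd t"
    then have "p dvd t * (t ^ 3 + 36 * t)" by simp
    then have "p dvd quartic_poly t - t * (t ^ 3 + 36 * t)" using assms(4) by (intro dvd_diff)
    also have "quartic_poly t - t * (t ^ 3 + 36 * t) = 432"
      unfolding quartic_poly_def by (simp add: poly_simps)
    finally show False using nd[of 4 3] by simp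
  qed
  moreover have "\<not> p dvd t ^ 2 + 18"
  proof
    assume "p dvd t ^ 2 + 18"
    then have "p dvd (t ^ 2 + 18) * (t ^ 2 + 18)" by simp
    then have "p dvd quartic_poly t - (t ^ 2 + 18) * (t ^ 2 + 18)" using assms(4) by (intro dvd_diff)
    also have "quartic_poly t - (t ^ 2 + 18) * (t ^ 2 + 18) = 108"
      unfolding quartic_poly_def by (simp add: poly_simps)
    finally show False using nd[of 2 3] by simp
  qed
  ultimately show False using not2 by blast
qed

text \<open>Modulo p the cofactor of t - t' in \<open>quartic_poly_diff\<close> is the derivative at
  t', hence prime to p, so the whole power p^k divides t - t'.\<close>

lemma quartic_root_unique:
  fixes p :: int
  assumes "prime p" "p \<noteq> 2" "p \<noteq> 3" "p ^ k dvd quartic_poly t" "p ^ k dvd quartic_poly t'"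
    "[t = t'] (mod p)" "k > 0"
  shows "[t = t'] (mod p ^ k)"
proof -
  have "p dvd p ^ k" using assms(7) by (simp add: dvd_power)
  then have pt: "p dvd quartic_poly t'" using assms(5) dvd_trans by blast
  have "[(t + t') * (t ^ 2 + t' ^ 2 + 36) = (t' + t') * (t' ^ 2 + t' ^ 2 + 36)] (mod p)"
    using assms(6) by (intro cong_mult cong_add cong_pow cong_refl)
  also have "(t' + t') * (t' ^ 2 + t' ^ 2 + 36) = 4 * t' ^ 3 + 72 * t'" by (simp add: poly_simps)
  finally have "\<not> p dvd (t + t') * (t ^ 2 + t' ^ 2 + 36)"
    using quartic_poly_deriv_unit[OF assms(1-3) pt] cong_dvd_iff by blast
  then have "coprime (p ^ k) ((t + t') * (t ^ 2 + t' ^ 2 + 36))"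
    using assms(1) by (meson coprime_power_left_iff prime_imp_coprime)
  moreover have "p ^ k dvd (t - t') * ((t + t') * (t ^ 2 + t' ^ 2 + 36))"
    using assms(4,5) by (simp flip: quartic_poly_diff)
  ultimately show ?thesis
    by (simp add: cong_iff_dvd_diff coprime_dvd_mult_left_iff)
qed

lemma quartic_root_lift:
  fixes p :: int
  assumes "prime p" "p \<noteq> 2" "p \<noteq> 3" "p dvd quartic_poly t" "k > 0"
  shows "\<exists>t'. [t' = t] (mod p) \<and> p ^ k dvd quartic_poly t'"
  using assms(5)
proof (induction k rule: nat_induct_non_zero)
  case 1
  then show ?case using assms(4) by (intro exI[of _ t]) auto
next
  case (Suc k)
  then obtain u w where u: "[u = t] (mod p)" "quartic_poly u = p ^ k * w" by (auto elim!: dvdE)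
  define d where "d = 4 * u ^ 3 + 72 * u"
  have "p dvd quartic_poly u" using u(2) Suc.hyps by (simp add: dvd_power)
  then have "\<not> p dvd d" unfolding d_def using quartic_poly_deriv_unit assms by blast
  then have "coprime d p" using assms(1) by (simp add: prime_imp_coprime coprime_commute[of d p])
  then obtain x where x: "[d * x = 1] (mod p)" by (meson cong_solve_coprime_int)
  \<comment> \<open>Newton step -f(u)/f'(u), with x inverse to the derivative modulo p. The terms of
    order h^2 vanish modulo p^(k+1) because 2 k >= k + 1.\<close>
  define h where "h = - (p ^ k * (x * w))"
  have h1: "p ^ k dvd h" unfolding h_def by simp
  have "k + 1 \<le> k * 2" using Suc.hyps by simp
  then have "p ^ Suc k dvd (p ^ k) ^ 2"
    unfolding power_mult [symmetric] by (intro le_imp_power_dvd) simp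
  then have h2: "p ^ Suc k dvd h ^ 2"
    using h1 dvd_trans dvd_power_same by blast
  have "quartic_poly (u + h) = quartic_poly u + d * h + h ^ 2 * (6 * u ^ 2 + 4 * u * h + h ^ 2 + 36)"
    unfolding quartic_poly_def d_def by (simp add: poly_simps)
  moreover have "quartic_poly u + d * h = p ^ k * (w * (1 - d * x))"
    unfolding u(2) h_def by (simp add: poly_simps)
  moreover have "p dvd 1 - d * x" using x by (simp add: cong_iff_dvd_diff dvd_diff_commute)
  then have "p ^ Suc k dvd p ^ k * (w * (1 - d * x))"
    unfolding power_Suc2 by (intro mult_dvd_mono dvd_mult) auto
  ultimately have "p ^ Suc k dvd quartic_poly (u + h)" using h2 by (metis dvd_add dvd_mult2)
  moreover have "p dvd h" using h1 Suc.hyps by (meson dvd_power dvd_trans)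
  then have "[u + h = t + 0] (mod p)" using u(1) by (intro cong_add) (auto simp: cong_0_iff)
  ultimately show ?case by auto
qed

definition quartic_roots :: "nat \<Rightarrow> nat \<Rightarrow> nat set" where
  "quartic_roots p k = {t. t < p ^ k \<and> p ^ k dvd quartic t 1}"

lemma quartic_poly_of_nat: "quartic_poly (int t) = int (quartic t 1)"
  unfolding quartic_poly_def quartic_def by simp

lemma quartic_roots_iff: "t \<in> quartic_roots p k \<longleftrightarrow> t < p ^ k \<and> int p ^ k dvd quartic_poly (int t)"
  unfolding quartic_roots_def quartic_poly_of_nat by (simp flip: of_nat_power)

lemma finite_quartic_roots [simp]: "finite (quartic_roots p k)"
  unfolding quartic_roots_def by auto

lemma quartic_poly_cong:
  assumes "[t = t'] (mod m)"
  shows "m dvd quartic_poly t \<longleftrightarrow> m dvd quartic_poly t'"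
  unfolding quartic_poly_def using assms
  by (intro cong_dvd_iff cong_add cong_mult cong_pow cong_refl)

text \<open>Hensel's lemma: reduction modulo p is injective on roots by
  \<open>quartic_root_unique\<close> and onto by \<open>quartic_root_lift\<close>.\<close>

lemma card_quartic_roots:
  assumes "prime p" "p \<noteq> 2" "p \<noteq> 3" "k > 0"
  shows "card (quartic_roots p k) = card (quartic_roots p 1)"
proof (rule bij_betw_same_card)
  have pp: "prime (int p)" "int p \<noteq> 2" "int p \<noteq> 3" using assms by auto
  have dvd: "int p dvd int p ^ k" using assms(4) by (simp add: dvd_power)
  have p0: "p > 0" using assms(1) by (simp add: prime_gt_0_nat)
  show "bij_betw (\<lambda>t. t mod p) (quartic_roots p k) (quartic_roots p 1)"
    unfolding bij_betw_def
  proof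
    show "inj_on (\<lambda>t. t mod p) (quartic_roots p k)"
    proof (rule inj_onI)
      fix t t' assume t: "t \<in> quartic_roots p k" "t' \<in> quartic_roots p k" "t mod p = t' mod p"
      then have "[int t = int t'] (mod int p)" by (simp add: cong_def flip: of_nat_mod)
      then have "[int t = int t'] (mod int p ^ k)"
        using quartic_root_unique[OF pp] t assms(4) by (auto simp: quartic_roots_iff)
      then have "[t = t'] (mod p ^ k)" by (simp add: cong_int_iff flip: of_nat_power)
      then show "t = t'" using t by (simp add: quartic_roots_iff cong_def)
    qed
    show "(\<lambda>t. t mod p) ` quartic_roots p k = quartic_roots p 1"
    proof (intro equalityI subsetI)
      fix s assume "s \<in> (\<lambda>t. t mod p) ` quartic_roots p k"
      then obtain t where t: "s = t mod p" "int p ^ k dvd quartic_poly (int t)"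
        by (auto simp: quartic_roots_iff)
      have "[int s = int t] (mod int p)" unfolding t(1) by (simp add: cong_def flip: of_nat_mod)
      then show "s \<in> quartic_roots p 1"
        using quartic_poly_cong dvd_trans[OF dvd t(2)] t(1) p0 by (simp add: quartic_roots_iff)
    next
      fix s assume s: "s \<in> quartic_roots p 1"
      then obtain t where t: "[t = int s] (mod int p)" "int p ^ k dvd quartic_poly t"
        using quartic_root_lift[OF pp _ assms(4), of "int s"] by (auto simp: quartic_roots_iff)
      define u where "u = nat (t mod int p ^ k)"
      have u: "int u = t mod int p ^ k" unfolding u_def using p0 by simp
      then have "[int u = t] (mod int p ^ k)" by (simp add: cong_def)
      moreover have "u < p ^ k" using u p0 by (metis of_nat_less_iff of_nat_power pos_mod_bound of_nat_0_less_iff zero_less_power)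
      ultimately have "u \<in> quartic_roots p k"
        using t(2) quartic_poly_cong by (auto simp: quartic_roots_iff)
      moreover have "[int u = int s] (mod int p)"
        using \<open>[int u = t] (mod int p ^ k)\<close> dvd t(1) cong_dvd_modulus cong_trans by blast
      then have "u mod p = s" using s by (simp add: cong_int_iff quartic_roots_iff) (simp add: cong_def)
      ultimately show "s \<in> (\<lambda>t. t mod p) ` quartic_roots p k" by auto
    qed
  qed
qed

lemma root_count_eq: "root_count p = card (quartic_roots p 1)"
  unfolding root_count_def quartic_roots_def quartic_def
  by (auto intro!: arg_cong[of _ _ card] simp: cong_0_iff)

text \<open>By the factored difference two roots satisfy t = u, t = -u or t^2 + u^2 = -36 modulo p.
  Roots outside the class of t0 up to sign therefore share one square, so at most two classes up to
  sign occur, each with at most two members.\<close>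

lemma root_count_le:
  assumes "prime p" "p \<noteq> 2" "p \<noteq> 3"
  shows "root_count p \<le> 4"
proof -
  let ?Z = "quartic_roots p 1"
  have pp: "prime (int p)" using assms by auto
  have key: "[int t = int u] (mod int p) \<or> [int t = - int u] (mod int p) \<or>
      [int t ^ 2 = - 36 - int u ^ 2] (mod int p)" if "t \<in> ?Z" "u \<in> ?Z" for t u
  proof -
    have "int p dvd quartic_poly (int t) - quartic_poly (int u)"
      using that by (intro dvd_diff) (auto simp: quartic_roots_iff)
    then have "int p dvd (int t - int u) * ((int t + int u) * (int t ^ 2 + int u ^ 2 + 36))"
      by (simp only: quartic_poly_diff)
    then consider "int p dvd int t - int u" | "int p dvd int t + int u" | "int p dvd int t ^ 2 + int u ^ 2 + 36"
      using pp prime_dvd_mult_iff by blast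
    then show ?thesis by cases (auto simp: cong_iff_dvd_diff algebra_simps)
  qed
  let ?E = "\<lambda>x. {t \<in> ?Z. [int t = x] (mod int p)}"
  define Y where "Y u = {t \<in> ?Z. [int t = int u] (mod int p) \<or> [int t = - int u] (mod int p)}" for u
  have Y: "card (Y u) \<le> 2" for u
  proof -
    have *: "t = t'" if "[int t = x] (mod int p)" "[int t' = x] (mod int p)" "t \<in> ?Z" "t' \<in> ?Z" for t t' x
    proof -
      have "[int t = int t'] (mod int p)" using that cong_trans cong_sym by blast
      then show ?thesis using that by (simp add: cong_int_iff cong_def quartic_roots_iff)
    qed
    have "card (?E x) \<le> 1" for x
      using * by (auto simp: card_le_Suc0_iff_eq)
    from add_mono[OF this[of "int u"] this[of "- int u"]]
    have "card (?E (int u)) + card (?E (- int u)) \<le> 2" by simp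
    moreover have "Y u = ?E (int u) \<union> ?E (- int u)"
      unfolding Y_def by auto
    ultimately show ?thesis
      using card_Un_le[of "?E (int u)" "?E (- int u)"]
      by (metis (no_types, lifting) order_trans)
  qed
  show ?thesis
  proof (cases "\<exists>t0 t1. t0 \<in> ?Z \<and> t1 \<in> ?Z \<and> t1 \<notin> Y t0")
    case True
    then obtain t0 t1 where t: "t0 \<in> ?Z" "t1 \<in> ?Z" "t1 \<notin> Y t0" by blast
    have "?Z \<subseteq> Y t0 \<union> Y t1"
    proof
      fix s assume s: "s \<in> ?Z"
      show "s \<in> Y t0 \<union> Y t1"
      proof (cases "s \<in> Y t0")
        case False
        then have "[int s ^ 2 = - 36 - int t0 ^ 2] (mod int p)" using key[OF s t(1)] s by (auto simp: Y_def)
        moreover have "[int t1 ^ 2 = - 36 - int t0 ^ 2] (mod int p)" using key[OF t(2) t(1)] t by (auto simp: Y_def)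
        ultimately have "[int s ^ 2 = int t1 ^ 2] (mod int p)" using cong_trans cong_sym by blast
        then have "int p dvd (int s - int t1) * (int s + int t1)"
          by (simp add: cong_iff_dvd_diff power2_eq_square algebra_simps)
        then have "int p dvd int s - int t1 \<or> int p dvd int s + int t1"
          using pp prime_dvd_mult_iff by blast
        then show ?thesis using s by (auto simp: Y_def cong_iff_dvd_diff)
      qed simp
    qed
    then have "card ?Z \<le> card (Y t0 \<union> Y t1)" by (intro card_mono) (auto simp: Y_def)
    also have "\<dots> \<le> card (Y t0) + card (Y t1)" by (rule card_Un_le)
    also have "\<dots> \<le> 4" using Y[of t0] Y[of t1] by simp
    finally show ?thesis by (simp add: root_count_eq)
  next
    case False
    then have "?Z = {} \<or> (\<exists>t0. ?Z \<subseteq> Y t0)" by blast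
    then have "card ?Z \<le> 2"
    proof
      assume "\<exists>t0. ?Z \<subseteq> Y t0"
      then obtain t0 where "?Z \<subseteq> Y t0" ..
      then have "card ?Z \<le> card (Y t0)" by (intro card_mono) (auto simp: Y_def)
      then show ?thesis using Y[of t0] by simp
    qed auto
    then show ?thesis by (simp add: root_count_eq)
  qed
qed

section \<open>Local densities and tail estimates\<close>

text \<open>The share of the prime p in coprimality and minimality together, as
  \<open>minimal_pair_forms_iff\<close> shows. At 2 and 3 the condition on \<open>a\<close> alone
  also excludes p as a common factor.\<close>

definition local_good :: "nat \<Rightarrow> nat \<Rightarrow> nat \<Rightarrow> bool" where
  "local_good p a b \<longleftrightarrow> (if p = 2 \<or> p = 3 then \<not> p dvd a
     else \<not> (p dvd a \<and> p dvd b) \<and> \<not> p ^ 4 dvd quartic a b)"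

lemma dvd_mod_power_iff:
  fixes p :: nat
  assumes "k > 0"
  shows "p dvd a mod p ^ k \<longleftrightarrow> p dvd a"
  using assms by (intro dvd_mod_iff) (simp add: dvd_power)

lemma quartic_cong:
  assumes "[a = a'] (mod m)" "[b = b'] (mod m)"
  shows "m dvd quartic a b \<longleftrightarrow> m dvd quartic a' b'"
  unfolding quartic_def using assms
  by (intro cong_dvd_iff cong_add cong_mult cong_pow cong_refl)

lemma periodic2_local_good: "periodic2 (p ^ 4) (local_good p)"
proof -
  have "local_good p a b \<longleftrightarrow> local_good p (a mod p ^ 4) (b mod p ^ 4)" for a b
    using quartic_cong[of a "a mod p ^ 4" "p ^ 4" b "b mod p ^ 4"]
    unfolding local_good_def by (simp add: dvd_mod_power_iff cong_sym_eq[of a] cong_sym_eq[of b])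
  then show ?thesis unfolding periodic2_def by blast
qed

lemma card_multiples_lessThan:
  fixes p :: nat
  assumes "p > 0"
  shows "card {a. a < p * n \<and> p dvd a} = n"
proof -
  have "{a. a < p * n \<and> p dvd a} = (\<lambda>x. p * x) ` {..<n}"
    using assms by (auto elim!: dvdE)
  moreover have "inj_on (\<lambda>x. p * x) {..<n}" using assms by (auto simp: inj_on_def)
  ultimately show ?thesis by (simp add: card_image)
qed

lemma card_nonmultiples_lessThan:
  fixes p :: nat
  assumes "p > 0"
  shows "card {a. a < p * n \<and> \<not> p dvd a} = p * n - n"
proof -
  have "{a. a < p * n \<and> \<not> p dvd a} = {..<p * n} - {a. a < p * n \<and> p dvd a}" by auto
  moreover have "card ({..<p * n} - {a. a < p * n \<and> p dvd a}) = card {..<p * n} - card {a. a < p * n \<and> p dvd a}"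
    by (intro card_Diff_subset) auto
  ultimately show ?thesis using card_multiples_lessThan[OF assms, of n] by simp
qed

lemma period_count_prod_pred:
  "period_count (\<lambda>a b. P a \<and> Q b) m = card {a. a < m \<and> P a} * card {b. b < m \<and> Q b}"
proof -
  have "{(a, b). a < m \<and> b < m \<and> P a \<and> Q b} = {a. a < m \<and> P a} \<times> {b. b < m \<and> Q b}" by auto
  then show ?thesis unfolding period_count_def by (simp add: card_cartesian_product)
qed

text \<open>Take t = a/b modulo p^k and use that C is homogeneous of degree 4. The zeros of C thus
  lie on one lattice a = t b for each root t.\<close>

lemma quartic_root_exists:
  assumes "prime p" "\<not> p dvd b" "p ^ k dvd quartic a b"
  shows "\<exists>t\<in>quartic_roots p k. [a = t * b] (mod p ^ k)"
proof -
  have cop: "coprime b (p ^ k)"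
    using assms(1,2) by (meson coprime_commute coprime_power_right_iff prime_imp_coprime)
  then obtain x where x: "[b * x = 1] (mod p ^ k)" using cong_solve_coprime_nat by fastforce
  define t where "t = (a * x) mod p ^ k"
  have t: "t < p ^ k" unfolding t_def using assms(1) by (simp add: prime_gt_0_nat)
  have "[t * b = (a * x) * b] (mod p ^ k)" unfolding t_def by (intro cong_mult) auto
  also have "(a * x) * b = a * (b * x)" by simp
  also have "[\<dots> = a * 1] (mod p ^ k)" by (intro cong_mult x cong_refl)
  finally have ab: "[a = t * b] (mod p ^ k)" by (simp add: cong_sym_eq)
  have "p ^ k dvd quartic (t * b) b"
    using quartic_cong[OF ab cong_refl[of b]] assms(3) by blast
  also have "quartic (t * b) b = b ^ 4 * quartic t 1"
    unfolding quartic_def by (simp add: poly_simps)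
  finally have "p ^ k dvd quartic t 1"
    using cop by (simp add: coprime_dvd_mult_right_iff coprime_commute)
  with t ab show ?thesis unfolding quartic_roots_def by auto
qed

text \<open>If p divides b, then C is congruent to a^4 modulo p, which would make p a common
  divisor.\<close>

lemma quartic_dvd_imp_not_dvd:
  assumes "prime p" "\<not> (p dvd a \<and> p dvd b)" "p ^ k dvd quartic a b" "k > 0"
  shows "\<not> p dvd b"
proof
  assume b: "p dvd b"
  have "p dvd quartic a b" using assms(3,4) by (meson dvd_power dvd_trans)
  moreover have "[quartic a b = a ^ 4 + 36 * a ^ 2 * 0 ^ 2 + 432 * 0 ^ 4] (mod p)"
    unfolding quartic_def using b by (intro cong_add cong_mult cong_pow cong_refl) (auto simp: cong_0_iff)
  ultimately have "p dvd a ^ 4" using cong_dvd_iff by auto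
  then have "p dvd a" using assms(1) prime_dvd_power by blast
  with b assms(2) show False by blast
qed

text \<open>The map (t, b) to (t b, b), with t a root modulo p^4 and b a unit, parametrises these
  zeros. Lifting makes the number of roots modulo p^4 equal to that modulo p.\<close>

lemma card_quartic_zeros:
  assumes "prime p" "p \<noteq> 2" "p \<noteq> 3"
  shows "card {(a, b). a < p ^ 4 \<and> b < p ^ 4 \<and> \<not> (p dvd a \<and> p dvd b) \<and> p ^ 4 dvd quartic a b}
    = root_count p * (p ^ 4 - p ^ 3)"
proof -
  let ?B = "{b. b < p * p ^ 3 \<and> \<not> p dvd b}"
  let ?f = "\<lambda>(t, b). (t * b mod p ^ 4, b)"
  have p0: "p > 0" using assms(1) by (simp add: prime_gt_0_nat)
  have cop: "coprime b (p ^ 4)" if "\<not> p dvd b" for b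
    using assms(1) that by (meson coprime_commute coprime_power_right_iff prime_imp_coprime)
  have inj: "inj_on ?f (quartic_roots p 4 \<times> ?B)"
  proof (rule inj_onI, clarify)
    fix t b t' b'
    assume t: "t \<in> quartic_roots p 4" "t' \<in> quartic_roots p 4" and b: "\<not> p dvd b'"
      "t * b' mod p ^ 4 = t' * b' mod p ^ 4"
    then have "[t * b' = t' * b'] (mod p ^ 4)" by (simp add: cong_def)
    then have "[t = t'] (mod p ^ 4)" using cop[OF b(1)] by (simp add: cong_mult_rcancel_nat)
    then show "t = t' \<and> b' = b'" using t by (simp add: cong_def quartic_roots_def)
  qed
  have "?f ` (quartic_roots p 4 \<times> ?B)
    = {(a, b). a < p ^ 4 \<and> b < p ^ 4 \<and> \<not> (p dvd a \<and> p dvd b) \<and> p ^ 4 dvd quartic a b}" (is "_ = ?S")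
  proof (intro equalityI subsetI)
    fix x assume "x \<in> ?f ` (quartic_roots p 4 \<times> ?B)"
    then obtain t b where x: "x = (t * b mod p ^ 4, b)" "p ^ 4 dvd quartic t 1" "b < p ^ 4" "\<not> p dvd b"
      by (auto simp: quartic_roots_def power_numeral_reduce)
    have "quartic (t * b) b = b ^ 4 * quartic t 1"
      unfolding quartic_def by (simp add: poly_simps)
    then have "p ^ 4 dvd quartic (t * b) b" using x(2) by simp
    moreover have "[t * b mod p ^ 4 = t * b] (mod p ^ 4)" by simp
    ultimately have "p ^ 4 dvd quartic (t * b mod p ^ 4) b" using quartic_cong cong_refl by blast
    then show "x \<in> ?S" using x p0 by simp
  next
    fix x assume "x \<in> ?S"
    then obtain a b where x: "x = (a, b)" "a < p ^ 4" "b < p ^ 4" "\<not> (p dvd a \<and> p dvd b)" "p ^ 4 dvd quartic a b"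
      by auto
    have b: "\<not> p dvd b" using quartic_dvd_imp_not_dvd[OF assms(1) x(4,5)] by simp
    obtain t where "t \<in> quartic_roots p 4" "[a = t * b] (mod p ^ 4)"
      using quartic_root_exists[OF assms(1) b x(5)] by blast
    then show "x \<in> ?f ` (quartic_roots p 4 \<times> ?B)"
      using x b by (intro image_eqI[of _ _ "(t, b)"]) (auto simp: cong_def power_numeral_reduce)
  qed
  then have "card ?S = card (quartic_roots p 4 \<times> ?B)" using card_image[OF inj] by simp
  also have "\<dots> = root_count p * (p * p ^ 3 - p ^ 3)"
    using card_nonmultiples_lessThan[OF p0, of "p ^ 3"] card_quartic_roots[OF assms, of 4]
    by (simp add: card_cartesian_product root_count_eq)
  finally show ?thesis by (simp add: power_numeral_reduce)
qed

text \<open>All local conditions in use have period p^4, so p^8 is the number of residue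
  pairs.\<close>

definition local_density :: "(nat \<Rightarrow> nat \<Rightarrow> bool) \<Rightarrow> nat \<Rightarrow> real" where
  "local_density P p = real (period_count P (p ^ 4)) / real p ^ 8"

lemma local_density_not_dvd:
  assumes "p > 0"
  shows "local_density (\<lambda>a b. \<not> p dvd a) p = 1 - 1 / real p"
proof -
  have "period_count (\<lambda>a b. \<not> p dvd a) (p ^ 4) = (p * p ^ 3 - p ^ 3) * p ^ 4"
    using period_count_prod_pred[of "\<lambda>a. \<not> p dvd a" "\<lambda>_. True" "p ^ 4"]
      card_nonmultiples_lessThan[OF assms, of "p ^ 3"] by (simp add: power_numeral_reduce)
  then show ?thesis
    using assms unfolding local_density_def by (simp add: of_nat_diff field_simps power_numeral_reduce)
qed

lemma local_density_dvd_not_dvd: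
  assumes "p > 0"
  shows "local_density (\<lambda>a b. p dvd a \<and> \<not> p dvd b) p = (1 - 1 / real p) / real p"
proof -
  have "period_count (\<lambda>a b. p dvd a \<and> \<not> p dvd b) (p ^ 4) = p ^ 3 * (p * p ^ 3 - p ^ 3)"
    using period_count_prod_pred[of "\<lambda>a. p dvd a" "\<lambda>b. \<not> p dvd b" "p ^ 4"]
      card_nonmultiples_lessThan[OF assms, of "p ^ 3"] card_multiples_lessThan[OF assms, of "p ^ 3"]
    by (simp add: power_numeral_reduce)
  then show ?thesis
    using assms unfolding local_density_def by (simp add: of_nat_diff field_simps power_numeral_reduce)
qed

lemma local_density_2_3:
  assumes "p = 2 \<or> p = 3"
  shows "local_density (local_good p) p = 1 - 1 / real p"
proof -
  have "local_good p = (\<lambda>a b. \<not> p dvd a)" using assms unfolding local_good_def by auto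
  then show ?thesis using assms local_density_not_dvd by auto
qed

text \<open>The bad residue pairs form two disjoint sets: p^6 pairs with both entries divisible by
  p, and the zeros counted in \<open>card_quartic_zeros\<close>. Divided by p^8 they are the two
  terms subtracted in the Euler factor.\<close>

lemma local_density_euler_factor:
  assumes "prime p" "p \<noteq> 2" "p \<noteq> 3"
  shows "local_density (local_good p) p = euler_factor p"
proof -
  have p0: "p > 0" using assms(1) by (simp add: prime_gt_0_nat)
  let ?U = "{..<p ^ 4} \<times> {..<p ^ 4}"
  let ?S1 = "{(a, b). a < p ^ 4 \<and> b < p ^ 4 \<and> p dvd a \<and> p dvd b}"
  let ?S2 = "{(a, b). a < p ^ 4 \<and> b < p ^ 4 \<and> \<not> (p dvd a \<and> p dvd b) \<and> p ^ 4 dvd quartic a b}"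
  let ?G = "{(a, b). a < p ^ 4 \<and> b < p ^ 4 \<and> local_good p a b}"
  have fin: "finite ?S1" "finite ?S2" "finite ?G"
    by (rule finite_subset[of _ ?U]; force)+
  have "?U = ?G \<union> (?S1 \<union> ?S2)" using assms by (auto simp: local_good_def)
  then have "card ?U = card (?G \<union> (?S1 \<union> ?S2))" by simp
  also have "\<dots> = card ?G + card (?S1 \<union> ?S2)"
    using fin assms by (intro card_Un_disjoint) (auto simp: local_good_def)
  also have "card (?S1 \<union> ?S2) = card ?S1 + card ?S2"
    using fin by (intro card_Un_disjoint) auto
  also have "card ?S1 = (p ^ 3) * (p ^ 3)"
    using card_multiples_lessThan[OF p0, of "p ^ 3"] period_count_prod_pred[of "\<lambda>a. p dvd a" "\<lambda>a. p dvd a" "p ^ 4"]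
    unfolding period_count_def by (simp add: power_numeral_reduce)
  also have "card ?S2 = root_count p * (p ^ 4 - p ^ 3)" by (rule card_quartic_zeros) fact+
  also have "card ?U = p ^ 8" by (simp add: card_cartesian_product flip: power_add)
  also have "card ?G = period_count (local_good p) (p ^ 4)" unfolding period_count_def ..
  finally have "real (p ^ 8) = real (period_count (local_good p) (p ^ 4) + (p ^ 3 * p ^ 3 + root_count p * (p ^ 4 - p ^ 3)))"
    by (simp only:)
  moreover have "real (p ^ 4 - p ^ 3) = real p ^ 4 - real p ^ 3"
    using p0 by (subst of_nat_diff) (auto intro: power_increasing)
  ultimately have "real (period_count (local_good p) (p ^ 4)) = real p ^ 8 - real p ^ 6 - root_count p * (real p ^ 4 - real p ^ 3)"
    by (simp flip: power_add)
  then show ?thesis using p0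
    unfolding local_density_def euler_factor_def by (simp add: field_simps power_numeral_reduce)
qed

section \<open>Tail estimates: pairs that fail only at a large prime\<close>

lemma sum_inverse_squares_le:
  assumes "z > 0"
  shows "(\<Sum>p\<in>{z<..N}. 1 / real p ^ 2) \<le> 1 / real z"
proof (cases "z \<le> N")
  case True
  \<comment> \<open>Subtracting 1 / N strengthens the claim so that the induction
    telescopes.\<close>
  then have "(\<Sum>p\<in>{z<..N}. 1 / real p ^ 2) \<le> 1 / real z - 1 / real N"
  proof (induction N rule: dec_induct)
    case (step N)
    have "{z<..Suc N} = insert (Suc N) {z<..N}" using step by auto
    then have "(\<Sum>p\<in>{z<..Suc N}. 1 / real p ^ 2) \<le> 1 / real (Suc N) ^ 2 + (1 / real z - 1 / real N)"
      using step by simp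
    also have "1 / real (Suc N) ^ 2 \<le> 1 / (real N * real (Suc N))"
      using assms step by (intro divide_left_mono) (auto simp: power2_eq_square)
    also have "\<dots> = 1 / real N - 1 / real (Suc N)"
      using assms step by (simp add: field_simps)
    finally show ?case by simp
  qed auto
  then show ?thesis using assms True by (smt (verit) divide_nonneg_nonneg of_nat_0_le_iff)
qed auto

text \<open>Each p > z contributes at most (N / p)^2 pairs, and the sum of 1 / p^2 over all integers
  above z is already at most 1 / z.\<close>

lemma card_common_multiples_le:
  assumes "z > 0"
  shows "real (card {(a, b). a \<in> {1..N} \<and> b \<in> {1..N} \<and> (\<exists>p>z. p dvd a \<and> p dvd b)})
    \<le> real N ^ 2 / real z" (is "real (card ?C) \<le> _")
proof -
  let ?S = "\<lambda>p. {a\<in>{1..N}. p dvd a} \<times> {a\<in>{1..N}. p dvd a}"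
  have c: "card {a\<in>{1..N}. p dvd a} = N div p" if "p > 0" for p
  proof -
    have "{a\<in>{1..N}. p dvd a} = (\<lambda>x. p * x) ` {1..N div p}"
      using that by (auto elim!: dvdE simp: less_eq_div_iff_mult_less_eq mult.commute)
    moreover have "inj_on (\<lambda>x. p * x) {1..N div p}" using that by (auto simp: inj_on_def)
    ultimately show ?thesis by (simp add: card_image)
  qed
  have "?C \<subseteq> (\<Union>p\<in>{z<..N}. ?S p)"
  proof clarify
    fix a b p assume ab: "a \<in> {1..N}" "b \<in> {1..N}" "z < p" "p dvd a" "p dvd b"
    then have "p \<le> N" using dvd_imp_le[of p a] by auto
    then show "(a, b) \<in> (\<Union>p\<in>{z<..N}. ?S p)" using ab by (intro UN_I[of p]) auto
  qed
  then have "card ?C \<le> card (\<Union>p\<in>{z<..N}. ?S p)"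
    by (intro card_mono) auto
  also have "\<dots> \<le> (\<Sum>p\<in>{z<..N}. card (?S p))" by (intro card_UN_le) auto
  also have "\<dots> = (\<Sum>p\<in>{z<..N}. (N div p) * (N div p))"
    using c by (intro sum.cong) (auto simp: card_cartesian_product)
  finally have "real (card ?C) \<le> real (\<Sum>p\<in>{z<..N}. (N div p) * (N div p))" by linarith
  also have "\<dots> \<le> (\<Sum>p\<in>{z<..N}. real N ^ 2 * (1 / real p ^ 2))"
    unfolding of_nat_sum
  proof (rule sum_mono)
    fix p assume "p \<in> {z<..N}"
    have "real (N div p) \<le> real N / real p" by (rule of_nat_div_le_of_nat)
    from mult_mono[OF this this] show "real ((N div p) * (N div p)) \<le> real N ^ 2 * (1 / real p ^ 2)"
      by (simp add: power2_eq_square)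
  qed
  also have "\<dots> = real N ^ 2 * (\<Sum>p\<in>{z<..N}. 1 / real p ^ 2)" by (simp add: sum_distrib_left)
  also have "\<dots> \<le> real N ^ 2 * (1 / real z)"
    using sum_inverse_squares_le[OF assms] by (intro mult_left_mono) auto
  finally show ?thesis by simp
qed

lemma card_residue_class_le:
  fixes m :: nat
  assumes "m > 0"
  shows "card {a \<in> {1..N}. [a = c] (mod m)} \<le> N div m + 1"
proof -
  have "inj_on (\<lambda>a. a div m) {a \<in> {1..N}. [a = c] (mod m)}"
  proof (rule inj_onI)
    fix a a' assume "a \<in> {a \<in> {1..N}. [a = c] (mod m)}" "a' \<in> {a \<in> {1..N}. [a = c] (mod m)}"
      "a div m = a' div m"
    then show "a = a'" unfolding cong_def by (metis (mono_tags, lifting) div_mult_mod_eq mem_Collect_eq)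
  qed
  then have "card {a \<in> {1..N}. [a = c] (mod m)} \<le> card {0..N div m}"
    by (rule card_inj_on_le) (auto intro: div_le_mono)
  then show ?thesis by simp
qed

text \<open>Each b leaves one residue class for a. The summand 1 costs N for every modulus, which is
  affordable only in the range p^2 < N.\<close>

lemma card_line_le:
  fixes m :: nat
  assumes "m > 0"
  shows "card {(a, b). a \<in> {1..N} \<and> b \<in> {1..N} \<and> [a = t * b] (mod m)}
    \<le> N * (N div m + 1)" (is "card ?L \<le> _")
proof -
  have "?L = (\<Union>b\<in>{1..N}. {a \<in> {1..N}. [a = t * b] (mod m)} \<times> {b})" by auto
  also have "card \<dots> \<le> (\<Sum>b\<in>{1..N}. card ({a \<in> {1..N}. [a = t * b] (mod m)} \<times> {b}))"
    by (intro card_UN_le) auto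
  also have "\<dots> \<le> (\<Sum>b\<in>{1..N}. N div m + 1)"
    using card_residue_class_le[OF assms] by (intro sum_mono) (simp add: card_cartesian_product)
  finally show ?thesis by simp
qed

text \<open>
  Two vectors of the lattice \<open>a \<equiv> t b\<close> modulo \<open>m\<close> have determinant divisible by \<open>m\<close>, so in a box of
  area at most \<open>m\<close> they are parallel.
\<close>
lemma card_coprime_line_le:
  fixes m :: nat
  assumes "N ^ 2 \<le> m"
  shows "card {(a, b). a \<in> {1..N} \<and> b \<in> {1..N} \<and> coprime a b \<and> [a = t * b] (mod m)} \<le> 1"
    (is "card ?S \<le> 1")
proof -
  have "finite ?S" by (rule finite_subset[of _ "{1..N} \<times> {1..N}"]) auto
  moreover have "x = y" if "x \<in> ?S" "y \<in> ?S" for x y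
  proof -
    obtain a b c d where xy: "x = (a, b)" "y = (c, d)" by (metis surj_pair)
    have ab: "a \<in> {1..N}" "b \<in> {1..N}" "coprime a b" "[a = t * b] (mod m)" using that xy by auto
    have cd: "c \<in> {1..N}" "d \<in> {1..N}" "coprime c d" "[c = t * d] (mod m)" using that xy by auto
    have "[a * d = (t * b) * d] (mod m)" using ab by (intro cong_mult cong_refl)
    also have "(t * b) * d = b * (t * d)" by simp
    also have "[\<dots> = b * c] (mod m)" using cd by (intro cong_mult cong_refl) (rule cong_sym)
    finally have "[int (a * d) = int (b * c)] (mod int m)" by (simp only: cong_int_iff)
    then have "int m dvd int (a * d) - int (b * c)" by (simp add: cong_iff_dvd_diff)
    moreover have "a * d \<le> N * N" "b * c \<le> N * N" "a * d \<ge> 1" "b * c \<ge> 1"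
      using ab cd by (auto intro: mult_mono)
    then have "\<bar>int (a * d) - int (b * c)\<bar> < int m" using assms unfolding power2_eq_square by linarith
    ultimately have "int (a * d) - int (b * c) = 0" by (metis dvd_imp_le_int not_less abs_of_nat)
    then have eq: "a * d = b * c" by linarith
    then have "a dvd b * c" "c dvd a * d" by (metis dvd_triv_left, metis dvd_triv_right)
    then have "a dvd c" "c dvd a" using ab(3) cd(3) by (simp_all add: coprime_dvd_mult_right_iff coprime_dvd_mult_left_iff)
    then have "a = c" by (rule dvd_antisym)
    with eq ab xy show ?thesis by auto
  qed
  ultimately show ?thesis by (simp only: One_nat_def card_le_Suc0_iff_eq) blast
qed

lemma quartic_le:
  assumes "a \<le> N" "b \<le> N"
  shows "quartic a b \<le> 469 * N ^ 4"
proof -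
  have "quartic a b \<le> N ^ 4 + 36 * N ^ 2 * N ^ 2 + 432 * N ^ 4"
    unfolding quartic_def using assms by (intro add_mono mult_mono power_mono) auto
  also have "\<dots> = 469 * N ^ 4" by (simp flip: power_add)
  finally show ?thesis .
qed

text \<open>The factor 4 bounds the number of roots, that is, of lattices. At p^2 >= N the index p^4
  reaches the area N^2 of the box and \<open>card_coprime_line_le\<close> takes over.\<close>

lemma card_coprime_quartic_zeros_le:
  assumes "prime p" "p \<noteq> 2" "p \<noteq> 3"
  shows "card {(a, b). a \<in> {1..N} \<and> b \<in> {1..N} \<and> coprime a b \<and> p ^ 4 dvd quartic a b}
    \<le> (if p ^ 2 < N then 4 * (N * (N div p ^ 4 + 1)) else 4)" (is "card ?Z \<le> _")
proof -
  let ?L = "\<lambda>t. {(a, b). a \<in> {1..N} \<and> b \<in> {1..N} \<and> coprime a b \<and> [a = t * b] (mod p ^ 4)}"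
  let ?L' = "\<lambda>t. {(a, b). a \<in> {1..N} \<and> b \<in> {1..N} \<and> [a = t * b] (mod p ^ 4)}"
  have fin: "finite (?L t)" for t by (rule finite_subset[of _ "{1..N} \<times> {1..N}"]) auto
  have L: "card (?L t) \<le> (if p ^ 2 < N then N * (N div p ^ 4 + 1) else 1)" for t
  proof (cases "p ^ 2 < N")
    case True
    have "card (?L t) \<le> card (?L' t)"
    proof (rule card_mono)
      show "finite (?L' t)"
        by (rule finite_subset[of _ "{1..N} \<times> {1..N}"]) auto
    qed auto
    also have "\<dots> \<le> N * (N div p ^ 4 + 1)"
      using assms by (intro card_line_le) (auto simp: prime_gt_0_nat)
    finally show ?thesis using True by simp
  next
    case False
    then have "N ^ 2 \<le> (p ^ 2) ^ 2" by (intro power_mono) auto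
    then show ?thesis using False card_coprime_line_le[of N "p ^ 4" t] by simp
  qed
  have "?Z \<subseteq> (\<Union>t\<in>quartic_roots p 4. ?L t)"
  proof clarify
    fix a b assume ab: "a \<in> {1..N}" "b \<in> {1..N}" "coprime a b" "p ^ 4 dvd quartic a b"
    have "\<not> (p dvd a \<and> p dvd b)" using ab(3) assms(1) by (meson coprime_common_divisor not_prime_unit)
    then have "\<not> p dvd b" using quartic_dvd_imp_not_dvd[OF assms(1) _ ab(4)] by simp
    then show "(a, b) \<in> (\<Union>t\<in>quartic_roots p 4. ?L t)"
      using quartic_root_exists[OF assms(1) _ ab(4)] ab by auto
  qed
  then have "card ?Z \<le> card (\<Union>t\<in>quartic_roots p 4. ?L t)"
    using fin by (intro card_mono) auto
  also have "\<dots> \<le> (\<Sum>t\<in>quartic_roots p 4. card (?L t))" by (intro card_UN_le) auto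
  also have "\<dots> \<le> (\<Sum>t\<in>quartic_roots p 4. if p ^ 2 < N then N * (N div p ^ 4 + 1) else 1)"
    using L by (intro sum_mono)
  also have "\<dots> = root_count p * (if p ^ 2 < N then N * (N div p ^ 4 + 1) else 1)"
    using card_quartic_roots[OF assms, of 4] by (simp add: root_count_eq)
  also have "\<dots> \<le> 4 * (if p ^ 2 < N then N * (N div p ^ 4 + 1) else 1)"
    using root_count_le[OF assms] by (rule mult_le_mono1)
  finally show ?thesis by (simp split: if_splits)
qed

text \<open>The first term is the area part of the lattice counts, the second the error 4 N for each
  of at most sqrt N primes with p^2 < N, the third four pairs for each of at most 5 N larger
  p.\<close>

lemma card_quartic_tail_le:
  assumes "z \<ge> 3"
  shows "real (card {(a, b). a \<in> {1..N} \<and> b \<in> {1..N} \<and> coprime a b \<and> (\<exists>p>z. prime p \<and> p ^ 4 dvd quartic a b)})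
    \<le> 4 * real N ^ 2 / real z + 4 * real N * sqrt (real N) + 20 * real N" (is "real (card ?T) \<le> _")
proof -
  let ?S = "\<lambda>p. {(a, b). a \<in> {1..N} \<and> b \<in> {1..N} \<and> coprime a b \<and> p ^ 4 dvd quartic a b}"
  let ?g = "\<lambda>p. if p ^ 2 < N then 4 * real N else 0" and ?I = "{z<..5 * N}"
  let ?P = "{p \<in> ?I. prime p}"
  have fin: "finite (?S p)" for p by (rule finite_subset[of _ "{1..N} \<times> {1..N}"]) auto
  have "?T \<subseteq> (\<Union>p\<in>?P. ?S p)"
  proof clarify
    fix a b p assume ab: "a \<in> {1..N}" "b \<in> {1..N}" "coprime a b" "z < p" "prime p" "p ^ 4 dvd quartic a b"
    have "quartic a b > 0" using ab unfolding quartic_def by simp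
    then have "p ^ 4 \<le> quartic a b" using ab(6) by (simp add: dvd_imp_le)
    also have "\<dots> \<le> 469 * N ^ 4" using ab by (intro quartic_le) auto
    \<comment> \<open>The bound 5 N comes from 469 <= 625 = 5^4.\<close>
    also have "\<dots> \<le> (5 * N) ^ 4" by (simp add: power_mult_distrib)
    finally have "p \<le> 5 * N" using power_mono_iff[of p "5 * N" 4] by simp
    then show "(a, b) \<in> (\<Union>p\<in>?P. ?S p)" using ab by auto
  qed
  then have "card ?T \<le> card (\<Union>p\<in>?P. ?S p)" using fin by (intro card_mono) auto
  also have "\<dots> \<le> (\<Sum>p\<in>?P. card (?S p))" by (intro card_UN_le) auto
  also have "\<dots> \<le> (\<Sum>p\<in>?P. if p ^ 2 < N then 4 * (N * (N div p ^ 4 + 1)) else 4)"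
    using assms by (intro sum_mono card_coprime_quartic_zeros_le) auto
  finally have "real (card ?T) \<le> real (\<Sum>p\<in>?P. if p ^ 2 < N then 4 * (N * (N div p ^ 4 + 1)) else 4)" by linarith
  \<comment> \<open>Weakening 1 / p^4 to 1 / p^2 lets the telescoping bound serve here too.\<close>
  also have "\<dots> \<le> (\<Sum>p\<in>?P. 4 * real N ^ 2 * (1 / real p ^ 2) + ?g p + 4)"
    unfolding of_nat_sum
  proof (rule sum_mono)
    fix p assume p: "p \<in> ?P"
    have "real (N div p ^ 4) \<le> real N / real (p ^ 4)" by (rule of_nat_div_le_of_nat)
    also have "\<dots> \<le> real N / real (p ^ 2)"
      using p prime_gt_0_nat[of p] by (intro divide_left_mono) (auto intro: power_increasing)
    finally have "real N * real (N div p ^ 4) \<le> real N * (real N / real (p ^ 2))" by (intro mult_left_mono) auto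
    then show "real (if p ^ 2 < N then 4 * (N * (N div p ^ 4 + 1)) else 4)
        \<le> 4 * real N ^ 2 * (1 / real p ^ 2) + ?g p + 4"
      by (simp add: distrib_left power2_eq_square mult.assoc)
  qed
  also have "\<dots> \<le> (\<Sum>p\<in>?I. 4 * real N ^ 2 * (1 / real p ^ 2) + ?g p + 4)"
    by (intro sum_mono2) auto
  also have "\<dots> = 4 * real N ^ 2 * (\<Sum>p\<in>?I. 1 / real p ^ 2)
      + (\<Sum>p\<in>?I. ?g p) + (\<Sum>p\<in>?I. 4)"
    by (simp add: sum.distrib sum_distrib_left)
  also have "\<dots> \<le> 4 * real N ^ 2 * (1 / real z) + 4 * real N * sqrt (real N) + 20 * real N"
  proof (intro add_mono)
    show "4 * real N ^ 2 * (\<Sum>p\<in>?I. 1 / real p ^ 2) \<le> 4 * real N ^ 2 * (1 / real z)"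
      using sum_inverse_squares_le[of z "5 * N"] assms by (intro mult_left_mono) auto
    let ?J = "{p \<in> ?I. p ^ 2 < N}"
    have "card ?J \<le> card {1..nat \<lfloor>sqrt (real N)\<rfloor>}"
    proof (rule card_mono, simp, rule subsetI)
      fix p assume "p \<in> ?J"
      then have p: "z < p" "p ^ 2 < N" by auto
      then have "real p ^ 2 \<le> real N" by (metis less_imp_le of_nat_le_iff of_nat_power)
      then have "real p \<le> sqrt (real N)" by (rule real_le_rsqrt)
      then show "p \<in> {1..nat \<lfloor>sqrt (real N)\<rfloor>}" using p by (simp add: le_nat_floor)
    qed
    then have "real (card ?J) \<le> real (nat \<lfloor>sqrt (real N)\<rfloor>)"
      by (simp only: of_nat_le_iff card_atLeastAtMost diff_Suc_1')
    also have "\<dots> \<le> sqrt (real N)" by (rule of_nat_floor) simp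
    finally have "real (card ?J) * (4 * real N) \<le> sqrt (real N) * (4 * real N)"
      by (intro mult_right_mono) auto
    moreover have "(\<Sum>p\<in>?I. ?g p) = real (card ?J) * (4 * real N)"
      by (simp flip: sum.inter_filter)
    ultimately show "(\<Sum>p\<in>?I. ?g p) \<le> 4 * real N * sqrt (real N)"
      by (simp only: mult_ac)
    show "(\<Sum>p\<in>?I. 4::real) \<le> 20 * real N" by simp
  qed
  finally show ?thesis by simp
qed

section \<open>Lattice points in a down-closed region\<close>

text \<open>Here f z is the count with conditions at primes up to z only, whose limit is known, and
  g is the full count. Because e does not depend on z, a large z can be fixed first to control l and
  r, and x is sent along F afterwards.\<close>

lemma tendsto_interchange:
  fixes f :: "nat \<Rightarrow> 'a \<Rightarrow> real"
  assumes "\<And>z. (f z \<longlongrightarrow> l z) F" "l \<longlonglongrightarrow> L" "r \<longlonglongrightarrow> 0" "(e \<longlongrightarrow> 0) F"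
    and le: "\<And>z. z \<ge> m \<Longrightarrow> eventually (\<lambda>x. \<bar>f z x - g x\<bar> \<le> r z + e x) F"
  shows "(g \<longlongrightarrow> L) F"
proof (rule tendstoI)
  fix \<epsilon> :: real assume "\<epsilon> > 0"
  then have e4: "\<epsilon> / 4 > 0" by simp
  have "eventually (\<lambda>z. \<bar>l z - L\<bar> < \<epsilon> / 4 \<and> \<bar>r z\<bar> < \<epsilon> / 4 \<and> z \<ge> m) sequentially"
    using tendstoD[OF assms(2) e4] tendstoD[OF assms(3) e4] eventually_ge_at_top[of m]
    by eventually_elim (simp add: dist_real_def)
  then obtain z where z: "\<bar>l z - L\<bar> < \<epsilon> / 4" "\<bar>r z\<bar> < \<epsilon> / 4" "z \<ge> m"
    by (auto simp: eventually_at_top_linorder)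
  show "eventually (\<lambda>x. dist (g x) L < \<epsilon>) F"
    using tendstoD[OF assms(1)[of z] e4] tendstoD[OF assms(4) e4] le[OF z(3)]
  proof eventually_elim
    case (elim x)
    then show ?case using z(1,2) unfolding dist_real_def by (simp add: abs_if split: if_splits)
  qed
qed

text \<open>Down-closedness replaces any discussion of the boundary: a grid square lies in D once
  its upper right corner does, and a square away from the axes that meets D has its lower left
  corner in D.\<close>

locale down_region =
  fixes D :: "(real \<times> real) set" and K :: real
  assumes sets_D [measurable]: "D \<in> sets borel"
    and bounded_D: "(u, v) \<in> D \<Longrightarrow> 0 < u \<and> u \<le> K \<and> 0 < v \<and> v \<le> K"
    and down: "(u, v) \<in> D \<Longrightarrow> 0 < u' \<Longrightarrow> u' \<le> u \<Longrightarrow> 0 < v' \<Longrightarrow> v' \<le> v \<Longrightarrow> (u', v') \<in> D"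
    and K_pos: "K > 0"
begin

definition grid :: "real \<Rightarrow> (nat \<times> nat) set" where
  "grid h = {(i, j). (real (i + 1) * h, real (j + 1) * h) \<in> D}"

lemma finite_grid: assumes "h > 0" shows "finite (grid h)"
proof (rule finite_subset)
  show "grid h \<subseteq> {..nat \<lfloor>K / h\<rfloor>} \<times> {..nat \<lfloor>K / h\<rfloor>}"
  proof (clarsimp simp: grid_def)
    fix i j :: nat assume "((1 + real i) * h, (1 + real j) * h) \<in> D"
    then have "(1 + real i) * h \<le> K" "(1 + real j) * h \<le> K" using bounded_D by blast+
    then have "real i \<le> K / h" "real j \<le> K / h"
      using assms by (auto simp: field_simps)
    then show "i \<le> nat \<lfloor>K / h\<rfloor> \<and> j \<le> nat \<lfloor>K / h\<rfloor>" by (simp add: le_nat_floor)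
  qed
qed auto

definition cell :: "real \<Rightarrow> nat \<times> nat \<Rightarrow> (real \<times> real) set" where
  "cell h = (\<lambda>(i, j). {real i * h<..real (i + 1) * h} \<times> {real j * h<..real (j + 1) * h})"

lemma emeasure_rectangle:
  assumes "a \<le> b" "c \<le> d"
  shows "emeasure lborel ({a<..b::real} \<times> {c<..d::real}) = ennreal ((b - a) * (d - c))"
  using assms unfolding lborel_prod[symmetric]
  by (subst lborel.emeasure_pair_measure_Times) (auto simp: ennreal_mult)

lemma sets_rectangle [measurable]: "{a<..b::real} \<times> {c<..d::real} \<in> sets borel"
  unfolding borel_prod[symmetric] by (intro pair_measureI) auto

lemma emeasure_cell: assumes "h > 0" shows "emeasure lborel (cell h x) = ennreal (h ^ 2)"
  using assms by (cases x) (simp add: cell_def emeasure_rectangle algebra_simps power2_eq_square)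

lemma sets_cell [measurable]: "cell h x \<in> sets borel"
  by (cases x) (simp add: cell_def sets_rectangle)

lemma cell_index:
  assumes "h > 0" "u > 0"
  obtains i :: nat where "real i * h < u" "u \<le> real (i + 1) * h"
proof -
  define i where "i = nat (\<lceil>u / h\<rceil> - 1)"
  have "\<lceil>u / h\<rceil> > 0" using assms by simp
  then have "real i = of_int \<lceil>u / h\<rceil> - 1" unfolding i_def by simp
  then have "real i < u / h" "u / h \<le> real (i + 1)" by linarith+
  then have "real i * h < u" "u \<le> real (i + 1) * h" using assms by (simp_all add: field_simps)
  then show thesis by (rule that)
qed

lemma cell_disjoint:
  assumes "h > 0" "p \<in> cell h x" "p \<in> cell h y"
  shows "x = y"
proof -
  have "i \<le> i'" if "real i * h < u" "u \<le> real (i' + 1) * h" for i i' :: nat and u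
  proof -
    have "real i * h < real (i' + 1) * h" using that by linarith
    then have "real i < real (i' + 1)" using assms(1) by (simp only: mult_less_cancel_right_pos)
    then show ?thesis by linarith
  qed
  note le = this
  obtain u v i j i' j' where pxy: "p = (u, v)" "x = (i, j)" "y = (i', j')" by (metis surj_pair)
  then have "real i * h < u" "u \<le> real (i + 1) * h" "real i' * h < u" "u \<le> real (i' + 1) * h"
    "real j * h < v" "v \<le> real (j + 1) * h" "real j' * h < v" "v \<le> real (j' + 1) * h"
    using assms(2,3) by (simp_all only: cell_def case_prod_conv mem_Times_iff fst_conv snd_conv greaterThanAtMost_iff)
  then show ?thesis unfolding pxy using le by (simp only: prod.inject) (meson antisym)
qed

lemma emeasure_D_finite: "emeasure lborel D < \<infinity>"
proof -
  have "emeasure lborel D \<le> emeasure lborel ({0<..K} \<times> {0<..K})"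
    using bounded_D by (intro emeasure_mono) auto
  also have "\<dots> < \<infinity>" using K_pos by (simp add: emeasure_rectangle)
  finally show ?thesis .
qed

lemma area_ge: assumes "h > 0" shows "real (card (grid h)) * h ^ 2 \<le> measure lborel D"
proof -
  have "ennreal (real (card (grid h)) * h ^ 2) = (\<Sum>x\<in>grid h. emeasure lborel (cell h x))"
    using assms by (simp add: emeasure_cell ennreal_mult ennreal_of_nat_eq_real_of_nat)
  also have "\<dots> = emeasure lborel (\<Union>x\<in>grid h. cell h x)"
    using finite_grid[OF assms] cell_disjoint[OF assms]
    by (intro sum_emeasure) (auto simp: disjoint_family_on_def)
  also have "\<dots> \<le> emeasure lborel D"
  proof (rule emeasure_mono)
    show "(\<Union>x\<in>grid h. cell h x) \<subseteq> D"
    proof (clarsimp simp: cell_def grid_def)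
      fix i j :: nat and u v :: real
      assume *: "((1 + real i) * h, (1 + real j) * h) \<in> D" "real i * h < u" "u \<le> (1 + real i) * h"
        "real j * h < v" "v \<le> (1 + real j) * h"
      have "u > 0" "v > 0" using * assms by (meson le_less_trans mult_nonneg_nonneg of_nat_0_le_iff less_imp_le)+
      then show "(u, v) \<in> D" using down * by blast
    qed
  qed (simp add: sets_D)
  also have "\<dots> = ennreal (measure lborel D)"
    using emeasure_D_finite by (simp add: emeasure_eq_ennreal_measure less_top)
  finally show ?thesis by simp
qed

text \<open>Outside the two strips of width h along the axes, a point of D lies in a square whose
  lower left corner belongs to D. This corner is the upper right corner of the diagonally preceding
  square, which is therefore in the grid; so the grid squares shifted by (1, 1), together with the
  strips, cover D.\<close>

lemma area_le: assumes "h > 0" shows "measure lborel D \<le> real (card (grid h)) * h ^ 2 + 2 * h * K"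
proof -
  let ?s = "\<lambda>(i, j). (i + 1, j + 1)"
  let ?A = "{0<..h} \<times> {0<..K}" and ?B = "{0<..K} \<times> {0<..h}" and ?C = "\<Union>x\<in>grid h. cell h (?s x)"
  have "D \<subseteq> ?C \<union> (?A \<union> ?B)"
  proof (rule subsetI, rule ccontr)
    fix x assume x: "x \<in> D" "x \<notin> ?C \<union> (?A \<union> ?B)"
    obtain u v where "x = (u, v)" by (metis surj_pair)
    with x have uv: "(u, v) \<in> D" "(u, v) \<notin> ?C" "(u, v) \<notin> ?A" "(u, v) \<notin> ?B" by auto
    then have pos: "u > h" "v > h" "u > 0" "v > 0" using bounded_D[OF uv(1)] by auto
    obtain i where i: "real i * h < u" "u \<le> real (i + 1) * h" using cell_index[OF assms pos(3)] .
    obtain j where j: "real j * h < v" "v \<le> real (j + 1) * h" using cell_index[OF assms pos(4)] .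
    have "i \<noteq> 0" "j \<noteq> 0" using i j pos by (auto intro: ccontr)
    then obtain i' j' where ij: "i = i' + 1" "j = j' + 1" by (metis Suc_eq_plus1 not0_implies_Suc)
    have "(real (i' + 1) * h, real (j' + 1) * h) \<in> D"
      using i j assms unfolding ij by (intro down[OF uv(1)]) auto
    then have "(i', j') \<in> grid h" unfolding grid_def by simp
    moreover have "(u, v) \<in> cell h (?s (i', j'))" using i j unfolding ij cell_def by auto
    ultimately show False using uv(2) by blast
  qed
  then have "emeasure lborel D \<le> emeasure lborel (?C \<union> (?A \<union> ?B))"
    using finite_grid[OF assms]
    by (intro emeasure_mono) (auto intro!: sets.Un sets.finite_UN simp: sets_cell sets_rectangle)
  also have "\<dots> \<le> emeasure lborel ?C + emeasure lborel (?A \<union> ?B)"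
    using finite_grid[OF assms]
    by (intro emeasure_subadditive) (auto intro!: sets.Un sets.finite_UN simp: sets_cell sets_rectangle)
  also have "emeasure lborel (?A \<union> ?B) \<le> emeasure lborel ?A + emeasure lborel ?B"
    by (intro emeasure_subadditive) (auto simp: sets_rectangle)
  also have "\<dots> = ennreal (2 * h * K)"
    using assms K_pos by (simp add: emeasure_rectangle flip: ennreal_plus)
  also have "emeasure lborel ?C \<le> (\<Sum>x\<in>grid h. emeasure lborel (cell h (?s x)))"
    using finite_grid[OF assms] by (intro emeasure_subadditive_finite) (auto simp: sets_cell)
  also have "\<dots> = ennreal (real (card (grid h)) * h ^ 2)"
    using assms by (simp add: emeasure_cell ennreal_mult ennreal_of_nat_eq_real_of_nat)
  finally have "emeasure lborel D \<le> ennreal (real (card (grid h)) * h ^ 2) + ennreal (2 * h * K)"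
    by (auto intro: add_mono)
  then have "emeasure lborel D \<le> ennreal (real (card (grid h)) * h ^ 2 + 2 * h * K)"
    using assms K_pos by simp
  then show ?thesis
    using assms K_pos by (simp add: measure_def enn2real_leI)
qed

section \<open>Integer points with periodic conditions in the dilated region\<close>

definition points :: "(nat \<Rightarrow> nat \<Rightarrow> bool) \<Rightarrow> real \<Rightarrow> (nat \<times> nat) set" where
  "points P T = {(a, b). (real a / T, real b / T) \<in> D \<and> P a b}"

lemma points_bounded:
  assumes "T > 0" "(a, b) \<in> points P T"
  shows "a \<in> {1..nat \<lfloor>K * T\<rfloor>}" "b \<in> {1..nat \<lfloor>K * T\<rfloor>}"
proof -
  have "0 < real a / T \<and> real a / T \<le> K \<and> 0 < real b / T \<and> real b / T \<le> K"
    using assms(2) bounded_D unfolding points_def by blast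
  then have "0 < a" "0 < b" "real a \<le> K * T" "real b \<le> K * T"
    using assms(1) by (auto simp: field_simps zero_less_divide_iff)
  then show "a \<in> {1..nat \<lfloor>K * T\<rfloor>}" "b \<in> {1..nat \<lfloor>K * T\<rfloor>}"
    by (auto simp: le_nat_floor Suc_le_eq)
qed

lemma finite_points: assumes "T > 0" shows "finite (points P T)"
  using points_bounded[OF assms]
  by (intro finite_subset[of "points P T" "{1..nat \<lfloor>K * T\<rfloor>} \<times> {1..nat \<lfloor>K * T\<rfloor>}"]) auto

definition block :: "nat \<Rightarrow> (nat \<Rightarrow> nat \<Rightarrow> bool) \<Rightarrow> nat \<times> nat \<Rightarrow> (nat \<times> nat) set" where
  "block M P = (\<lambda>(i, j). {(a, b). i * M < a \<and> a \<le> (i + 1) * M \<and> j * M < b \<and> b \<le> (j + 1) * M \<and> P a b})"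

lemma finite_block: "finite (block M P x)"
  by (cases x, rule finite_subset[of _ "{..(fst x + 1) * M} \<times> {..(snd x + 1) * M}"]) (auto simp: block_def)

lemma block_disjoint:
  assumes "p \<in> block M P x" "p \<in> block M P y"
  shows "x = y"
proof -
  have "i \<le> i'" if "i * M < a" "a \<le> (i' + 1) * M" for i i' a
  proof -
    have "i * M < (i' + 1) * M" using that by linarith
    then show ?thesis by (simp only: mult_less_cancel2) simp
  qed
  note le = this
  obtain a b i j i' j' where pxy: "p = (a, b)" "x = (i, j)" "y = (i', j')" by (metis surj_pair)
  then have "i * M < a" "a \<le> (i + 1) * M" "i' * M < a" "a \<le> (i' + 1) * M"
    "j * M < b" "b \<le> (j + 1) * M" "j' * M < b" "b \<le> (j' + 1) * M"
    using assms by (simp_all only: block_def case_prod_conv mem_Collect_eq)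
  then show ?thesis unfolding pxy using le by (simp only: prod.inject) (meson antisym)
qed

text \<open>Dilated by T, a square of side M / T becomes a block of M by M integers, which contains
  exactly \<open>period_count P M\<close> solutions.\<close>

lemma card_points_ge:
  assumes "periodic2 M P" "M > 0" "T > 0"
  shows "period_count P M * card (grid (M / T)) \<le> card (points P T)"
proof -
  have h: "real M / T > 0" using assms by simp
  have "period_count P M * card (grid (M / T)) = (\<Sum>x\<in>grid (M / T). card (block M P x))"
    using card_block[OF assms(1,2)] by (simp add: block_def case_prod_unfold)
  also have "\<dots> = card (\<Union>x\<in>grid (M / T). block M P x)"
    using finite_grid[OF h] finite_block block_disjoint
    by (intro card_UN_disjoint[symmetric]) blast+
  also have "\<dots> \<le> card (points P T)"
  proof (rule card_mono[OF finite_points[OF assms(3)]], clarsimp simp: block_def points_def grid_def)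
    fix i j a b :: nat
    assume *: "((1 + real i) * real M / T, (1 + real j) * real M / T) \<in> D"
      "i * M < a" "a \<le> M + i * M" "j * M < b" "b \<le> M + j * M"
    have "real a \<le> (1 + real i) * real M" "real b \<le> (1 + real j) * real M"
      using *(3,5) by (auto simp: algebra_simps simp flip: of_nat_mult of_nat_add)
    moreover have "a > 0" "b > 0" using * by auto
    ultimately show "(real a / T, real b / T) \<in> D"
      using assms(3) by (intro down[OF *(1)]) (auto intro: divide_right_mono)
  qed
  finally show ?thesis .
qed

text \<open>The integer version of \<open>area_le\<close>: diagonally shifted blocks and two strips
  of width M, whose contribution is only linear in T.\<close>

lemma card_points_le:
  assumes "periodic2 M P" "M > 0" "T > 0"
  shows "real (card (points P T)) \<le> real (period_count P M * card (grid (M / T))) + 2 * real M * (K * T)"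
proof -
  let ?N = "nat \<lfloor>K * T\<rfloor>" and ?s = "\<lambda>(i, j). (i + 1, j + 1)"
  let ?A = "{1..M} \<times> {1..?N}" and ?B = "{1..?N} \<times> {1..M}" and ?C = "\<Union>x\<in>grid (M / T). block M P (?s x)"
  have h: "real M / T > 0" using assms by simp
  have idx: "\<exists>i. i * M < a \<and> a \<le> (i + 1) * M" if "a > 0" for a
  proof (intro exI conjI)
    show "(a - 1) div M * M < a" using that by (metis div_times_less_eq_dividend le_less_trans diff_less zero_less_one)
    show "a \<le> ((a - 1) div M + 1) * M"
      using dividend_less_div_times[OF assms(2), of "a - 1"] that by (simp add: algebra_simps)
  qed
  have "points P T \<subseteq> ?C \<union> (?A \<union> ?B)"
  proof (rule subsetI, rule ccontr)
    fix x assume x: "x \<in> points P T" "x \<notin> ?C \<union> (?A \<union> ?B)"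
    obtain a b where "x = (a, b)" by (metis surj_pair)
    with x have ab: "(a, b) \<in> points P T" "(a, b) \<notin> ?C" "(a, b) \<notin> ?A" "(a, b) \<notin> ?B" by auto
    then have D: "(real a / T, real b / T) \<in> D" and P: "P a b" by (auto simp: points_def)
    have pos: "a > M" "b > M" "a > 0" "b > 0" using points_bounded[OF assms(3) ab(1)] ab(3,4) by auto
    obtain i j where ij: "i * M < a" "a \<le> (i + 1) * M" "j * M < b" "b \<le> (j + 1) * M"
      using idx pos(3,4) by meson
    have "i \<noteq> 0" "j \<noteq> 0" using ij pos by (auto intro: ccontr)
    then obtain i' j' where ij': "i = i' + 1" "j = j' + 1" by (metis Suc_eq_plus1 not0_implies_Suc)
    have "real (i * M) \<le> real a" "real (j * M) \<le> real b" using ij by linarith+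
    then have "(real (i' + 1) * (M / T), real (j' + 1) * (M / T)) \<in> D"
      using assms(2,3) unfolding ij' times_divide_eq_right
      by (intro down[OF D] divide_right_mono) (auto simp: field_simps intro!: add_pos_nonneg)
    then have "(i', j') \<in> grid (M / T)" unfolding grid_def by simp
    moreover have "(a, b) \<in> block M P (?s (i', j'))" using ij P unfolding ij' block_def by auto
    ultimately show False using ab(2) by blast
  qed
  then have "card (points P T) \<le> card (?C \<union> (?A \<union> ?B))"
    using finite_grid[OF h] finite_block by (intro card_mono) auto
  also have "\<dots> \<le> card ?C + card (?A \<union> ?B)" by (rule card_Un_le)
  also have "\<dots> \<le> card ?C + (card ?A + card ?B)" by (intro add_left_mono card_Un_le)
  also have "card ?C \<le> (\<Sum>x\<in>grid (M / T). card (block M P (?s x)))"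
    using finite_grid[OF h] by (intro card_UN_le)
  also have "\<dots> = period_count P M * card (grid (M / T))"
    using card_block[OF assms(1,2), of "_ + 1" "_ + 1"] by (simp add: block_def case_prod_unfold)
  also have "card ?A + card ?B = 2 * M * ?N" by (simp add: card_cartesian_product)
  finally have "real (card (points P T)) \<le> real (period_count P M * card (grid (M / T)) + 2 * M * ?N)"
    by (simp only: of_nat_le_iff)
  also have "\<dots> \<le> real (period_count P M * card (grid (M / T))) + 2 * real M * (K * T)"
    using K_pos assms by (auto intro!: mult_left_mono of_nat_floor)
  finally show ?thesis .
qed

text \<open>Area and point count are both compared with the number of grid squares of side M / T.
  Eliminating that number leaves an error of order 1 / T after division by T^2.\<close>

lemma card_points_asymp:
  assumes "periodic2 M P" "M > 0"
  shows "((\<lambda>T. real (card (points P T)) / T ^ 2) \<longlongrightarrow> real (period_count P M) / real M ^ 2 * measure lborel D) at_top"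
proof (rule tendsto_sandwich)
  let ?n = "real (period_count P M)" and ?m = "measure lborel D"
  show "eventually (\<lambda>T. ?n / real M ^ 2 * ?m - 2 * ?n * K / real M / T \<le> real (card (points P T)) / T ^ 2) at_top"
    using eventually_gt_at_top[of 0]
  proof eventually_elim
    case (elim T)
    have h: "real M / T > 0" using assms elim by simp
    have "?n * ?m \<le> ?n * (real (card (grid (M / T))) * (M / T) ^ 2 + 2 * (M / T) * K)"
      using area_le[OF h] by (intro mult_left_mono) auto
    also have "\<dots> = (?n * real (card (grid (M / T)))) * (M / T) ^ 2 + 2 * ?n * (M / T) * K"
      by (simp add: algebra_simps)
    also have "\<dots> \<le> real (card (points P T)) * (M / T) ^ 2 + 2 * ?n * (M / T) * K"
      using card_points_ge[OF assms elim]
      by (intro add_right_mono mult_right_mono) (simp_all flip: of_nat_mult)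
    finally have "(?n * ?m - 2 * ?n * (M / T) * K) / real M ^ 2 \<le> real (card (points P T)) * (M / T) ^ 2 / real M ^ 2"
      by (intro divide_right_mono) auto
    then show ?case using assms by (simp add: diff_divide_distrib power_divide power2_eq_square mult_ac)
  qed
  show "eventually (\<lambda>T. real (card (points P T)) / T ^ 2 \<le> ?n / real M ^ 2 * ?m + 2 * real M * K / T) at_top"
    using eventually_gt_at_top[of 0]
  proof eventually_elim
    case (elim T)
    have h: "real M / T > 0" using assms elim by simp
    have "real (card (points P T)) * (M / T) ^ 2
        \<le> (?n * real (card (grid (M / T))) + 2 * real M * (K * T)) * (M / T) ^ 2"
      using card_points_le[OF assms elim] by (intro mult_right_mono) auto
    also have "\<dots> = ?n * (real (card (grid (M / T))) * (M / T) ^ 2) + 2 * real M * (K * T) * (M / T) ^ 2"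
      by (simp add: algebra_simps)
    also have "\<dots> \<le> ?n * ?m + 2 * real M * (K * T) * (M / T) ^ 2"
      using area_ge[OF h] by (intro add_right_mono mult_left_mono) auto
    finally have "real (card (points P T)) * (M / T) ^ 2 / real M ^ 2
        \<le> (?n * ?m + 2 * real M * (K * T) * (M / T) ^ 2) / real M ^ 2"
      by (intro divide_right_mono) auto
    then show ?case using assms elim by (simp add: add_divide_distrib power_divide power2_eq_square mult_ac)
  qed
  have lim0: "((\<lambda>T. c / T) \<longlongrightarrow> 0) at_top" for c :: real
    by (rule tendsto_divide_0[OF tendsto_const filterlim_at_top_imp_at_infinity[OF filterlim_ident]])
  show "((\<lambda>T. ?n / real M ^ 2 * ?m - 2 * ?n * K / real M / T) \<longlongrightarrow> ?n / real M ^ 2 * ?m) at_top"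
    using tendsto_diff[OF tendsto_const lim0[of "2 * ?n * K / real M"]] by simp
  show "((\<lambda>T. ?n / real M ^ 2 * ?m + 2 * real M * K / T) \<longlongrightarrow> ?n / real M ^ 2 * ?m) at_top"
    using tendsto_add[OF tendsto_const lim0[of "2 * real M * K"]] by simp
qed

text \<open>The conditions G p are free at primes up to z0, so that the same sieve serves
  \<open>local_good\<close> and its modification at 5.\<close>

lemma sieve_asymp:
  assumes per: "\<And>p. prime p \<Longrightarrow> periodic2 (p ^ 4) (G p)"
    and tail: "\<And>p. prime p \<Longrightarrow> p > z0 \<Longrightarrow> G p = local_good p" and z0: "z0 \<ge> 3"
    and cop: "\<And>p a b. prime p \<Longrightarrow> G p a b \<Longrightarrow> \<not> (p dvd a \<and> p dvd b)"
    and lim: "(\<lambda>z. \<Prod>p | prime p \<and> p \<le> z. local_density (G p) p) \<longlonglongrightarrow> \<delta>"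
  shows "((\<lambda>T. real (card (points (\<lambda>a b. \<forall>p. prime p \<longrightarrow> G p a b) T)) / T ^ 2)
    \<longlongrightarrow> \<delta> * measure lborel D) at_top"
proof -
  let ?ps = "\<lambda>z. {p. prime p \<and> p \<le> (z::nat)}"
  define Q where "Q z a b \<longleftrightarrow> (\<forall>p\<in>?ps z. G p a b)" for z a b
  define M where "M z = (\<Prod>p\<in>?ps z. p ^ 4)" for z
  let ?all = "\<lambda>a b. \<forall>p. prime p \<longrightarrow> G p a b"
  have fin: "finite (?ps z)" for z by (rule finite_subset[of _ "{..z}"]) auto
  have Mpos: "M z > 0" for z unfolding M_def by (auto intro!: prod_pos simp: prime_gt_0_nat)
  have "periodic2 (M z) (Q z) \<and> period_count (Q z) (M z) = (\<Prod>p\<in>?ps z. period_count (G p) (p ^ 4))" for z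
    unfolding Q_def M_def using fin per by (intro period_count_prod) auto
  then have perQ: "periodic2 (M z) (Q z)"
    and cnt: "period_count (Q z) (M z) = (\<Prod>p\<in>?ps z. period_count (G p) (p ^ 4))" for z by blast+
  have dens: "real (period_count (Q z) (M z)) / real (M z) ^ 2 = (\<Prod>p\<in>?ps z. local_density (G p) p)" for z
  proof -
    have "real (M z) ^ 2 = (\<Prod>p\<in>?ps z. real p ^ 8)"
      unfolding M_def of_nat_prod of_nat_power prod_power_distrib by (simp flip: power_mult)
    then show ?thesis unfolding cnt local_density_def by (simp add: prod_dividef)
  qed
  show ?thesis
  proof (rule tendsto_interchange[where m = z0])
    show "((\<lambda>T. real (card (points (Q z) T)) / T ^ 2)
        \<longlongrightarrow> (\<Prod>p\<in>?ps z. local_density (G p) p) * measure lborel D) at_top" for z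
      using card_points_asymp[OF perQ Mpos] unfolding dens .
    show "(\<lambda>z. (\<Prod>p\<in>?ps z. local_density (G p) p) * measure lborel D) \<longlonglongrightarrow> \<delta> * measure lborel D"
      by (intro tendsto_mult lim tendsto_const)
    \<comment> \<open>Common factors contribute K^2 / z and the quartic tail 4 K^2 / z.\<close>
    show "(\<lambda>z. 5 * K ^ 2 / real z) \<longlonglongrightarrow> 0" by (rule lim_const_over_n)
    show "((\<lambda>T. 4 * K * sqrt K / sqrt T + 20 * K / T) \<longlongrightarrow> 0) at_top"
      using tendsto_add[OF tendsto_divide_0[OF tendsto_const filterlim_at_top_imp_at_infinity[OF sqrt_at_top]]
          tendsto_divide_0[OF tendsto_const filterlim_at_top_imp_at_infinity[OF filterlim_ident]]] by simp
    fix z assume z: "z \<ge> z0"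
    show "eventually (\<lambda>T. \<bar>real (card (points (Q z) T)) / T ^ 2 - real (card (points ?all T)) / T ^ 2\<bar>
        \<le> 5 * K ^ 2 / real z + (4 * K * sqrt K / sqrt T + 20 * K / T)) at_top"
      using eventually_gt_at_top[of 0]
    proof eventually_elim
      case (elim T)
      let ?N = "nat \<lfloor>K * T\<rfloor>"
      let ?A = "{(a, b). a \<in> {1..?N} \<and> b \<in> {1..?N} \<and> (\<exists>p>z. p dvd a \<and> p dvd b)}"
      let ?B = "{(a, b). a \<in> {1..?N} \<and> b \<in> {1..?N} \<and> coprime a b \<and> (\<exists>p>z. prime p \<and> p ^ 4 dvd quartic a b)}"
      let ?D = "points (Q z) T - points ?all T"
      have finAB: "finite ?A" "finite ?B" by (rule finite_subset[of _ "{1..?N} \<times> {1..?N}"]; auto)+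
      have sub: "points ?all T \<subseteq> points (Q z) T" unfolding points_def Q_def by auto
      \<comment> \<open>A pair that passes up to z but fails later is of one of two kinds. If it is
        coprime, it fails at some p > z, necessarily through p^4 dividing C. If not, it has a common
        prime factor, which the conditions up to z force to exceed z.\<close>
      have "?D \<subseteq> ?A \<union> ?B"
      proof (rule subsetI, rule ccontr)
        fix x assume x: "x \<in> ?D" "x \<notin> ?A \<union> ?B"
        obtain a b where "x = (a, b)" by (metis surj_pair)
        with x have ab: "(a, b) \<in> points (Q z) T" "(a, b) \<notin> points ?all T" "(a, b) \<notin> ?A" "(a, b) \<notin> ?B"
          by blast+
        note bd = points_bounded[OF elim ab(1)]
        obtain p where p: "prime p" "\<not> G p a b" using ab by (auto simp: points_def)
        have Q: "G q a b" if "prime q" "q \<le> z" for q using ab(1) that by (auto simp: points_def Q_def)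
        have pz: "p > z" using p Q by (meson not_less)
        show False
        proof (cases "coprime a b")
          case True
          have "p \<noteq> 2" "p \<noteq> 3" using pz z z0 by auto
          moreover have "\<not> (p dvd a \<and> p dvd b)" using True p(1) by (meson coprime_common_divisor not_prime_unit)
          ultimately have "p ^ 4 dvd quartic a b" using p(2) tail[OF p(1)] pz z by (simp add: local_good_def)
          then show ?thesis using ab(4) bd True p(1) pz by blast
        next
          case False
          then obtain q where q: "prime q" "q dvd a" "q dvd b" by (meson coprime_iff_gcd_eq_1 gcd_dvd1 gcd_dvd2 dvd_trans prime_factor_nat)
          then have "q > z" using Q cop by (meson not_less)
          then show ?thesis using q bd ab(3) by blast
        qed
      qed
      then have "card (?D) \<le> card (?A \<union> ?B)"
        using finAB by (intro card_mono) auto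
      also have "\<dots> \<le> card ?A + card ?B" by (rule card_Un_le)
      finally have "real (card (?D)) \<le> real (card ?A) + real (card ?B)" by simp
      also have "\<dots> \<le> real ?N ^ 2 / real z + (4 * real ?N ^ 2 / real z + 4 * real ?N * sqrt (real ?N) + 20 * real ?N)"
        using z z0 by (intro add_mono card_common_multiples_le card_quartic_tail_le) auto
      also have "\<dots> = 5 * real ?N ^ 2 / real z + 4 * real ?N * sqrt (real ?N) + 20 * real ?N"
        by (simp add: field_simps)
      also have "\<dots> \<le> 5 * (K * T) ^ 2 / real z + 4 * (K * T) * sqrt (K * T) + 20 * (K * T)"
      proof -
        have "real ?N \<le> K * T" using K_pos elim by (intro of_nat_floor) auto
        then show ?thesis
          using K_pos elim by (intro add_mono divide_right_mono mult_mono power_mono real_sqrt_le_mono) auto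
      qed
      also have "\<dots> = (5 * K ^ 2 / real z + (4 * K * sqrt K / sqrt T + 20 * K / T)) * T ^ 2"
      proof -
        have "sqrt T * sqrt T = T" using elim by simp
        then have "sqrt T = T / sqrt T" using elim by (simp add: field_simps)
        then have "sqrt (K * T) = sqrt K * (T / sqrt T)" by (metis real_sqrt_mult)
        then show ?thesis using elim by (simp add: field_simps power2_eq_square)
      qed
      finally have le: "real (card (?D)) / T ^ 2
          \<le> 5 * K ^ 2 / real z + (4 * K * sqrt K / sqrt T + 20 * K / T)"
        using elim by (simp add: pos_divide_le_eq)
      have "card (points (Q z) T) = card (points ?all T) + card (?D)"
        using card_mono[OF finite_points[OF elim] sub]
        by (simp add: card_Diff_subset[OF finite_points[OF elim] sub])
      then have "real (card (points (Q z) T)) / T ^ 2 - real (card (points ?all T)) / T ^ 2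
          = real (card (?D)) / T ^ 2"
        by (simp only: of_nat_add add_divide_distrib add_diff_cancel_left')
      with le show ?case by simp
    qed
  qed
qed

end

section \<open>Minimality of the family\<close>

text \<open>The quintic factor of \<open>B_form\<close> is 2 a C. With C squared in B, p^4 dividing
  C settles both divisibilities in the definition of minimality.\<close>

lemma B_form_eq: "B_form a b = 2 * a * C_form a b ^ 2"
  unfolding B_form_def C_form_def by (simp add: poly_simps)

lemma A_form_eq: "A_form a b = - (3 * (a ^ 2 + 12 * b ^ 2) * C_form a b)"
  unfolding A_form_def by (simp add: algebra_simps)

text \<open>With s = a^2 + 12 b^2 the identity a^2 C = s^3 - 1728 b^6 is behind this. As 186624 =
  432^2, the discriminant of the cubic is C times the square of 432 b^3 C.\<close>

lemma discriminant_form: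
  fixes a b :: "'a::idom"
  shows "4 * A_form a b ^ 3 + 27 * B_form a b ^ 2 = - (186624 * b ^ 6 * C_form a b ^ 3)"
proof -
  have "4 * A_form a b ^ 3 + 27 * B_form a b ^ 2
      = 108 * C_form a b ^ 3 * (a ^ 2 * C_form a b - (a ^ 2 + 12 * b ^ 2) ^ 3)"
    unfolding A_form_eq B_form_eq by (simp add: poly_simps)
  also have "a ^ 2 * C_form a b - (a ^ 2 + 12 * b ^ 2) ^ 3 = - (1728 * b ^ 6)"
    unfolding C_form_def by (simp add: poly_simps)
  finally show ?thesis by simp
qed

lemma A_form_minus: "A_form (- a) b = A_form a b"
  and B_form_minus: "B_form (- a) b = - B_form a b"
  unfolding A_form_eq B_form_eq C_form_def by simp_all

lemma quartic_C_form: "int (quartic a b) = C_form (int a) (int b)"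
  unfolding quartic_def C_form_def by simp

lemma C_form_pos:
  fixes a b :: "'a::linordered_idom"
  assumes "b \<noteq> 0"
  shows "C_form a b > 0"
  unfolding C_form_def using assms
  by (intro add_nonneg_pos add_nonneg_nonneg) (auto simp: zero_less_mult_iff)

text \<open>If a is even, 16 divides C; if 3 divides a, then 27 divides C and 9 divides 3 (a^2 + 12
  b^2), so minimality fails at 2 or 3. Conversely, for p >= 5 dividing C the factor 3 (a^2 + 12 b^2)
  of A is prime to p, hence p^4 dividing A forces p^4 to divide C.\<close>

lemma minimal_pair_forms_iff:
  fixes a b :: nat
  assumes "b > 0"
  shows "coprime a b \<and> minimal_pair (A_form (int a) (int b)) (B_form (int a) (int b))
    \<longleftrightarrow> (\<forall>p. prime p \<longrightarrow> local_good p a b)" (is "?L \<longleftrightarrow> ?R")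
proof
  let ?A = "A_form (int a) (int b)" and ?B = "B_form (int a) (int b)" and ?C = "C_form (int a) (int b)"
  assume L: ?L
  have cop: "\<not> (p dvd a \<and> p dvd b)" if "prime p" for p
    using L that by (meson coprime_common_divisor not_prime_unit)
  have min: "\<not> (int p ^ 4 dvd ?A \<and> int p ^ 6 dvd ?B)" if "prime p" for p
    using L prime_gt_1_nat[OF that] unfolding minimal_pair_def by force
  show ?R
  proof (intro allI impI)
    fix p :: nat assume p: "prime p"
    consider "p = 2" | "p = 3" | "p \<noteq> 2" "p \<noteq> 3" by blast
    then show "local_good p a b"
    proof cases
      case 1
      have "\<not> 2 dvd a"
      proof
        assume "2 dvd a"
        then obtain c where c: "int a = 2 * int c" by (auto elim!: dvdE)
        have "?A = 2 ^ 4 * (- 3 * (4 * int c ^ 2 + 12 * int b ^ 2) * (int c ^ 4 + 9 * int c ^ 2 * int b ^ 2 + 27 * int b ^ 4))"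
          unfolding c A_form_eq C_form_def by (simp add: poly_simps)
        moreover have "?B = 2 ^ 6 * (16 * int c * (int c ^ 4 + 9 * int c ^ 2 * int b ^ 2 + 27 * int b ^ 4) ^ 2)"
          unfolding c B_form_eq C_form_def by (simp add: poly_simps)
        ultimately show False using min[of 2] by (metis dvd_triv_left of_nat_numeral two_is_prime_nat)
      qed
      then show ?thesis using 1 by (simp add: local_good_def)
    next
      case 2
      have "\<not> 3 dvd a"
      proof
        assume "3 dvd a"
        then obtain c where c: "int a = 3 * int c" by (auto elim!: dvdE)
        have "?A = 3 ^ 4 * (- 3 * (3 * int c ^ 2 + 4 * int b ^ 2) * (3 * int c ^ 4 + 12 * int c ^ 2 * int b ^ 2 + 16 * int b ^ 4))"
          unfolding c A_form_eq C_form_def by (simp add: poly_simps)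
        moreover have "?B = 3 ^ 6 * (6 * int c * (3 * int c ^ 4 + 12 * int c ^ 2 * int b ^ 2 + 16 * int b ^ 4) ^ 2)"
          unfolding c B_form_eq C_form_def by (simp add: poly_simps)
        moreover have "prime (3::nat)" by simp
        ultimately show False using min[of 3] by (metis dvd_triv_left of_nat_numeral)
      qed
      then show ?thesis using 2 by (simp add: local_good_def)
    next
      case 3
      have "\<not> p ^ 4 dvd quartic a b"
      proof
        assume "p ^ 4 dvd quartic a b"
        then have "int (p ^ 4) dvd int (quartic a b)" by (simp only: of_nat_dvd_iff)
        then have C4: "int p ^ 4 dvd ?C" by (simp only: quartic_C_form of_nat_power)
        then have "int p ^ 4 dvd ?A" unfolding A_form_eq by simp
        moreover have "int p ^ 6 dvd (int p ^ 4) ^ 2" by (simp add: le_imp_power_dvd flip: power_mult)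
        then have "int p ^ 6 dvd ?C ^ 2" using C4 dvd_power_same dvd_trans by blast
        then have "int p ^ 6 dvd ?B" unfolding B_form_eq by simp
        ultimately show False using min[OF p] by blast
      qed
      then show ?thesis using 3 cop[OF p] by (simp add: local_good_def)
    qed
  qed
next
  let ?A = "A_form (int a) (int b)" and ?B = "B_form (int a) (int b)"
  define C where "C = C_form (int a) (int b)"
  define N where "N = int a ^ 2 + 12 * int b ^ 2"
  have A_eq: "?A = - (3 * N * C)" and B_eq: "?B = 2 * int a * C ^ 2"
    unfolding A_form_eq B_form_eq N_def C_def by simp_all
  assume R: ?R
  have a2: "odd a" and a3: "\<not> 3 dvd a" using R[rule_format, of 2] R[rule_format, of 3] by (auto simp: local_good_def)
  have cop: "\<not> (p dvd a \<and> p dvd b)" if "prime p" for p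
    using R that a2 a3 by (auto simp: local_good_def split: if_splits)
  have "coprime a b" using cop by (meson coprime_iff_gcd_eq_1 gcd_dvd1 gcd_dvd2 dvd_trans prime_factor_nat)
  moreover have "minimal_pair ?A ?B"
    unfolding minimal_pair_def
  proof
    assume "\<exists>m>1. m ^ 4 dvd ?A \<and> m ^ 6 dvd ?B"
    then obtain m where m: "m > 1" "m ^ 4 dvd ?A" "m ^ 6 dvd ?B" by blast
    then have "nat m \<noteq> 1" by auto
    then obtain p where p: "prime p" "p dvd nat m" using prime_factor_nat by blast
    then have "int p dvd m" using m(1) by (simp add: int_dvd_int_iff[symmetric] del: int_dvd_int_iff)
    then have pA: "int p ^ 4 dvd ?A" and pB: "int p ^ 6 dvd ?B"
      using m dvd_power_same dvd_trans by blast+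
    have pp: "prime (int p)" using p by simp
    have A4: "int p ^ 4 dvd 3 * N * C" using pA unfolding A_eq by (simp only: dvd_minus_iff)
    consider "p = 2" | "p = 3" | "p \<noteq> 2" "p \<noteq> 3" by blast
    then show False
    proof cases
      case 1
      have "odd ?A" using a2 unfolding A_form_def C_form_def by simp
      moreover have "(2::int) dvd 2 ^ 4" by simp
      ultimately show False using pA 1 dvd_trans by fastforce
    next
      case 2
      \<comment> \<open>Modulo 3, N is a^2 and C is a^4, so 3 divides A exactly once.\<close>
      have "int 3 ^ 4 dvd 3 * N * C" using A4 2 by simp
      then obtain k where "3 * N * C = 3 ^ 4 * k" by (auto elim!: dvdE)
      then have "N * C = 3 * (9 * k)" by (simp add: mult.commute)
      then have "3 dvd N * C" by (metis dvd_triv_left)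
      then have "3 dvd N \<or> 3 dvd C" by (simp add: prime_dvd_mult_iff)
      moreover have "C = int a ^ 4 + 3 * (12 * int a ^ 2 * int b ^ 2 + 144 * int b ^ 4)"
        unfolding C_def C_form_def by simp
      moreover have "N = int a ^ 2 + 3 * (4 * int b ^ 2)" unfolding N_def by simp
      ultimately have "3 dvd int a ^ 2 \<or> 3 dvd int a ^ 4" by (metis dvd_add_left_iff dvd_triv_left)
      then have "3 dvd int a" using prime_dvd_power[of "3::int"] by auto
      then show False using a3 by presburger
    next
      case 3
      have not2: "\<not> int p dvd 2" and not3: "\<not> int p dvd 3"
        using 3 pp primes_dvd_imp_eq[of "int p" 2] primes_dvd_imp_eq[of "int p" 3] by auto
      have nd: "\<not> int p dvd 2 ^ i * 3 ^ j" for i j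
        using not2 not3 pp by (meson prime_dvd_multD prime_dvd_power)
      have ab: "int p dvd int b" if "int p dvd N" "int p dvd int a"
      proof -
        have "int p dvd int a ^ 2" using that(2) by (simp add: power2_eq_square)
        then have "int p dvd 2 ^ 2 * 3 ^ 1 * int b ^ 2" using that(1) unfolding N_def by (simp add: dvd_add_right_iff)
        then have "int p dvd int b ^ 2" using nd[of 2 1] pp prime_dvd_multD by blast
        then show ?thesis using pp prime_dvd_power by blast
      qed
      show False
      proof (cases "int p dvd C")
        case True
        have "\<not> int p dvd N"
        proof
          assume D: "int p dvd N"
          \<comment> \<open>Division of C by N leaves 144 b^4, so a common prime factor of C and N
            above 3 would divide b and then a.\<close>
          have "C = N * (int a ^ 2 + 24 * int b ^ 2) + 2 ^ 4 * 3 ^ 2 * int b ^ 4"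
            unfolding C_def N_def C_form_def by (simp add: poly_simps)
          then have "int p dvd 2 ^ 4 * 3 ^ 2 * int b ^ 4" using True D by (metis dvd_add_right_iff dvd_mult2)
          then have "int p dvd int b ^ 4" using nd[of 4 2] pp prime_dvd_multD by blast
          then have b: "int p dvd int b" using pp prime_dvd_power by blast
          then have "int p dvd 12 * int b ^ 2" by (simp add: power2_eq_square)
          then have "int p dvd int a ^ 2" using D unfolding N_def by (simp add: dvd_add_left_iff)
          then have "int p dvd int a" using pp prime_dvd_power by blast
          with b cop[OF p(1)] show False by simp
        qed
        then have "\<not> int p dvd 3 * N" using not3 pp prime_dvd_multD by blast
        then have "coprime (int p ^ 4) (3 * N)"
          using pp by (meson coprime_power_left_iff prime_imp_coprime)
        then have "int p ^ 4 dvd C" using A4 by (simp add: coprime_dvd_mult_right_iff)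
        then have "int (p ^ 4) dvd int (quartic a b)" unfolding C_def by (simp only: quartic_C_form of_nat_power)
        then have "p ^ 4 dvd quartic a b" by (simp only: of_nat_dvd_iff)
        then show False using R p(1) 3 by (auto simp: local_good_def)
      next
        case False
        \<comment> \<open>With C prime to p, divisibility of B gives p | a and that of A gives p |
          N, hence p | b.\<close>
        have p6: "int p dvd int p ^ 6" "int p dvd int p ^ 4" by (simp_all add: dvd_power)
        have "int p dvd 2 * int a * C ^ 2" using pB p6(1) unfolding B_eq by (metis dvd_trans)
        then have "int p dvd int a"
          using False not2 pp by (meson prime_dvd_multD prime_dvd_power)
        moreover have "int p dvd 3 * N * C" using A4 p6(2) by (metis dvd_trans)
        then have "int p dvd N" using False not3 pp by (meson prime_dvd_multD)
        ultimately show False using ab cop[OF p(1)] by auto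
      qed
    qed
  qed
  ultimately show ?L by blast
qed

section \<open>The height region\<close>

text \<open>The half u > 0 of \<open>region_R\<close>, chosen because it is down-closed and its
  integer points are pairs of naturals.\<close>

definition quadrant_region :: "(real \<times> real) set" where
  "quadrant_region = {(u, v). u > 0 \<and> v > 0 \<and> \<bar>A_form u v\<bar> \<le> 4 powr (- 1 / 3) \<and>
     \<bar>B_form u v\<bar> \<le> 27 powr (- 1 / 2)}"

lemma abs_A_form:
  fixes u v :: real
  shows "\<bar>A_form u v\<bar> = 3 * (u ^ 2 + 12 * v ^ 2) * (u ^ 4 + 36 * u ^ 2 * v ^ 2 + 432 * v ^ 4)"
  unfolding A_form_eq C_form_def by (subst abs_minus_cancel, rule abs_of_nonneg) auto

lemma abs_B_form:
  fixes u v :: real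
  shows "\<bar>B_form u v\<bar> = 2 * \<bar>u\<bar> * (u ^ 4 + 36 * u ^ 2 * v ^ 2 + 432 * v ^ 4) ^ 2"
  unfolding B_form_eq C_form_def by (simp add: abs_mult)

lemma continuous_on_forms:
  "continuous_on UNIV (\<lambda>x::real \<times> real. A_form (fst x) (snd x))"
  "continuous_on UNIV (\<lambda>x::real \<times> real. B_form (fst x) (snd x))"
  unfolding A_form_def B_form_def C_form_def by (intro continuous_intros)+

lemma sets_forms_le:
  "{x::real \<times> real. \<bar>A_form (fst x) (snd x)\<bar> \<le> \<alpha> \<and> \<bar>B_form (fst x) (snd x)\<bar> \<le> \<beta>} \<in> sets borel"
  using continuous_on_forms
  by (intro borel_closed closed_Collect_conj closed_Collect_le continuous_intros)

lemma sets_quadrant_region: "quadrant_region \<in> sets borel"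
proof -
  have eq: "quadrant_region = ({0<..} \<times> {0<..}) \<inter>
      {x. \<bar>A_form (fst x) (snd x)\<bar> \<le> 4 powr (- 1 / 3) \<and> \<bar>B_form (fst x) (snd x)\<bar> \<le> 27 powr (- 1 / 2)}"
    unfolding quadrant_region_def by auto
  have op: "open ({0::real<..} \<times> {0::real<..})" by (intro open_Times) auto
  show ?thesis unfolding eq by (rule sets.Int[OF borel_open[OF op] sets_forms_le])
qed

lemma quarter_powr_le_1: "(4::real) powr (- 1 / 3) \<le> 1"
  using powr_mono[of "- 1 / 3" 0 "4::real"] by simp

text \<open>In absolute value both forms are polynomials in |u|, |v| with nonnegative coefficients,
  hence monotone. The bound 1 on the coordinates holds because |A| dominates u^6 and v^6.\<close>

interpretation quadrant: down_region quadrant_region 1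
proof
  show "quadrant_region \<in> sets borel" by (rule sets_quadrant_region)
  fix u v assume uv: "(u, v) \<in> quadrant_region"
  then have pos: "u > 0" "v > 0" and A: "3 * (u ^ 2 + 12 * v ^ 2) * (u ^ 4 + 36 * u ^ 2 * v ^ 2 + 432 * v ^ 4) \<le> 4 powr (- 1 / 3)"
    unfolding quadrant_region_def abs_A_form by auto
  have 1: "3 * (u ^ 2 + 12 * v ^ 2) * (u ^ 4 + 36 * u ^ 2 * v ^ 2 + 432 * v ^ 4) \<le> 1"
    using A quarter_powr_le_1 by linarith
  have "u ^ 6 \<le> 3 * (u ^ 2 + 12 * v ^ 2) * (u ^ 4 + 36 * u ^ 2 * v ^ 2 + 432 * v ^ 4)"
    using pos by (simp add: poly_simps)
  then have "u ^ 6 \<le> 1 ^ 6" using 1 by simp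
  then have "u \<le> 1" using power_le_imp_le_base[of u 5 1] by simp
  moreover have "v ^ 6 \<le> 3 * (u ^ 2 + 12 * v ^ 2) * (u ^ 4 + 36 * u ^ 2 * v ^ 2 + 432 * v ^ 4)"
    using pos by (simp add: poly_simps)
  then have "v ^ 6 \<le> 1 ^ 6" using 1 by simp
  then have "v \<le> 1" using power_le_imp_le_base[of v 5 1] by simp
  ultimately show "0 < u \<and> u \<le> 1 \<and> 0 < v \<and> v \<le> 1" using pos by simp
  fix u' v' assume le: "0 < u'" "u' \<le> u" "0 < v'" "v' \<le> v"
  have "\<bar>A_form u' v'\<bar> \<le> \<bar>A_form u v\<bar>"
    unfolding abs_A_form using le by (intro mult_mono add_mono power_mono) auto
  moreover have "\<bar>B_form u' v'\<bar> \<le> \<bar>B_form u v\<bar>"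
    unfolding abs_B_form using le by (intro mult_mono add_mono power_mono) auto
  ultimately show "(u', v') \<in> quadrant_region" using uv le unfolding quadrant_region_def by auto
qed simp

text \<open>The region consists of the quadrant part, its mirror image under u to -u, and a null set
  on the axis u = 0.\<close>

lemma measure_region_R: "measure lborel region_R = 2 * measure lborel quadrant_region"
proof -
  let ?D = quadrant_region and ?D' = "{x. (- fst x, snd x) \<in> quadrant_region}"
    and ?N = "{x \<in> region_R. fst x = 0}"
  have sR: "region_R \<in> sets borel"
  proof -
    have eq: "region_R = (UNIV \<times> {0<..}) \<inter>
        {x. \<bar>A_form (fst x) (snd x)\<bar> \<le> 4 powr (- 1 / 3) \<and> \<bar>B_form (fst x) (snd x)\<bar> \<le> 27 powr (- 1 / 2)}"
      unfolding region_R_def by auto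
    have op: "open ((UNIV::real set) \<times> {0::real<..})" by (intro open_Times) auto
    show ?thesis unfolding eq by (rule sets.Int[OF borel_open[OF op] sets_forms_le])
  qed
  have sN: "?N \<in> sets borel"
  proof -
    have "closed {x::real \<times> real. fst x = 0}" by (intro closed_Collect_eq continuous_intros)
    moreover have "?N = region_R \<inter> {x. fst x = 0}" by auto
    ultimately show ?thesis using sR by auto
  qed
  have D': "?D' = (\<lambda>x. (- fst x, snd x)) -` ?D \<inter> space borel" by auto
  have sD': "?D' \<in> sets borel"
    unfolding D' by (rule measurable_sets[OF borel_measurable_continuous_onI sets_quadrant_region]) (intro continuous_intros)
  have un: "region_R = ?D \<union> (?D' \<union> ?N)"
    unfolding region_R_def quadrant_region_def by (auto simp: A_form_minus B_form_minus)
  have N0: "emeasure lborel ?N = 0"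
  proof -
    have "emeasure lborel ?N \<le> emeasure lborel ({0::real} \<times> (UNIV::real set))"
      by (intro emeasure_mono) (auto simp flip: lborel_prod)
    also have "\<dots> = 0" unfolding lborel_prod[symmetric] by (subst lborel.emeasure_pair_measure_Times) auto
    finally show ?thesis by simp
  qed
  have eD': "emeasure lborel ?D' = emeasure lborel ?D"
  proof -
    have s: "?D \<in> sets (lborel \<Otimes>\<^sub>M lborel)" "?D' \<in> sets (lborel \<Otimes>\<^sub>M lborel)"
      using sets_quadrant_region sD' unfolding lborel_prod sets_lborel .
    \<comment> \<open>Reflection invariance is applied on each horizontal slice and then integrated
      over v.\<close>
    have "emeasure lborel ((\<lambda>u. (u, v)) -` ?D') = emeasure lborel ((\<lambda>u. (u, v)) -` ?D)" for v
    proof -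
      have m: "(\<lambda>u. (u, v)) -` ?D \<in> sets borel"
        using sets_Pair2[OF s(1), of v] by simp
      have "emeasure lborel ((\<lambda>u. (u, v)) -` ?D) = emeasure (distr lborel borel uminus) ((\<lambda>u. (u, v)) -` ?D)"
        by (simp add: lborel_distr_uminus)
      also have "\<dots> = emeasure lborel (uminus -` ((\<lambda>u. (u, v)) -` ?D))"
        using m by (subst emeasure_distr) auto
      also have "uminus -` ((\<lambda>u. (u, v)) -` ?D) = (\<lambda>u. (u, v)) -` ?D'" by auto
      finally show ?thesis by simp
    qed
    then show ?thesis
      using lborel_pair.emeasure_pair_measure_alt2[OF s(1)] lborel_pair.emeasure_pair_measure_alt2[OF s(2)]
      by (simp add: lborel_prod)
  qed
  have "emeasure lborel region_R = emeasure lborel (?D \<union> (?D' \<union> ?N))" using un by (rule arg_cong)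
  also have "\<dots> = emeasure lborel ?D + emeasure lborel (?D' \<union> ?N)"
    using sets_quadrant_region sD' sN
    by (intro plus_emeasure[symmetric]) (auto simp: quadrant_region_def)
  also have "emeasure lborel (?D' \<union> ?N) = emeasure lborel ?D'"
    using sD' sN N0 by (intro emeasure_Un_null_set) auto
  finally have "emeasure lborel region_R = 2 * emeasure lborel ?D" unfolding eD' by (simp add: mult_2)
  then show ?thesis unfolding measure_def by (simp add: enn2real_mult)
qed

text \<open>Both forms vanish at the origin, so a small (h, h) lies in the region and the square of
  side h below it gives positive area by \<open>area_ge\<close>.\<close>

lemma measure_quadrant_region_pos: "measure lborel quadrant_region > 0"
proof -
  have "\<exists>h>0. (h, h) \<in> quadrant_region"
  proof -
    have "((\<lambda>h::real. \<bar>A_form h h\<bar>) \<longlongrightarrow> \<bar>A_form 0 0\<bar>) (at_right 0)"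
      "((\<lambda>h::real. \<bar>B_form h h\<bar>) \<longlongrightarrow> \<bar>B_form 0 0\<bar>) (at_right 0)"
      unfolding A_form_def B_form_def C_form_def by (intro tendsto_intros)+
    then have "((\<lambda>h::real. \<bar>A_form h h\<bar>) \<longlongrightarrow> 0) (at_right 0)" "((\<lambda>h::real. \<bar>B_form h h\<bar>) \<longlongrightarrow> 0) (at_right 0)"
      by (simp_all add: A_form_def B_form_def)
    then have "eventually (\<lambda>h::real. \<bar>A_form h h\<bar> < 4 powr (- 1 / 3)) (at_right 0)"
      "eventually (\<lambda>h::real. \<bar>B_form h h\<bar> < 27 powr (- 1 / 2)) (at_right 0)"
      by (auto intro!: order_tendstoD(2))
    moreover have "eventually (\<lambda>h::real. h > 0) (at_right 0)" by (rule eventually_at_right_less)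
    ultimately have "eventually (\<lambda>h. h > 0 \<and> (h, h) \<in> quadrant_region) (at_right 0)"
      by eventually_elim (simp add: quadrant_region_def)
    then show ?thesis using eventually_happens'[OF trivial_limit_at_right_real] by blast
  qed
  then obtain h where h: "h > 0" "(h, h) \<in> quadrant_region" by blast
  then have "(0, 0) \<in> quadrant.grid h" unfolding quadrant.grid_def by simp
  then have "card (quadrant.grid h) > 0" using quadrant.finite_grid[OF h(1)] card_gt_0_iff by blast
  then have "real (card (quadrant.grid h)) * h ^ 2 > 0" using h by simp
  then show ?thesis using quadrant.area_ge[OF h(1)] by linarith
qed

section \<open>The asymptotic formula\<close>

lemma forms_divide:
  fixes u v T :: real
  shows "A_form (u / T) (v / T) = A_form u v / T ^ 6"
    and "B_form (u / T) (v / T) = B_form u v / T ^ 9"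
proof -
  have C: "C_form (u / T) (v / T) = C_form u v / T ^ 4"
    unfolding C_form_def by (simp add: power_divide add_divide_distrib flip: power_add)
  have "(u / T) ^ 2 + 12 * (v / T) ^ 2 = (u ^ 2 + 12 * v ^ 2) / T ^ 2"
    by (simp add: power_divide add_divide_distrib)
  then show "A_form (u / T) (v / T) = A_form u v / T ^ 6"
    unfolding A_form_eq C by (simp flip: power_add)
  have "T * (T ^ 4) ^ 2 = T ^ 9" by (simp flip: power_mult power_Suc)
  then show "B_form (u / T) (v / T) = B_form u v / T ^ 9"
    unfolding B_form_eq C power_divide by (simp add: mult.assoc)
qed

text \<open>|A|^3 and |B|^2 are both homogeneous of degree 18, which dictates the dilation factor
  T.\<close>

lemma pair_height_le_iff:
  fixes a b :: nat
  assumes "x > 0" "a > 0" "b > 0"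
  defines "T \<equiv> x powr (1 / 18)"
  shows "real_of_int (H_form (int a) (int b)) \<le> x \<longleftrightarrow> (real a / T, real b / T) \<in> quadrant_region"
proof -
  have "(x powr (1 / 18)) ^ 18 = x powr (1 / 18 * real 18)" using assms(1) by (subst powr_power) (simp_all add: mult.commute)
  then have T: "T > 0" "T ^ 18 = x" unfolding T_def using assms(1) by simp_all
  have A: "\<bar>A_form (real a / T) (real b / T)\<bar> = \<bar>A_form (real a) (real b)\<bar> / T ^ 6"
    unfolding forms_divide using T(1) by (simp add: abs_divide)
  have B: "\<bar>B_form (real a / T) (real b / T)\<bar> = \<bar>B_form (real a) (real b)\<bar> / T ^ 9"
    unfolding forms_divide using T(1) by (simp add: abs_divide)
  have "(4 powr (- 1 / 3)) ^ 3 = (4 :: real) powr (- 1)" by (subst powr_power) simp_all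
  also have "\<dots> = 1 / 4" by (simp add: powr_minus_divide)
  finally have c3: "(4 powr (- 1 / 3)) ^ 3 = (1 / 4 :: real)" .
  have "(27 powr (- 1 / 2)) ^ 2 = (27 :: real) powr (- 1)" by (subst powr_power) simp_all
  also have "\<dots> = 1 / 27" by (simp add: powr_minus_divide)
  finally have c2: "(27 powr (- 1 / 2)) ^ 2 = (1 / 27 :: real)" .
  have T63: "(y / T ^ 6) ^ 3 = y ^ 3 / x" and T92: "(y / T ^ 9) ^ 2 = y ^ 2 / x" for y
    unfolding power_divide using T(2) by (simp_all flip: power_mult)
  have "\<bar>A_form (real a) (real b)\<bar> / T ^ 6 \<le> 4 powr (- 1 / 3) \<longleftrightarrow>
      (\<bar>A_form (real a) (real b)\<bar> / T ^ 6) ^ 3 \<le> (4 powr (- 1 / 3)) ^ 3"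
    using T by (intro power_mono_iff[symmetric]) auto
  also have "\<dots> \<longleftrightarrow> 4 * \<bar>A_form (real a) (real b)\<bar> ^ 3 \<le> x"
    unfolding c3 T63 using assms(1) by (simp add: pos_divide_le_eq mult.commute)
  finally have 1: "\<bar>A_form (real a / T) (real b / T)\<bar> \<le> 4 powr (- 1 / 3) \<longleftrightarrow> 4 * \<bar>A_form (real a) (real b)\<bar> ^ 3 \<le> x"
    unfolding A .
  have "\<bar>B_form (real a) (real b)\<bar> / T ^ 9 \<le> 27 powr (- 1 / 2) \<longleftrightarrow>
      (\<bar>B_form (real a) (real b)\<bar> / T ^ 9) ^ 2 \<le> (27 powr (- 1 / 2)) ^ 2"
    using T by (intro power_mono_iff[symmetric]) auto
  also have "\<dots> \<longleftrightarrow> 27 * \<bar>B_form (real a) (real b)\<bar> ^ 2 \<le> x"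
    unfolding c2 T92 using assms(1) by (simp add: pos_divide_le_eq mult.commute)
  finally have 2: "\<bar>B_form (real a / T) (real b / T)\<bar> \<le> 27 powr (- 1 / 2) \<longleftrightarrow> 27 * \<bar>B_form (real a) (real b)\<bar> ^ 2 \<le> x"
    unfolding B .
  have "real_of_int (A_form (int a) (int b)) = A_form (real a) (real b)"
    "real_of_int (B_form (int a) (int b)) = B_form (real a) (real b)"
    unfolding A_form_def B_form_def C_form_def by simp_all
  then have "real_of_int (H_form (int a) (int b)) = max (4 * \<bar>A_form (real a) (real b)\<bar> ^ 3) (27 * \<bar>B_form (real a) (real b)\<bar> ^ 2)"
    unfolding H_form_def pair_height_def by (simp add: of_int_max)
  then show ?thesis using assms T(1) 1 2 unfolding quadrant_region_def by simp
qed

abbreviation sieved :: "(nat \<Rightarrow> nat \<Rightarrow> nat \<Rightarrow> bool) \<Rightarrow> real \<Rightarrow> (nat \<times> nat) set" where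
  "sieved G \<equiv> quadrant.points (\<lambda>a b. \<forall>p. prime p \<longrightarrow> G p a b)"

text \<open>The factor 2 is the sign of a: A is even and B is odd in a, so height and minimality do
  not change under a to -a.\<close>

lemma N1_eq:
  assumes "x > 0"
  shows "N1 x = 2 * card (sieved local_good (x powr (1 / 18)))"
proof -
  let ?P = "sieved local_good (x powr (1 / 18))"
  let ?f = "\<lambda>(a, b). (int a, int b)" and ?g = "\<lambda>(a, b). (- int a, int b)"
  define S where "S = {(a :: int, b :: int).
     b > 0 \<and> gcd a b = 1 \<and> 4 * A_form a b ^ 3 + 27 * B_form a b ^ 2 \<noteq> 0 \<and>
     minimal_pair (A_form a b) (B_form a b) \<and> real_of_int (H_form a b) \<le> x}"
  have T: "x powr (1 / 18) > 0" using assms by simp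
  have fin: "finite ?P" by (rule quadrant.finite_points[OF T])
  have pos: "a > 0 \<and> b > 0" if "(a, b) \<in> ?P" for a b
    using quadrant.points_bounded[OF T that] by auto
  have key: "(int a, int b) \<in> S \<longleftrightarrow> (a, b) \<in> ?P" if "a > 0" "b > 0" for a b
  proof -
    have "4 * A_form (int a) (int b) ^ 3 + 27 * B_form (int a) (int b) ^ 2 \<noteq> 0"
      using that C_form_pos[of "int b" "int a"] unfolding discriminant_form by auto
    then have "(int a, int b) \<in> S \<longleftrightarrow> (coprime a b \<and> minimal_pair (A_form (int a) (int b)) (B_form (int a) (int b)))
        \<and> real_of_int (H_form (int a) (int b)) \<le> x"
      using that unfolding S_def mem_Collect_eq case_prod_conv
      by (simp only: coprime_iff_gcd_eq_1 gcd_int_int_eq of_nat_0_less_iff of_nat_eq_1_iff) blast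
    then show ?thesis
      unfolding minimal_pair_forms_iff[OF that(2)] pair_height_le_iff[OF assms that] quadrant.points_def by auto
  qed
  have sym: "(- a, b) \<in> S \<longleftrightarrow> (a, b) \<in> S" for a b
    unfolding S_def H_form_def minimal_pair_def pair_height_def by (simp add: A_form_minus B_form_minus)
  have zero: "(0, b) \<notin> S" for b
  proof
    assume b: "(0, b) \<in> S"
    \<comment> \<open>Coprimality with 0 leaves only b = 1, and then minimality fails at 2.\<close>
    then have "b = 1" unfolding S_def by (auto simp: abs_if split: if_splits)
    then have "minimal_pair (A_form (int 0) (int 1)) (B_form (int 0) (int 1))" using b unfolding S_def by simp
    then have "\<forall>p. prime p \<longrightarrow> local_good p 0 1" using minimal_pair_forms_iff[of 1 0] by simp
    then show False by (auto simp: local_good_def dest: spec[of _ 2])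
  qed
  have "S = ?f ` ?P \<union> ?g ` ?P"
  proof (intro equalityI subsetI)
    fix y assume y: "y \<in> S"
    obtain a b where ab: "y = (a, b)" by (metis surj_pair)
    have b: "b > 0" using y ab unfolding S_def by simp
    have "a \<noteq> 0" using y ab zero by auto
    have "(int (nat \<bar>a\<bar>), int (nat b)) \<in> S" using y ab b sym[of a b] by (cases "a > 0") auto
    then have "(nat \<bar>a\<bar>, nat b) \<in> ?P" using key[of "nat \<bar>a\<bar>" "nat b"] \<open>a \<noteq> 0\<close> b by simp
    then show "y \<in> ?f ` ?P \<union> ?g ` ?P"
      using ab b by (cases "a > 0") (force intro: image_eqI[of _ _ "(nat \<bar>a\<bar>, nat b)"])+
  next
    fix y assume "y \<in> ?f ` ?P \<union> ?g ` ?P"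
    then show "y \<in> S" using key pos sym by auto
  qed
  moreover have "?f ` ?P \<inter> ?g ` ?P = {}" using pos by fastforce
  moreover have "inj_on ?f ?P" "inj_on ?g ?P" by (auto simp: inj_on_def)
  ultimately have "card S = 2 * card ?P" using fin by (simp add: card_Un_disjoint card_image)
  then show ?thesis unfolding N1_def S_def .
qed

section \<open>Convergence and positivity of the Euler product\<close>

definition euler_term :: "nat \<Rightarrow> real" where
  "euler_term l = (if prime l \<and> l \<noteq> 2 \<and> l \<noteq> 3 then euler_factor l else 1)"

text \<open>At most four roots give a deviation of at most 5 / l^2, and l >= 5 makes this at most
  1/5, so no factor vanishes.\<close>

lemma euler_term_bounds: "\<bar>euler_term l - 1\<bar> \<le> 5 * (1 / real l ^ 2)" "euler_term l > 0"
proof -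
  have "\<bar>euler_term l - 1\<bar> \<le> 5 * (1 / real l ^ 2) \<and> euler_term l > 0"
  proof (cases "prime l \<and> l \<noteq> 2 \<and> l \<noteq> 3")
    case True
    then have r: "root_count l \<le> 4" using root_count_le by blast
    have "l \<ge> 2" "l \<noteq> 4" using True prime_ge_2_nat prime_nat_not_dvd[of l 2] by auto
    moreover have "l \<noteq> 2" "l \<noteq> 3" using True by auto
    ultimately have l: "l \<ge> 5" by arith
    have "real (root_count l) * (real l - 1) / real l ^ 5 \<le> 4 * real l / real l ^ 5"
      using r l by (intro divide_right_mono mult_mono) auto
    also have "\<dots> = 4 * (1 / real l ^ 4)" using l by (simp add: power_numeral_reduce)
    also have "\<dots> \<le> 4 * (1 / real l ^ 2)" using l
      by (intro mult_left_mono divide_left_mono power_increasing) auto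
    finally have ub: "real (root_count l) * (real l - 1) / real l ^ 5 \<le> 4 * (1 / real l ^ 2)" .
    have "0 \<le> real (root_count l) * (real l - 1) / real l ^ 5" using l by simp
    moreover have "0 \<le> 1 / real l ^ 2" by simp
    ultimately have "\<bar>euler_term l - 1\<bar> \<le> 5 * (1 / real l ^ 2)"
      using ub True unfolding euler_term_def euler_factor_def by (simp only: if_True abs_le_iff simp_thms) linarith
    moreover have "5 * (1 / real l ^ 2) < 1"
    proof -
      have "real l ^ 2 \<ge> 5 ^ 2" using l by (intro power_mono) auto
      then show ?thesis using l by (simp add: divide_less_eq)
    qed
    ultimately show ?thesis by linarith
  next
    case False
    then have "euler_term l = 1" by (simp only: euler_term_def if_False)
    then show ?thesis by simp
  qed
  then show "\<bar>euler_term l - 1\<bar> \<le> 5 * (1 / real l ^ 2)" "euler_term l > 0" by blast+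
qed

lemma convergent_prod_euler_term: "convergent_prod euler_term"
proof -
  have "summable (\<lambda>l. 5 * (1 / real l ^ 2))"
    using inverse_power_summable[of 2, where 'a = real] by (intro summable_mult) (simp add: inverse_eq_divide)
  then have "summable (\<lambda>l. norm (euler_term l - 1))"
  proof (rule summable_comparison_test')
    show "norm (norm (euler_term l - 1)) \<le> 5 * (1 / real l ^ 2)" for l
      unfolding real_norm_def abs_abs by (rule euler_term_bounds(1))
  qed
  then show ?thesis
    by (intro abs_convergent_prod_imp_convergent_prod summable_imp_abs_convergent_prod)
qed

lemma euler_product_eq: "euler_product = prodinf euler_term"
  unfolding euler_product_def euler_term_def ..

lemma euler_product_pos: "euler_product > 0"
proof -
  have "euler_product \<noteq> 0"
    unfolding euler_product_eq using convergent_prod_euler_term euler_term_bounds(2)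
    by (intro prodinf_nonzero) (auto simp: less_imp_neq[symmetric])
  moreover have "euler_product \<ge> 0"
    unfolding euler_product_eq using convergent_prod_LIMSEQ[OF convergent_prod_euler_term] euler_term_bounds(2)
    by (intro LIMSEQ_le_const[of _ _ 0]) (blast intro: prod_nonneg less_imp_le)+
  ultimately show ?thesis by simp
qed

text \<open>The densities differ from the Euler terms at finitely many primes only; their ratios
  form the finite correction. The maximum with 3 includes 2 and 3, where the Euler term is
  1.\<close>

lemma density_product_limit:
  assumes "\<And>p. prime p \<Longrightarrow> p > z0 \<Longrightarrow> G p = local_good p"
  shows "(\<lambda>z. \<Prod>p | prime p \<and> p \<le> z. local_density (G p) p)
    \<longlonglongrightarrow> euler_product * (\<Prod>p | prime p \<and> p \<le> max 3 z0. local_density (G p) p / euler_term p)"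
proof -
  let ?m = "max 3 z0"
  let ?ps = "\<lambda>z. {p. prime p \<and> p \<le> (z::nat)}"
  let ?q = "\<lambda>p. local_density (G p) p / euler_term p"
  have fin: "finite (?ps z)" for z by (rule finite_subset[of _ "{..z}"]) auto
  have eq: "(\<Prod>p\<in>?ps z. local_density (G p) p) = (\<Prod>i\<le>z. euler_term i) * (\<Prod>p\<in>?ps ?m. ?q p)" if "z \<ge> ?m" for z
  proof -
    have "(\<Prod>p\<in>?ps z. local_density (G p) p) = (\<Prod>p\<in>?ps z. euler_term p * ?q p)"
      using euler_term_bounds(2) by (intro prod.cong) (auto simp: less_imp_neq[symmetric])
    also have "\<dots> = (\<Prod>p\<in>?ps z. euler_term p) * (\<Prod>p\<in>?ps z. ?q p)" by (rule prod.distrib)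
    also have "(\<Prod>p\<in>?ps z. euler_term p) = (\<Prod>i\<le>z. euler_term i)"
      by (rule prod.mono_neutral_left) (auto simp: euler_term_def)
    also have "(\<Prod>p\<in>?ps z. ?q p) = (\<Prod>p\<in>?ps ?m. ?q p)"
    proof (rule prod.mono_neutral_right[OF fin])
      show "?ps ?m \<subseteq> ?ps z" using that by auto
      show "\<forall>p\<in>?ps z - ?ps ?m. ?q p = 1"
      proof
        fix p assume "p \<in> ?ps z - ?ps ?m"
        then have p: "prime p" "p > 3" "p > z0" by auto
        then have "local_density (G p) p = euler_term p"
          using assms local_density_euler_factor[of p] unfolding euler_term_def by simp
        then show "?q p = 1" using euler_term_bounds(2)[of p] by simp
      qed
    qed
    finally show ?thesis .
  qed
  have "(\<lambda>z. (\<Prod>i\<le>z. euler_term i) * (\<Prod>p\<in>?ps ?m. ?q p)) \<longlonglongrightarrow> euler_product * (\<Prod>p\<in>?ps ?m. ?q p)"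
    unfolding euler_product_eq by (intro tendsto_mult convergent_prod_LIMSEQ convergent_prod_euler_term tendsto_const)
  then show ?thesis
    by (rule Lim_transform_eventually) (use eq in \<open>auto simp: eventually_at_top_linorder intro!: exI[of _ ?m]\<close>)
qed

lemma tendsto_powr_18:
  fixes f :: "real \<Rightarrow> real"
  assumes "((\<lambda>T. f T / T ^ 2) \<longlongrightarrow> L) at_top"
  shows "((\<lambda>x. f (x powr (1 / 18)) / x powr (1 / 9)) \<longlongrightarrow> L) at_top"
proof -
  have "filterlim (\<lambda>x::real. x powr (1 / 18)) at_top at_top" by real_asymp
  from filterlim_compose[OF assms this]
  have "((\<lambda>x. f (x powr (1 / 18)) / (x powr (1 / 18)) ^ 2) \<longlongrightarrow> L) at_top" .
  then show ?thesis
    by (rule Lim_transform_eventually) (use eventually_gt_at_top[of 0] in eventually_elim, simp add: powr_power)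
qed

theorem N1_asymp:
  "(\<lambda>x. real (N1 x)) \<sim>[at_top] (\<lambda>x. 1 / 2 * (2 / 3) * euler_product * measure lborel region_R * x powr (1 / 9))"
proof -
  let ?c = "1 / 2 * (2 / 3) * euler_product * measure lborel region_R"
  let ?P = "sieved local_good"
  have "{p::nat. prime p \<and> p \<le> 3} = {2, 3}"
  proof (intro equalityI subsetI)
    fix p :: nat assume "p \<in> {p. prime p \<and> p \<le> 3}"
    then have "p \<ge> 2" "p \<le> 3" using prime_ge_2_nat by auto
    then show "p \<in> {2, 3}" by auto
  qed auto
  \<comment> \<open>The Euler terms at 2 and 3 are 1, so the correction is (1 - 1/2) (1 -
    1/3).\<close>
  then have ps: "(\<Prod>p::nat | prime p \<and> p \<le> max 3 3. local_density (local_good p) p / euler_term p) = 1 / 2 * (2 / 3)"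
    by (simp add: euler_term_def local_density_2_3)
  have lim: "(\<lambda>z. \<Prod>p | prime p \<and> p \<le> z. local_density (local_good p) p) \<longlonglongrightarrow> euler_product * (1 / 2 * (2 / 3))"
    using density_product_limit[of 3 local_good, OF refl] unfolding ps .
  have "((\<lambda>T. real (card (?P T)) / T ^ 2) \<longlongrightarrow> euler_product * (1 / 2 * (2 / 3)) * measure lborel quadrant_region) at_top"
  proof (rule quadrant.sieve_asymp[OF periodic2_local_good _ _ _ lim])
    show "local_good p a b \<Longrightarrow> \<not> (p dvd a \<and> p dvd b)" if "prime p" for p a b
      using that by (auto simp: local_good_def split: if_splits)
    show "local_good p = local_good p" for p ..
    show "(3::nat) \<le> 3" ..
  qed
  from tendsto_powr_18[OF this]
  have "((\<lambda>x. 2 * (real (card (?P (x powr (1 / 18)))) / x powr (1 / 9))) \<longlongrightarrow> 2 * (euler_product * (1 / 2 * (2 / 3)) * measure lborel quadrant_region)) at_top"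
    by (intro tendsto_mult tendsto_const)
  \<comment> \<open>The factor 2 from the sign of a turns the area of the quadrant part into that of
    the whole region.\<close>
  also have "2 * (euler_product * (1 / 2 * (2 / 3)) * measure lborel quadrant_region) = ?c"
    unfolding measure_region_R by simp
  finally have "((\<lambda>x. real (N1 x) / x powr (1 / 9)) \<longlongrightarrow> ?c) at_top"
    by (rule Lim_transform_eventually) (use eventually_gt_at_top[of 0] in eventually_elim, simp add: N1_eq)
  moreover have c: "?c \<noteq> 0" using euler_product_pos measure_quadrant_region_pos by (simp add: measure_region_R)
  ultimately have "((\<lambda>x. real (N1 x) / x powr (1 / 9) / ?c) \<longlongrightarrow> ?c / ?c) at_top" by (intro tendsto_divide tendsto_const)
  then have "((\<lambda>x. real (N1 x) / (?c * x powr (1 / 9))) \<longlongrightarrow> 1) at_top" using c by (simp add: mult.commute)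
  then show ?thesis by (intro asymp_equivI') simp
qed

section \<open>Minimal short models\<close>

lemma w_isomorphic_refl: "w_isomorphic E E"
  unfolding w_isomorphic_def by (intro exI[of _ 1] exI[of _ 0]) simp

text \<open>The equations solved for the coefficients of E, so that E can be eliminated by
  substitution.\<close>

lemma w_isomorphic_iff:
  "w_isomorphic E E' \<longleftrightarrow> (\<exists>u r s t. u \<noteq> 0 \<and>
     wa1 E = u * wa1 E' - 2 * s \<and>
     wa2 E = u ^ 2 * wa2 E' + s * wa1 E - 3 * r + s ^ 2 \<and>
     wa3 E = u ^ 3 * wa3 E' - r * wa1 E - 2 * t \<and>
     wa4 E = u ^ 4 * wa4 E' + s * wa3 E - 2 * r * wa2 E + (t + r * s) * wa1 E - 3 * r ^ 2 + 2 * s * t \<and>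
     wa6 E = u ^ 6 * wa6 E' - r * wa4 E - r ^ 2 * wa2 E - r ^ 3 + t * wa3 E + t ^ 2 + r * t * wa1 E)"
  unfolding w_isomorphic_def by (intro ex_cong1 conj_cong refl) (auto simp: algebra_simps)

lemma w_isomorphic_sym:
  assumes "w_isomorphic E E'"
  shows "w_isomorphic E' E"
proof -
  obtain u r s t where u: "u \<noteq> 0"
    and h: "u * wa1 E' = wa1 E + 2 * s"
     "u ^ 2 * wa2 E' = wa2 E - s * wa1 E + 3 * r - s ^ 2"
     "u ^ 3 * wa3 E' = wa3 E + r * wa1 E + 2 * t"
     "u ^ 4 * wa4 E' = wa4 E - s * wa3 E + 2 * r * wa2 E - (t + r * s) * wa1 E + 3 * r ^ 2 - 2 * s * t"
     "u ^ 6 * wa6 E' = wa6 E + r * wa4 E + r ^ 2 * wa2 E + r ^ 3 - t * wa3 E - t ^ 2 - r * t * wa1 E"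
    using assms unfolding w_isomorphic_def by blast
  have k: "wa1 E' = (wa1 E + 2 * s) / u"
     "wa2 E' = (wa2 E - s * wa1 E + 3 * r - s ^ 2) / u ^ 2"
     "wa3 E' = (wa3 E + r * wa1 E + 2 * t) / u ^ 3"
     "wa4 E' = (wa4 E - s * wa3 E + 2 * r * wa2 E - (t + r * s) * wa1 E + 3 * r ^ 2 - 2 * s * t) / u ^ 4"
     "wa6 E' = (wa6 E + r * wa4 E + r ^ 2 * wa2 E + r ^ 3 - t * wa3 E - t ^ 2 - r * t * wa1 E) / u ^ 6"
    using u by (simp_all flip: h)
  show ?thesis
    unfolding w_isomorphic_def
  proof (intro exI conjI)
    \<comment> \<open>Solving x = u^2 x' + r and y = u^3 y' + s u^2 x' + t for x', y' gives the
      parameters 1/u, -r/u^2, -s/u and (r s - t)/u^3.\<close>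
    show "1 / u \<noteq> 0" using u by simp
    show "1 / u * wa1 E = wa1 E' + 2 * (- s / u)"
      unfolding k using u by (simp add: field_simps)
    show "(1 / u) ^ 2 * wa2 E = wa2 E' - (- s / u) * wa1 E' + 3 * (- r / u ^ 2) - (- s / u) ^ 2"
      unfolding k using u by (simp add: field_simps power_numeral_reduce)
    show "(1 / u) ^ 3 * wa3 E = wa3 E' + (- r / u ^ 2) * wa1 E' + 2 * ((r * s - t) / u ^ 3)"
      unfolding k using u by (simp add: field_simps power_numeral_reduce)
    show "(1 / u) ^ 4 * wa4 E = wa4 E' - (- s / u) * wa3 E' + 2 * (- r / u ^ 2) * wa2 E'
        - ((r * s - t) / u ^ 3 + (- r / u ^ 2) * (- s / u)) * wa1 E'
        + 3 * (- r / u ^ 2) ^ 2 - 2 * (- s / u) * ((r * s - t) / u ^ 3)"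
      unfolding k using u by (simp add: field_simps power_numeral_reduce)
    show "(1 / u) ^ 6 * wa6 E = wa6 E' + (- r / u ^ 2) * wa4 E' + (- r / u ^ 2) ^ 2 * wa2 E' + (- r / u ^ 2) ^ 3
        - ((r * s - t) / u ^ 3) * wa3 E' - ((r * s - t) / u ^ 3) ^ 2 - (- r / u ^ 2) * ((r * s - t) / u ^ 3) * wa1 E'"
      unfolding k using u by (simp add: field_simps power_numeral_reduce)
  qed
qed

lemma w_isomorphic_trans:
  assumes "w_isomorphic E E'" "w_isomorphic E' E''"
  shows "w_isomorphic E E''"
proof -
  obtain u r s t where u: "u \<noteq> 0"
    and h: "wa1 E = u * wa1 E' - 2 * s"
     "wa2 E = u ^ 2 * wa2 E' + s * wa1 E - 3 * r + s ^ 2"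
     "wa3 E = u ^ 3 * wa3 E' - r * wa1 E - 2 * t"
     "wa4 E = u ^ 4 * wa4 E' + s * wa3 E - 2 * r * wa2 E + (t + r * s) * wa1 E - 3 * r ^ 2 + 2 * s * t"
     "wa6 E = u ^ 6 * wa6 E' - r * wa4 E - r ^ 2 * wa2 E - r ^ 3 + t * wa3 E + t ^ 2 + r * t * wa1 E"
    using assms(1) unfolding w_isomorphic_iff by blast
  obtain v p q w where v: "v \<noteq> 0"
    and k: "v * wa1 E'' = wa1 E' + 2 * q"
     "v ^ 2 * wa2 E'' = wa2 E' - q * wa1 E' + 3 * p - q ^ 2"
     "v ^ 3 * wa3 E'' = wa3 E' + p * wa1 E' + 2 * w"
     "v ^ 4 * wa4 E'' = wa4 E' - q * wa3 E' + 2 * p * wa2 E' - (w + p * q) * wa1 E' + 3 * p ^ 2 - 2 * q * w"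
     "v ^ 6 * wa6 E'' = wa6 E' + p * wa4 E' + p ^ 2 * wa2 E' + p ^ 3 - w * wa3 E' - w ^ 2 - p * w * wa1 E'"
    using assms(2) unfolding w_isomorphic_def by blast
  \<comment> \<open>The parameters of the composed substitution, read off after inserting x' = v^2
    x'' + p and y' = v^3 y'' + q v^2 x'' + w.\<close>
  let ?R = "r + u ^ 2 * p" and ?S = "s + u * q" and ?T = "t + u ^ 3 * w + s * u ^ 2 * p"
  show ?thesis
    unfolding w_isomorphic_def
  proof (intro exI conjI)
    show "u * v \<noteq> 0" using u v by simp
    have "(u * v) * wa1 E'' = u * (v * wa1 E'')" by simp
    also have "\<dots> = wa1 E + 2 * ?S" unfolding k h(1) by (simp add: algebra_simps)
    finally show "(u * v) * wa1 E'' = wa1 E + 2 * ?S" .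
    have "(u * v) ^ 2 * wa2 E'' = u ^ 2 * (v ^ 2 * wa2 E'')" by (simp add: power_mult_distrib)
    also have "\<dots> = wa2 E - ?S * wa1 E + 3 * ?R - ?S ^ 2" (is "_ = ?r2")
      unfolding k h(2) h(1) by (simp add: poly_simps)
    finally show "(u * v) ^ 2 * wa2 E'' = ?r2" .
    have "(u * v) ^ 3 * wa3 E'' = u ^ 3 * (v ^ 3 * wa3 E'')" by (simp add: power_mult_distrib)
    also have "\<dots> = wa3 E + ?R * wa1 E + 2 * ?T" (is "_ = ?r3")
      unfolding k h(3) h(1) by (simp add: poly_simps)
    finally show "(u * v) ^ 3 * wa3 E'' = ?r3" .
    have "(u * v) ^ 4 * wa4 E'' = u ^ 4 * (v ^ 4 * wa4 E'')" by (simp add: power_mult_distrib)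
    also have "\<dots> = wa4 E - ?S * wa3 E + 2 * ?R * wa2 E - (?T + ?R * ?S) * wa1 E + 3 * ?R ^ 2 - 2 * ?S * ?T" (is "_ = ?r4")
      unfolding k h(4) h(3) h(2) h(1) by (simp add: poly_simps)
    finally show "(u * v) ^ 4 * wa4 E'' = ?r4" .
    have "(u * v) ^ 6 * wa6 E'' = u ^ 6 * (v ^ 6 * wa6 E'')" by (simp add: power_mult_distrib)
    also have "\<dots> = wa6 E + ?R * wa4 E + ?R ^ 2 * wa2 E + ?R ^ 3 - ?T * wa3 E - ?T ^ 2 - ?R * ?T * wa1 E" (is "_ = ?r6")
      unfolding k h(5) h(4) h(3) h(2) h(1) by (simp add: poly_simps)
    finally show "(u * v) ^ 6 * wa6 E'' = ?r6" .
  qed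
qed

lemma w_discriminant_short: "w_discriminant (Weierstrass 0 0 0 A B) = - 16 * (4 * A ^ 3 + 27 * B ^ 2)"
  unfolding w_discriminant_def by (simp add: poly_simps)

text \<open>This rules out the cusp y^2 = x^3 as a model of an elliptic curve; the pair (0, 0) could
  never be reduced to a minimal one.\<close>

lemma w_discriminant_eq_0_short:
  assumes "w_isomorphic E (Weierstrass 0 0 0 0 0)"
  shows "w_discriminant E = 0"
proof -
  obtain u r s t where "wa1 E = u * 0 - 2 * s \<and>
     wa2 E = u ^ 2 * 0 + s * wa1 E - 3 * r + s ^ 2 \<and>
     wa3 E = u ^ 3 * 0 - r * wa1 E - 2 * t \<and>
     wa4 E = u ^ 4 * 0 + s * wa3 E - 2 * r * wa2 E + (t + r * s) * wa1 E - 3 * r ^ 2 + 2 * s * t \<and>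
     wa6 E = u ^ 6 * 0 - r * wa4 E - r ^ 2 * wa2 E - r ^ 3 + t * wa3 E + t ^ 2 + r * t * wa1 E"
    using assms unfolding w_isomorphic_iff weierstrass.sel by blast
  then have h: "wa1 E = - 2 * s" "wa2 E = s * wa1 E - 3 * r + s ^ 2" "wa3 E = - r * wa1 E - 2 * t"
    "wa4 E = s * wa3 E - 2 * r * wa2 E + (t + r * s) * wa1 E - 3 * r ^ 2 + 2 * s * t"
    "wa6 E = - r * wa4 E - r ^ 2 * wa2 E - r ^ 3 + t * wa3 E + t ^ 2 + r * t * wa1 E" by auto
  have k1: "wa1 E = - 2 * s" by (rule h)
  have k2: "wa2 E = - (s ^ 2) - 3 * r" unfolding h(2) k1 by (simp add: algebra_simps power2_eq_square)
  have k3: "wa3 E = 2 * r * s - 2 * t" unfolding h(3) k1 by (simp add: algebra_simps)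
  have k4: "wa4 E = 3 * r ^ 2 - 2 * s * t + 2 * r * s ^ 2"
    unfolding h(4) k1 k2 k3 by (simp add: poly_simps)
  have k6: "wa6 E = - (r ^ 3) - (r * s - t) ^ 2"
    unfolding h(5) k1 k2 k3 k4 by (simp add: poly_simps)
  have b2: "wa1 E ^ 2 + 4 * wa2 E = - 12 * r"
    unfolding k1 k2 by (simp add: poly_simps)
  have b4: "2 * wa4 E + wa1 E * wa3 E = 6 * r ^ 2"
    unfolding k1 k3 k4 by (simp add: poly_simps)
  have b6: "wa3 E ^ 2 + 4 * wa6 E = - 4 * r ^ 3"
    unfolding k3 k6 by (simp add: poly_simps)
  have "wa1 E ^ 2 * wa6 E + 4 * wa2 E * wa6 E - wa1 E * wa3 E * wa4 E + wa2 E * wa3 E ^ 2 - wa4 E ^ 2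
      = (wa1 E ^ 2 + 4 * wa2 E) * wa6 E - wa1 E * wa3 E * wa4 E + wa2 E * wa3 E ^ 2 - wa4 E ^ 2"
    by (simp add: algebra_simps)
  also have "\<dots> = 3 * r ^ 4"
    unfolding b2 unfolding k1 k2 k3 k4 k6 by (simp add: poly_simps)
  finally show ?thesis unfolding w_discriminant_def Let_def b2 b4 b6
    by (simp add: poly_simps)
qed

text \<open>In characteristic 0 the vanishing of the first three coefficients forces s = r = t = 0,
  so only scaling remains.\<close>

lemma w_isomorphic_short_iff:
  fixes A B A' B' :: "'a::field_char_0"
  shows "w_isomorphic (Weierstrass 0 0 0 A B) (Weierstrass 0 0 0 A' B') \<longleftrightarrow>
    (\<exists>u. u \<noteq> 0 \<and> u ^ 4 * A' = A \<and> u ^ 6 * B' = B)"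
proof
  assume "w_isomorphic (Weierstrass 0 0 0 A B) (Weierstrass 0 0 0 A' B')"
  then obtain u r s t where "u \<noteq> 0" "0 = 2 * s" "0 = 3 * r - s ^ 2" "0 = 2 * t"
    "u ^ 4 * A' = A + 3 * r ^ 2 - 2 * s * t" "u ^ 6 * B' = B + r * A + r ^ 3 - t ^ 2"
    unfolding w_isomorphic_def by auto
  then show "\<exists>u. u \<noteq> 0 \<and> u ^ 4 * A' = A \<and> u ^ 6 * B' = B" by auto
next
  assume "\<exists>u. u \<noteq> 0 \<and> u ^ 4 * A' = A \<and> u ^ 6 * B' = B"
  then obtain u where "u \<noteq> 0" "u ^ 4 * A' = A" "u ^ 6 * B' = B" by blast
  then show "w_isomorphic (Weierstrass 0 0 0 A B) (Weierstrass 0 0 0 A' B')"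
    unfolding w_isomorphic_def by (intro exI[of _ u] exI[of _ 0]) simp
qed

lemma rat_lowest_terms:
  obtains p q :: int where "u = of_int p / (of_int q :: rat)" "q > 0" "coprime p q"
  by (metis quotient_of_coprime quotient_of_denom_pos quotient_of_div surj_pair)

text \<open>For u = p / q in lowest terms, minimality of (A', B') forces q = 1 and minimality of (A,
  B) forces |p| = 1; only even powers of u occur.\<close>

lemma minimal_pair_unique:
  assumes "w_isomorphic (short_model A B) (short_model A' B')" "minimal_pair A B" "minimal_pair A' B'"
  shows "A = A' \<and> B = B'"
proof -
  obtain u :: rat where u: "u \<noteq> 0" "u ^ 4 * of_int A' = of_int A" "u ^ 6 * of_int B' = of_int B"
    using assms(1) unfolding short_model_def w_isomorphic_short_iff by blast
  obtain p q :: int where pq: "u = of_int p / of_int q" "q > 0" "coprime p q" by (rule rat_lowest_terms)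
  have p0: "p \<noteq> 0" using u(1) pq by auto
  have "of_int (p ^ 4 * A') = (of_int (q ^ 4 * A) :: rat)" "of_int (p ^ 6 * B') = (of_int (q ^ 6 * B) :: rat)"
    using u(2,3) pq(2) unfolding pq(1) by (auto simp: field_simps)
  then have eq: "p ^ 4 * A' = q ^ 4 * A" "p ^ 6 * B' = q ^ 6 * B" by (simp_all only: of_int_eq_iff)
  have cop: "coprime (p ^ i) (q ^ i)" for i using pq(3) by simp
  have "q ^ 4 dvd p ^ 4 * A'" "q ^ 6 dvd p ^ 6 * B'" "p ^ 4 dvd q ^ 4 * A" "p ^ 6 dvd q ^ 6 * B"
    using eq by (metis dvd_triv_left)+
  then have "q ^ 4 dvd A'" "q ^ 6 dvd B'" "\<bar>p\<bar> ^ 4 dvd A" "\<bar>p\<bar> ^ 6 dvd B"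
    using cop[of 4] cop[of 6] by (simp_all add: coprime_dvd_mult_right_iff coprime_commute power_even_abs)
  then have "\<not> q > 1" "\<not> \<bar>p\<bar> > 1" using assms(2,3) unfolding minimal_pair_def by blast+
  then have "q = 1" "\<bar>p\<bar> = 1" using pq(2) p0 by auto
  then have "q = 1" "p ^ 4 = 1" "p ^ 6 = 1" by (auto simp flip: power_even_abs[of _ p])
  with eq show ?thesis by simp
qed

text \<open>The values of s, t and r complete the square in y and the cube in x; scaling then clears
  the denominators.\<close>

lemma exists_short_model:
  fixes E :: "rat weierstrass"
  shows "\<exists>A B. w_isomorphic E (short_model A B)"
proof -
  define s where "s = - wa1 E / 2"
  define r where "r = (s * wa1 E + s ^ 2 - wa2 E) / 3"
  define t where "t = - (wa3 E + r * wa1 E) / 2"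
  define v where "v = wa4 E - s * wa3 E + 2 * r * wa2 E - (t + r * s) * wa1 E + 3 * r ^ 2 - 2 * s * t"
  define w where "w = wa6 E + r * wa4 E + r ^ 2 * wa2 E + r ^ 3 - t * wa3 E - t ^ 2 - r * t * wa1 E"
  obtain x n where X: "v = of_int x / of_int n" "n > 0" by (metis rat_lowest_terms)
  obtain y m where Y: "w = of_int y / of_int m" "m > 0" by (metis rat_lowest_terms)
  \<comment> \<open>Scaling by u = 1 / (n m) multiplies x / n by (n m)^4 and y / m by (n
    m)^6.\<close>
  have "w_isomorphic E (short_model (x * n ^ 3 * m ^ 4) (y * n ^ 6 * m ^ 5))"
    unfolding w_isomorphic_def short_model_def weierstrass.sel
  proof (intro exI conjI)
    show "1 / of_int (n * m) \<noteq> (0::rat)" using X Y by simp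
    show "1 / of_int (n * m) * 0 = wa1 E + 2 * s" unfolding s_def by simp
    show "(1 / of_int (n * m)) ^ 2 * 0 = wa2 E - s * wa1 E + 3 * r - s ^ 2" unfolding r_def by simp
    show "(1 / of_int (n * m)) ^ 3 * 0 = wa3 E + r * wa1 E + 2 * t" unfolding t_def by simp
    have "(1 / of_int (n * m)) ^ 4 * of_int (x * n ^ 3 * m ^ 4) = v"
      using X Y by (simp add: field_simps power_numeral_reduce)
    then show "(1 / of_int (n * m)) ^ 4 * of_int (x * n ^ 3 * m ^ 4)
        = wa4 E - s * wa3 E + 2 * r * wa2 E - (t + r * s) * wa1 E + 3 * r ^ 2 - 2 * s * t"
      unfolding v_def .
    have "(1 / of_int (n * m)) ^ 6 * of_int (y * n ^ 6 * m ^ 5) = w"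
      using X Y by (simp add: field_simps power_numeral_reduce)
    then show "(1 / of_int (n * m)) ^ 6 * of_int (y * n ^ 6 * m ^ 5)
        = wa6 E + r * wa4 E + r ^ 2 * wa2 E + r ^ 3 - t * wa3 E - t ^ 2 - r * t * wa1 E"
      unfolding w_def .
  qed
  then show ?thesis by blast
qed

text \<open>Descent: a model with |A| + |B| least is minimal, since dividing by m^4 and m^6 would
  decrease the sum unless A = B = 0.\<close>

lemma exists_minimal_short_model:
  fixes E :: "rat weierstrass"
  assumes "E \<in> elliptic_curves"
  shows "\<exists>A B. minimal_pair A B \<and> w_isomorphic E (short_model A B)"
proof -
  obtain A B where AB: "w_isomorphic E (short_model A B)"
    and min: "\<And>A' B'. w_isomorphic E (short_model A' B') \<Longrightarrow> \<bar>A\<bar> + \<bar>B\<bar> \<le> \<bar>A'\<bar> + \<bar>B'\<bar>"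
  proof -
    let ?P = "\<lambda>x. w_isomorphic E (short_model (fst x) (snd x))"
    let ?f = "\<lambda>x. nat (\<bar>fst x\<bar> + \<bar>snd x\<bar>)"
    obtain A0 B0 where "?P (A0, B0)" using exists_short_model[of E] by auto
    then obtain x where x: "?P x" "\<forall>y. ?P y \<longrightarrow> ?f x \<le> ?f y"
      using ex_has_least_nat[of ?P "(A0, B0)" ?f] by blast
    show thesis
    proof (rule that[OF x(1)])
      fix A' B' assume "w_isomorphic E (short_model A' B')"
      then show "\<bar>fst x\<bar> + \<bar>snd x\<bar> \<le> \<bar>A'\<bar> + \<bar>B'\<bar>"
        using x(2)[rule_format, of "(A', B')"] by (simp add: nat_le_eq_zle)
    qed
  qed
  have "minimal_pair A B"
    unfolding minimal_pair_def
  proof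
    assume "\<exists>m>1. m ^ 4 dvd A \<and> m ^ 6 dvd B"
    then obtain m A' B' where m: "m > 1" "A = m ^ 4 * A'" "B = m ^ 6 * B'" by (auto elim!: dvdE)
    have "w_isomorphic (short_model A B) (short_model A' B')"
      unfolding short_model_def w_isomorphic_short_iff using m by (intro exI[of _ "of_int m"]) auto
    then have "w_isomorphic E (short_model A' B')" using AB w_isomorphic_trans by blast
    then have le: "\<bar>A\<bar> + \<bar>B\<bar> \<le> \<bar>A'\<bar> + \<bar>B'\<bar>" by (rule min)
    have "\<not> (A = 0 \<and> B = 0)"
    proof
      assume "A = 0 \<and> B = 0"
      then have "w_isomorphic E (Weierstrass 0 0 0 0 0)" using AB by (simp add: short_model_def)
      then show False using assms w_discriminant_eq_0_short unfolding elliptic_curves_def by blast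
    qed
    then have "A' \<noteq> 0 \<or> B' \<noteq> 0" using m by auto
    have m1: "m ^ 4 > 1" "m ^ 6 > 1" using m(1) by (simp_all add: one_less_power)
    have "\<bar>A'\<bar> \<le> \<bar>A\<bar>" "\<bar>B'\<bar> \<le> \<bar>B\<bar>" "A' \<noteq> 0 \<Longrightarrow> \<bar>A'\<bar> < \<bar>A\<bar>" "B' \<noteq> 0 \<Longrightarrow> \<bar>B'\<bar> < \<bar>B\<bar>"
      using m1 unfolding m(2,3) abs_mult by (auto simp: mult_le_cancel_right1 mult_less_cancel_right1)
    then show False using le \<open>A' \<noteq> 0 \<or> B' \<noteq> 0\<close> by linarith
  qed
  with AB show ?thesis by blast
qed

lemma minimal_short_coeffs_eq:
  assumes "minimal_pair A B" "w_isomorphic E (short_model A B)"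
  shows "minimal_short_coeffs E = (A, B)"
  unfolding minimal_short_coeffs_def
proof (rule the_equality)
  fix x assume "case x of (A, B) \<Rightarrow> minimal_pair A B \<and> w_isomorphic E (short_model A B)"
  then obtain A' B' where x: "x = (A', B')" "minimal_pair A' B'" "w_isomorphic E (short_model A' B')"
    by (cases x) auto
  have "w_isomorphic (short_model A B) (short_model A' B')"
    using assms(2) x(3) w_isomorphic_sym w_isomorphic_trans by blast
  then show "x = (A, B)" using minimal_pair_unique assms(1) x by blast
qed (use assms in auto)

lemma naive_height_eq:
  assumes "minimal_pair A B" "w_isomorphic E (short_model A B)"
  shows "naive_height E = pair_height A B"
  unfolding naive_height_def minimal_short_coeffs_eq[OF assms] by simp

section \<open>Isomorphism classes of bounded height\<close>

lemma pair_height_ge: "\<bar>A\<bar> \<le> pair_height A B" "\<bar>B\<bar> \<le> pair_height A B"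
proof -
  have "\<bar>A\<bar> \<le> \<bar>A\<bar> ^ 3" by (cases "A = 0") (auto intro: self_le_power)
  moreover have "4 * \<bar>A\<bar> ^ 3 \<le> pair_height A B" unfolding pair_height_def by (rule max.cobounded1)
  ultimately show "\<bar>A\<bar> \<le> pair_height A B" using zero_le_power[OF abs_ge_zero, of A 3] by linarith
  have "\<bar>B\<bar> \<le> \<bar>B\<bar> ^ 2" by (cases "B = 0") (simp, rule self_le_power, simp_all del: power2_abs)
  moreover have "27 * \<bar>B\<bar> ^ 2 \<le> pair_height A B" unfolding pair_height_def by (rule max.cobounded2)
  ultimately show "\<bar>B\<bar> \<le> pair_height A B" using zero_le_power[OF abs_ge_zero, of B 2] by linarith
qed

text \<open>Infinite sets have \<open>card\<close> 0, so a lower bound for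
  \<open>entangled_class_count\<close> depends on this finiteness. Each class is determined by a
  minimal pair in a bounded box.\<close>

lemma finite_classes_of_bounded_height:
  "finite {c \<in> elliptic_curves // isomorphism_rel. \<exists>E\<in>c. real_of_int (naive_height E) \<le> x}" (is "finite ?S")
proof (rule finite_subset)
  let ?g = "\<lambda>(A, B). {E \<in> elliptic_curves. w_isomorphic (short_model A B) E}"
  let ?N = "\<lfloor>x\<rfloor>"
  show "finite (?g ` ({- ?N..?N} \<times> {- ?N..?N}))" by simp
  show "?S \<subseteq> ?g ` ({- ?N..?N} \<times> {- ?N..?N})"
  proof
    fix c assume c: "c \<in> ?S"
    then obtain E0 E where E0: "E0 \<in> elliptic_curves" "c = isomorphism_rel `` {E0}"
      and E: "E \<in> c" "real_of_int (naive_height E) \<le> x" by (auto elim!: quotientE)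
    have E': "E \<in> elliptic_curves" "w_isomorphic E0 E" using E(1) E0 by (auto simp: isomorphism_rel_def)
    obtain A B where AB: "minimal_pair A B" "w_isomorphic E (short_model A B)"
      using exists_minimal_short_model[OF E'(1)] by blast
    have "real_of_int (pair_height A B) \<le> x" using E(2) naive_height_eq[OF AB] by simp
    then have "pair_height A B \<le> ?N" by (simp add: le_floor_iff)
    then have "\<bar>A\<bar> \<le> ?N" "\<bar>B\<bar> \<le> ?N" using pair_height_ge order_trans by blast+
    moreover have iso: "w_isomorphic E0 (short_model A B)" using E'(2) AB(2) w_isomorphic_trans by blast
    have "c = ?g (A, B)"
      unfolding E0(2) isomorphism_rel_def using E0(1) iso
      by (auto intro: w_isomorphic_trans w_isomorphic_sym)
    ultimately show "c \<in> ?g ` ({- ?N..?N} \<times> {- ?N..?N})" by (intro image_eqI[of _ _ "(A, B)"]) auto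
  qed
qed

text \<open>Different minimal pairs lie in different classes by \<open>minimal_pair_unique\<close>,
  and the short model of a minimal pair has the height of that pair.\<close>

lemma entangled_class_count_ge:
  assumes "finite S"
    and S: "\<And>A B. (A, B) \<in> S \<Longrightarrow> minimal_pair A B \<and> 4 * A ^ 3 + 27 * B ^ 2 \<noteq> 0 \<and>
      real_of_int (pair_height A B) \<le> x \<and> has_entanglement_2_3_Z2 (short_model A B)"
  shows "card S \<le> entangled_class_count x"
proof -
  let ?c = "\<lambda>(A, B). isomorphism_rel `` {short_model A B}"
  let ?T = "{c \<in> elliptic_curves // isomorphism_rel.
            \<exists>E\<in>c. real_of_int (naive_height E) \<le> x \<and> has_entanglement_2_3_Z2 E}"
  have ell: "short_model A B \<in> elliptic_curves" if "(A, B) \<in> S" for A B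
  proof -
    have "of_int (4 * A ^ 3 + 27 * B ^ 2) \<noteq> (0::rat)" using S[OF that] by (simp only: of_int_eq_0_iff) blast
    then show ?thesis unfolding short_model_def elliptic_curves_def mem_Collect_eq w_discriminant_short by simp
  qed
  have mem: "short_model A B \<in> ?c (A, B)" if "(A, B) \<in> S" for A B
    using ell[OF that] w_isomorphic_refl by (auto simp: isomorphism_rel_def)
  have "inj_on ?c S"
  proof (rule inj_onI)
    fix y z assume yz: "y \<in> S" "z \<in> S" "?c y = ?c z"
    obtain A B A' B' where e: "y = (A, B)" "z = (A', B')" by (metis surj_pair)
    have "short_model A' B' \<in> ?c (A, B)" using mem[of A' B'] yz unfolding e by simp
    then have "w_isomorphic (short_model A B) (short_model A' B')" by (auto simp: isomorphism_rel_def)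
    then show "y = z" using minimal_pair_unique S yz unfolding e by blast
  qed
  moreover have "?c ` S \<subseteq> ?T"
  proof
    fix c assume "c \<in> ?c ` S"
    then obtain A B where AB: "(A, B) \<in> S" "c = ?c (A, B)" by auto
    have "c \<in> elliptic_curves // isomorphism_rel" unfolding AB(2) using ell[OF AB(1)] by (auto intro: quotientI)
    moreover have "real_of_int (naive_height (short_model A B)) \<le> x"
      using S[OF AB(1)] naive_height_eq[of A B "short_model A B", OF _ w_isomorphic_refl] by simp
    ultimately show "c \<in> ?T" using S[OF AB(1)] mem[OF AB(1)] AB(2) by blast
  qed
  moreover have "finite ?T" by (rule finite_subset[OF _ finite_classes_of_bounded_height[of x]]) blast
  ultimately show ?thesis unfolding entangled_class_count_def by (rule card_inj_on_le)
qed

section \<open>Towers of quadratic and cubic extensions\<close>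

lemma inv_ring_of_type_algebra:
  fixes x :: "'a::field"
  assumes "x \<noteq> 0"
  shows "inv\<^bsub>ring_of_type_algebra\<^esub> x = inverse x"
proof -
  interpret R: cring "ring_of_type_algebra :: 'a ring" by (rule cring_from_type_algebra)
  show ?thesis
    by (rule R.comm_inv_char) (use assms in \<open>simp_all add: ring_of_type_algebra_def\<close>)
qed

lemma minus_ring_of_type_algebra: "\<ominus>\<^bsub>ring_of_type_algebra\<^esub> x = - (x :: 'a::field)"
proof -
  interpret R: ring "ring_of_type_algebra :: 'a ring" by (rule ring_from_type_algebra)
  show ?thesis
    by (rule R.minus_equality) (simp_all add: ring_of_type_algebra_def)
qed

text \<open>Stated in the operations of the type, so that membership reduces to arithmetic closure;
  as inverse 0 = 0, closure under inverses makes no exception for 0.\<close>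

definition subfield_set :: "'a::field set \<Rightarrow> bool" where
  "subfield_set S \<longleftrightarrow> 1 \<in> S \<and> (\<forall>x\<in>S. - x \<in> S \<and> inverse x \<in> S) \<and> (\<forall>x\<in>S. \<forall>y\<in>S. x + y \<in> S \<and> x * y \<in> S)"

lemma subfield_setD:
  assumes "subfield_set S"
  shows "1 \<in> S" "0 \<in> S" "x \<in> S \<Longrightarrow> - x \<in> S" "x \<in> S \<Longrightarrow> inverse x \<in> S"
    "x \<in> S \<Longrightarrow> y \<in> S \<Longrightarrow> x + y \<in> S" "x \<in> S \<Longrightarrow> y \<in> S \<Longrightarrow> x * y \<in> S"
    "x \<in> S \<Longrightarrow> y \<in> S \<Longrightarrow> x - y \<in> S" "x \<in> S \<Longrightarrow> y \<in> S \<Longrightarrow> x / y \<in> S"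
    "x \<in> S \<Longrightarrow> x ^ n \<in> S" "of_nat n \<in> S" "numeral k \<in> S"
proof -
  have *: "1 \<in> S" "\<And>x. x \<in> S \<Longrightarrow> - x \<in> S" "\<And>x. x \<in> S \<Longrightarrow> inverse x \<in> S"
    "\<And>x y. x \<in> S \<Longrightarrow> y \<in> S \<Longrightarrow> x + y \<in> S" "\<And>x y. x \<in> S \<Longrightarrow> y \<in> S \<Longrightarrow> x * y \<in> S"
    using assms unfolding subfield_set_def by blast+
  show 0: "0 \<in> S" using *(1) *(2)[of 1] *(4)[of 1 "- 1"] by simp
  show "x \<in> S \<Longrightarrow> y \<in> S \<Longrightarrow> x - y \<in> S" using *(2)[of y] *(4)[of x "- y"] by simp
  show "x \<in> S \<Longrightarrow> y \<in> S \<Longrightarrow> x / y \<in> S" using *(3)[of y] *(5)[of x "inverse y"] by (simp add: divide_inverse)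
  show "x \<in> S \<Longrightarrow> x ^ n \<in> S" by (induction n) (auto intro: *)
  show n: "of_nat n \<in> S" for n by (induction n) (auto intro: * 0)
  show "numeral k \<in> S" using n[of "numeral k"] by simp
qed (use assms in \<open>auto simp: subfield_set_def\<close>)

lemma generate_field_subset:
  assumes "subfield_set S" "H \<subseteq> S"
  shows "generate_field ring_of_type_algebra H \<subseteq> S"
proof
  fix x assume "x \<in> generate_field ring_of_type_algebra H"
  then show "x \<in> S"
  proof induction
    case (m_inv h)
    then show ?case using subfield_setD[OF assms(1)] inv_ring_of_type_algebra[of h]
      by (simp add: ring_of_type_algebra_def)
  next
    case (a_inv h)
    then show ?case using subfield_setD[OF assms(1)] by (simp add: minus_ring_of_type_algebra)
  qed (use assms subfield_setD[OF assms(1)] in \<open>auto simp: ring_of_type_algebra_def\<close>)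
qed

lemma subfield_set_generate_field: "subfield_set (generate_field ring_of_type_algebra (H :: 'a::field set))"
  unfolding subfield_set_def
proof (intro conjI ballI)
  let ?G = "generate_field ring_of_type_algebra H"
  show one: "1 \<in> ?G" using generate_field.one[of ring_of_type_algebra H] by (simp add: ring_of_type_algebra_def)
  fix x assume x: "x \<in> ?G"
  show m: "- x \<in> ?G" using generate_field.a_inv[OF x] by (simp add: minus_ring_of_type_algebra)
  fix y assume y: "y \<in> ?G"
  show "x + y \<in> ?G" using generate_field.eng_add[OF x y] by (simp add: ring_of_type_algebra_def)
  show "x * y \<in> ?G" using generate_field.eng_mult[OF x y] by (simp add: ring_of_type_algebra_def)
next
  let ?G = "generate_field ring_of_type_algebra H"
  fix x assume x: "x \<in> ?G"
  show "inverse x \<in> ?G"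
  proof (cases "x = 0")
    case False
    then show ?thesis using generate_field.m_inv[OF x] inv_ring_of_type_algebra[OF False]
      by (simp add: ring_of_type_algebra_def)
  qed (use x in simp)
qed

text \<open>This is S(c) when c^2 lies in S. The case of c in S is allowed and gives back S, which
  spares case distinctions in towers.\<close>

definition quad_ext :: "'a::field set \<Rightarrow> 'a \<Rightarrow> 'a set" where
  "quad_ext S c = {p + q * c | p q. p \<in> S \<and> q \<in> S}"

lemma quad_extI: "p \<in> S \<Longrightarrow> q \<in> S \<Longrightarrow> p + q * c \<in> quad_ext S c"
  unfolding quad_ext_def by blast

lemma quad_extE:
  assumes "x \<in> quad_ext S c"
  obtains p q where "x = p + q * c" "p \<in> S" "q \<in> S"
  using assms unfolding quad_ext_def by blast

lemma quad_ext_incl: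
  assumes "subfield_set S"
  shows "S \<subseteq> quad_ext S c" "c \<in> quad_ext S c"
proof -
  note S = subfield_setD[OF assms]
  show "S \<subseteq> quad_ext S c" unfolding quad_ext_def using S(2) by force
  show "c \<in> quad_ext S c" unfolding quad_ext_def using S(1,2) by force
qed

lemma quad_ext_minimal:
  assumes "subfield_set T" "S \<subseteq> T" "c \<in> T"
  shows "quad_ext S c \<subseteq> T"
proof
  fix x assume "x \<in> quad_ext S c"
  then obtain p q where "x = p + q * c" "p \<in> S" "q \<in> S" by (rule quad_extE)
  then show "x \<in> T" using assms by (auto intro!: subfield_setD[OF assms(1)])
qed

text \<open>The inverse is the conjugate p - q c divided by the norm p^2 - q^2 c^2. For c outside S
  the norm vanishes only at p = q = 0.\<close>

lemma subfield_set_quad_ext: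
  assumes S: "subfield_set S" and c: "c ^ 2 \<in> S"
  shows "subfield_set (quad_ext S c)"
proof -
  note S = subfield_setD[OF S]
  have inv: "inverse (p + q * c) \<in> quad_ext S c" if pq: "p \<in> S" "q \<in> S" for p q
  proof (cases "c \<in> S")
    case True
    then have "inverse (p + q * c) \<in> S" using pq by (simp add: S)
    then show ?thesis using quad_ext_incl[OF assms(1)] by blast
  next
    case False
    define n where "n = p ^ 2 - q ^ 2 * c ^ 2"
    have nS: "n \<in> S" unfolding n_def using pq c by (simp add: S)
    show ?thesis
    proof (cases "n = 0")
      case True
      then have "(p - q * c) * (p + q * c) = 0" unfolding n_def by (simp add: algebra_simps power2_eq_square)
      then have pqc: "p = q * c \<or> p = - (q * c)" by (auto simp: eq_neg_iff_add_eq_0)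
      have "q = 0"
      proof (rule ccontr)
        assume q: "q \<noteq> 0"
        then have "c = p / q \<or> c = - (p / q)" using pqc by auto
        moreover have "p / q \<in> S" "- (p / q) \<in> S" using pq by (simp_all add: S)
        ultimately show False using False by metis
      qed
      then have "inverse (p + q * c) = 0" using pqc by auto
      then show ?thesis using S(2) quad_ext_incl(1)[OF assms(1)] by auto
    next
      case n0: False
      have "(p + q * c) * (p / n + (- q / n) * c) = (p ^ 2 - q ^ 2 * c ^ 2) / n"
        by (simp add: algebra_simps power2_eq_square diff_divide_distrib add_divide_distrib)
      also have "\<dots> = 1" using n0 unfolding n_def by simp
      finally have "inverse (p + q * c) = p / n + (- q / n) * c" by (rule inverse_unique)
      moreover have "p / n \<in> S" "- q / n \<in> S" using pq nS by (simp_all add: S)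
      ultimately show ?thesis using quad_extI by metis
    qed
  qed
  have neg: "- (p + q * c) \<in> quad_ext S c" if "p \<in> S" "q \<in> S" for p q
    using quad_extI[of "- p" S "- q" c] that by (simp add: S)
  have add: "(p + q * c) + (p' + q' * c) \<in> quad_ext S c" if "p \<in> S" "q \<in> S" "p' \<in> S" "q' \<in> S" for p q p' q'
  proof -
    have "(p + q * c) + (p' + q' * c) = (p + p') + (q + q') * c" by (simp add: algebra_simps)
    moreover have "(p + p') + (q + q') * c \<in> quad_ext S c" by (rule quad_extI) (simp_all add: S that)
    ultimately show ?thesis by metis
  qed
  have mult: "(p + q * c) * (p' + q' * c) \<in> quad_ext S c" if "p \<in> S" "q \<in> S" "p' \<in> S" "q' \<in> S" for p q p' q'
  proof -
    have "(p + q * c) * (p' + q' * c) = (p * p' + q * q' * c ^ 2) + (p * q' + q * p') * c"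
      by (simp add: algebra_simps power2_eq_square)
    moreover have "(p * p' + q * q' * c ^ 2) + (p * q' + q * p') * c \<in> quad_ext S c"
      by (rule quad_extI) (simp_all add: S that c)
    ultimately show ?thesis by metis
  qed
  have "1 \<in> quad_ext S c" using S(1) quad_ext_incl[OF assms(1)] by blast
  moreover have "- x \<in> quad_ext S c" "inverse x \<in> quad_ext S c" if x: "x \<in> quad_ext S c" for x
    by (rule quad_extE[OF x], simp only: neg inv)+
  moreover have "x + y \<in> quad_ext S c" "x * y \<in> quad_ext S c"
    if x: "x \<in> quad_ext S c" and y: "y \<in> quad_ext S c" for x y
    by (rule quad_extE[OF x], rule quad_extE[OF y], simp only: add mult)+
  ultimately show ?thesis unfolding subfield_set_def by simp
qed

text \<open>The classical step of the proof that the cube cannot be doubled with ruler and compass.\<close>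
lemma cubic_root_quad_ext:
  assumes S: "subfield_set S" and c: "c ^ 2 \<in> S" and AB: "A \<in> S" "B \<in> S"
    and x: "x \<in> quad_ext S c" "x ^ 3 + A * x + B = 0"
  shows "\<exists>y\<in>S. y ^ 3 + A * y + B = 0"
proof -
  note S' = subfield_setD[OF S]
  obtain p q where pq: "x = p + q * c" "p \<in> S" "q \<in> S" using x(1) unfolding quad_ext_def by blast
  define U V where "U = p ^ 3 + 3 * p * q ^ 2 * c ^ 2 + A * p + B" and "V = 3 * p ^ 2 * q + q ^ 3 * c ^ 2 + A * q"
  have UV: "U \<in> S" "V \<in> S" unfolding U_def V_def using pq AB c by (simp_all add: S')
  have eq: "U + V * c = 0"
    using x(2) unfolding pq U_def V_def by (simp add: poly_simps)
  show ?thesis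
  proof (cases "c \<in> S \<or> q = 0")
    case True
    then have "x \<in> S" using pq by (auto simp: S')
    then show ?thesis using x(2) by blast
  next
    case False
    have "V = 0"
    proof (rule ccontr)
      assume "V \<noteq> 0"
      then have "c = - (U / V)" using eq by (simp add: field_simps eq_neg_iff_add_eq_0)
      moreover have "- (U / V) \<in> S" using UV by (simp add: S')
      ultimately show False using False by metis
    qed
    then have "U = 0" using eq by simp
    have A: "A = - (3 * p ^ 2 + q ^ 2 * c ^ 2)"
    proof -
      have "q * (A + (3 * p ^ 2 + q ^ 2 * c ^ 2)) = V" unfolding V_def by (simp add: poly_simps)
      then have "A + (3 * p ^ 2 + q ^ 2 * c ^ 2) = 0" using \<open>V = 0\<close> False by (metis mult_eq_0_iff)
      then show ?thesis by (simp only: eq_neg_iff_add_eq_0)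
    qed
    have B: "B = - (p ^ 3 + 3 * p * q ^ 2 * c ^ 2 + A * p)"
      using \<open>U = 0\<close> unfolding U_def by (simp only: eq_neg_iff_add_eq_0 add_ac)
    \<comment> \<open>V = 0 makes p - q c a root as well; the three roots sum to 0, so the third one
      is -2 p.\<close>
    have "(- 2 * p) ^ 3 + A * (- 2 * p) + B = 0"
      unfolding B A by (simp add: poly_simps)
    moreover have "- 2 * p \<in> S" using pq by (simp add: S')
    ultimately show ?thesis by blast
  qed
qed

inductive sqrt_tower :: "'a::field set \<Rightarrow> 'a set \<Rightarrow> bool" for S where
  base: "sqrt_tower S S"
| step: "sqrt_tower S T \<Longrightarrow> c ^ 2 \<in> T \<Longrightarrow> sqrt_tower S (quad_ext T c)"

lemma sqrt_tower_subfield: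
  assumes "sqrt_tower S T" "subfield_set S"
  shows "subfield_set T \<and> S \<subseteq> T"
  using assms
proof induction
  case (step T c)
  then show ?case using subfield_set_quad_ext quad_ext_incl(1) by blast
qed auto

lemma cubic_root_sqrt_tower:
  assumes "sqrt_tower S T" "subfield_set S" "A \<in> S" "B \<in> S" "x \<in> T" "x ^ 3 + A * x + B = 0"
  shows "\<exists>y\<in>S. y ^ 3 + A * y + B = 0"
  using assms
proof (induction arbitrary: x)
  case (step T c)
  have T: "subfield_set T" "S \<subseteq> T" using sqrt_tower_subfield step by blast+
  obtain y where "y \<in> T" "y ^ 3 + A * y + B = 0"
    using cubic_root_quad_ext[OF T(1) step.hyps(2), of A B x] step.prems T(2) by blast
  then show ?case using step by blast
qed auto

text \<open>If q or r were nonzero, e would satisfy an equation of degree at most 2 over the tower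
  T. One more square root would then reach e, against \<open>cubic_root_sqrt_tower\<close>.\<close>

lemma sqrt_tower_cubic_element:
  fixes e :: "'a::field_char_0"
  assumes T: "sqrt_tower S T" "subfield_set S" and AB: "A \<in> S" "B \<in> S" and e: "e ^ 3 + A * e + B = 0"
    and no: "\<not> (\<exists>y\<in>S. y ^ 3 + A * y + B = 0)"
    and pqr: "p \<in> S" "q \<in> S" "r \<in> S" "p + q * e + r * e ^ 2 \<in> T"
  shows "q = 0 \<and> r = 0"
proof (rule ccontr)
  assume nz: "\<not> (q = 0 \<and> r = 0)"
  have T': "subfield_set T" "S \<subseteq> T" using sqrt_tower_subfield T by blast+
  note TD = subfield_setD[OF T'(1)]
  have pqrT: "p \<in> T" "q \<in> T" "r \<in> T" using pqr T'(2) by blast+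
  define x where "x = p + q * e + r * e ^ 2"
  have x: "x \<in> T" unfolding x_def by (rule pqr)
  show False
  proof (cases "r = 0")
    case True
    then have "e = (x - p) / q" using nz unfolding x_def by (simp add: field_simps)
    then have "e \<in> T" using pqrT x by (simp add: TD)
    then show False using cubic_root_sqrt_tower[OF T AB _ e] no by blast
  next
    case False
    \<comment> \<open>Completing the square in r e^2 + q e + (p - x) = 0; c^2 is the
      discriminant.\<close>
    define c where "c = 2 * r * e + q"
    have "c ^ 2 = q ^ 2 + 4 * r * (x - p)"
      unfolding c_def x_def by (simp add: poly_simps)
    moreover have "q ^ 2 + 4 * r * (x - p) \<in> T" using pqrT x by (simp add: TD)
    ultimately have c: "c ^ 2 \<in> T" by metis
    have Tc: "sqrt_tower S (quad_ext T c)" using T(1) c by (rule sqrt_tower.step)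
    have sf: "subfield_set (quad_ext T c)" "c \<in> quad_ext T c" "T \<subseteq> quad_ext T c"
      using subfield_set_quad_ext[OF T'(1) c] quad_ext_incl[OF T'(1)] by blast+
    have "e = (c - q) / (2 * r)" using False unfolding c_def by (simp add: field_simps)
    moreover have "(c - q) / (2 * r) \<in> quad_ext T c"
      using sf(2) subsetD[OF sf(3) pqrT(2)] subsetD[OF sf(3) pqrT(3)] by (simp add: subfield_setD[OF sf(1)])
    ultimately have "e \<in> quad_ext T c" by metis
    then show False using cubic_root_sqrt_tower[OF Tc T(2) AB _ e] no by blast
  qed
qed

section \<open>The cubic extension in coordinates on 1, e, e^2\<close>

definition cubic_ext :: "'a::field set \<Rightarrow> 'a \<Rightarrow> 'a set" where
  "cubic_ext S e = {p + q * e + r * e ^ 2 | p q r. p \<in> S \<and> q \<in> S \<and> r \<in> S}"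

lemma cubic_extI: "p \<in> S \<Longrightarrow> q \<in> S \<Longrightarrow> r \<in> S \<Longrightarrow> p + q * e + r * e ^ 2 \<in> cubic_ext S e"
  unfolding cubic_ext_def by blast

lemma cubic_extE:
  assumes "x \<in> cubic_ext S e"
  obtains p q r where "x = p + q * e + r * e ^ 2" "p \<in> S" "q \<in> S" "r \<in> S"
  using assms unfolding cubic_ext_def by blast

text \<open>The nonzero vector (1, x, y) is in the kernel; combining the rows with the cofactors of
  the first column isolates the determinant.\<close>

lemma det3_eq_0:
  fixes x y :: "'a::comm_ring_1"
  assumes "a11 + a12 * x + a13 * y = 0" "a21 + a22 * x + a23 * y = 0" "a31 + a32 * x + a33 * y = 0"
  shows "a11 * (a22 * a33 - a23 * a32) - a12 * (a21 * a33 - a23 * a31) + a13 * (a21 * a32 - a22 * a31) = 0"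
proof -
  have "a11 * (a22 * a33 - a23 * a32) - a12 * (a21 * a33 - a23 * a31) + a13 * (a21 * a32 - a22 * a31)
    = (a22 * a33 - a23 * a32) * (a11 + a12 * x + a13 * y) - (a12 * a33 - a13 * a32) * (a21 + a22 * x + a23 * y)
      + (a12 * a23 - a13 * a22) * (a31 + a32 * x + a33 * y)"
    by (simp add: algebra_simps)
  then show ?thesis unfolding assms by simp
qed

text \<open>By Cayley-Hamilton for multiplication by x, x (x^2 - t x + s) = n with t, s, n in S,
  which yields the inverse when n is nonzero. If n = 0 and x is nonzero, x is at most quadratic over
  S and hence lies in S by \<open>sqrt_tower_cubic_element\<close>.\<close>

lemma subfield_set_cubic_ext:
  fixes e :: "'a::field_char_0"
  assumes S: "subfield_set S" and AB: "A \<in> S" "B \<in> S" and e: "e ^ 3 + A * e + B = 0"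
    and no: "\<not> (\<exists>y\<in>S. y ^ 3 + A * y + B = 0)"
  shows "subfield_set (cubic_ext S e)"
proof -
  note SD = subfield_setD[OF S]
  have e3: "e ^ 3 = - A * e - B" using e by (simp add: eq_neg_iff_add_eq_0 algebra_simps)
  have e4: "e ^ 4 = - A * e ^ 2 - B * e"
  proof -
    have "e ^ 4 = e * e ^ 3" by (simp add: power_numeral_reduce)
    then show ?thesis unfolding e3 by (simp add: algebra_simps power2_eq_square)
  qed
  have mult: "x * y \<in> cubic_ext S e" if xy: "x \<in> cubic_ext S e" "y \<in> cubic_ext S e" for x y
  proof -
    obtain p q r where x: "x = p + q * e + r * e ^ 2" "p \<in> S" "q \<in> S" "r \<in> S" by (rule cubic_extE[OF xy(1)])
    obtain p' q' r' where y: "y = p' + q' * e + r' * e ^ 2" "p' \<in> S" "q' \<in> S" "r' \<in> S" by (rule cubic_extE[OF xy(2)])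
    have "x * y = p * p' + (p * q' + q * p') * e + (p * r' + q * q' + r * p') * e ^ 2 + (q * r' + r * q') * e ^ 3 + r * r' * e ^ 4"
      unfolding x y by (simp add: poly_simps)
    also have "\<dots> = (p * p' - (q * r' + r * q') * B) + (p * q' + q * p' - (q * r' + r * q') * A - r * r' * B) * e
        + (p * r' + q * q' + r * p' - r * r' * A) * e ^ 2"
      unfolding e3 e4 by (simp add: algebra_simps)
    also have "\<dots> \<in> cubic_ext S e" by (rule cubic_extI) (use x y AB in \<open>simp_all add: SD\<close>)
    finally show ?thesis .
  qed
  have add: "x + y \<in> cubic_ext S e" if xy: "x \<in> cubic_ext S e" "y \<in> cubic_ext S e" for x y
  proof -
    obtain p q r where x: "x = p + q * e + r * e ^ 2" "p \<in> S" "q \<in> S" "r \<in> S" by (rule cubic_extE[OF xy(1)])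
    obtain p' q' r' where y: "y = p' + q' * e + r' * e ^ 2" "p' \<in> S" "q' \<in> S" "r' \<in> S" by (rule cubic_extE[OF xy(2)])
    have "x + y = (p + p') + (q + q') * e + (r + r') * e ^ 2" unfolding x y by (simp add: algebra_simps)
    also have "\<dots> \<in> cubic_ext S e" by (rule cubic_extI) (use x y in \<open>simp_all add: SD\<close>)
    finally show ?thesis .
  qed
  have base: "S \<subseteq> cubic_ext S e" unfolding cubic_ext_def using SD(2) by force
  have neg: "- x \<in> cubic_ext S e" if "x \<in> cubic_ext S e" for x
    using mult[OF _ that, of "- 1"] base SD(3)[OF SD(1)] by auto
  have inv: "inverse x \<in> cubic_ext S e" if xe: "x \<in> cubic_ext S e" for x
  proof -
    obtain p q r where x: "x = p + q * e + r * e ^ 2" and pqr: "p \<in> S" "q \<in> S" "r \<in> S" by (rule cubic_extE[OF xe])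
    \<comment> \<open>In the matrix of multiplication by x on 1, e, e^2 the diagonal is p, h, h; its
      trace is t, its second invariant s and its determinant n.\<close>
    define h where "h = p - r * A"
    define t where "t = p + 2 * h"
    define s where "s = 2 * p * h + h ^ 2 + 3 * q * r * B + q ^ 2 * A"
    define n where "n = p * (h ^ 2 + q * (r * B + q * A)) - q * (q ^ 2 * B - r * B * h) + r * (r * B * (r * B + q * A) + q * B * h)"
    have "h \<in> S" unfolding h_def using pqr AB by (simp add: SD)
    then have S': "t \<in> S" "s \<in> S" "n \<in> S" unfolding t_def s_def n_def using pqr AB by (simp_all add: SD)
    have 1: "(p - x) + q * e + r * e ^ 2 = 0" unfolding x by simp
    have "x * e = p * e + q * e ^ 2 + r * e ^ 3" unfolding x by (simp add: poly_simps)
    then have 2: "- r * B + (h - x) * e + q * e ^ 2 = 0" unfolding e3 h_def by (simp add: algebra_simps)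
    have "x * e ^ 2 = p * e ^ 2 + q * e ^ 3 + r * e ^ 4" unfolding x by (simp add: poly_simps)
    then have 3: "- q * B + (- r * B - q * A) * e + (h - x) * e ^ 2 = 0" unfolding e3 e4 h_def by (simp add: algebra_simps)
    have "n - x * (x ^ 2 - t * x + s) = 0"
      using det3_eq_0[OF 1 2 3] unfolding n_def t_def s_def by (simp add: poly_simps)
    then have n: "x * (x ^ 2 - t * x + s) = n" by simp
    have "- t \<in> cubic_ext S e" "s \<in> cubic_ext S e" using S' base SD(3) by blast+
    then have "x * x + (- t) * x + s \<in> cubic_ext S e" using xe by (intro add mult)
    then have y: "x ^ 2 - t * x + s \<in> cubic_ext S e" by (simp add: power2_eq_square)
    show ?thesis
    proof (cases "n = 0 \<and> x \<noteq> 0")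
      case True
      then have "x ^ 2 - t * x + s = 0" using n by simp
      \<comment> \<open>c^2 is the discriminant of X^2 - t X + s.\<close>
      define c where "c = 2 * x - t"
      have "c ^ 2 = 4 * (x ^ 2 - t * x + s) + (t ^ 2 - 4 * s)"
        unfolding c_def by (simp add: poly_simps)
      also have "\<dots> \<in> S" unfolding \<open>x ^ 2 - t * x + s = 0\<close> using S' by (simp add: SD)
      finally have c: "c ^ 2 \<in> S" .
      have sf: "subfield_set (quad_ext S c)" "c \<in> quad_ext S c" "S \<subseteq> quad_ext S c"
        using subfield_set_quad_ext[OF S c] quad_ext_incl[OF S] by blast+
      have "x = (c + t) / 2" unfolding c_def by simp
      also have "\<dots> \<in> quad_ext S c"
        using sf(2) subsetD[OF sf(3) S'(1)] by (simp add: subfield_setD[OF sf(1)])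
      finally have "x \<in> quad_ext S c" .
      moreover have "sqrt_tower S (quad_ext S c)" using c by (intro sqrt_tower.intros)
      ultimately have "q = 0 \<and> r = 0"
        using sqrt_tower_cubic_element[OF _ S AB e no pqr] unfolding x by blast
      then have "x \<in> S" unfolding x using pqr by simp
      then show ?thesis using base SD(4) by blast
    next
      case False
      show ?thesis
      proof (cases "x = 0")
        case True
        then show ?thesis using base SD(2) by auto
      next
        case x0: False
        then have "inverse x = inverse n * (x ^ 2 - t * x + s)" using False n by (auto simp: field_simps)
        then show ?thesis using mult[OF _ y] base SD(4)[OF S'(3)] by (metis subsetD)
      qed
    qed
  qed
  show ?thesis unfolding subfield_set_def
    by (intro conjI ballI mult add neg inv subsetD[OF base SD(1)])
qed

section \<open>Torsion points\<close>

lemma point_mult_2: "point_mult E 2 (Affine x y) = point_add E (Affine x y) (Affine x y)"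
  unfolding point_mult_def by (simp add: numeral_2_eq_2)

lemma point_mult_3: "point_mult E 3 (Affine x y) = point_add E (Affine x y) (point_add E (Affine x y) (Affine x y))"
  unfolding point_mult_def by (simp add: numeral_3_eq_3)

lemma torsion_points_2_iff:
  fixes A B :: "'a::field_char_0"
  shows "Affine x y \<in> torsion_points (Weierstrass 0 0 0 A B) 2 \<longleftrightarrow> y = 0 \<and> x ^ 3 + A * x + B = 0"
proof -
  have "y + y = 0 \<longleftrightarrow> y = 0" by (simp flip: mult_2)
  then show ?thesis
    unfolding torsion_points_def mem_Collect_eq point_mult_2 by (auto simp: Let_def)
qed

text \<open>For y nonzero, 3P = 0 means 2P = -P, which comes down to equal x-coordinates, that is
  l^2 = 3 x for the tangent slope l. Clearing denominators gives the 3-division polynomial.\<close>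

lemma torsion_points_3_iff:
  fixes A B :: "'a::field_char_0"
  assumes "4 * A ^ 3 + 27 * B ^ 2 \<noteq> 0"
  shows "Affine x y \<in> torsion_points (Weierstrass 0 0 0 A B) 3 \<longleftrightarrow>
    y ^ 2 = x ^ 3 + A * x + B \<and> 3 * x ^ 4 + 6 * A * x ^ 2 + 12 * B * x - A ^ 2 = 0"
proof -
  let ?E = "Weierstrass 0 0 0 A B"
  define l where "l = (3 * x ^ 2 + A) / (2 * y)"
  define x3 where "x3 = l ^ 2 - x - x"
  have psi: "3 * x ^ 4 + 6 * A * x ^ 2 + 12 * B * x - A ^ 2 = 12 * x * (x ^ 3 + A * x + B) - (3 * x ^ 2 + A) ^ 2"
    by (simp add: poly_simps)
  have on: "on_curve ?E (Affine x y) \<longleftrightarrow> y ^ 2 = x ^ 3 + A * x + B" by simp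
  show ?thesis
  proof (cases "y = 0")
    case True
    \<comment> \<open>At y = 0 the division polynomial equals -(3 x^2 + A)^2, so its vanishing would
      make x a double root of the cubic.\<close>
    have "\<not> (0 = x ^ 3 + A * x + B \<and> 3 * x ^ 4 + 6 * A * x ^ 2 + 12 * B * x - A ^ 2 = 0)"
    proof
      assume *: "0 = x ^ 3 + A * x + B \<and> 3 * x ^ 4 + 6 * A * x ^ 2 + 12 * B * x - A ^ 2 = 0"
      then have f: "x ^ 3 + A * x + B = 0" by simp
      have "12 * x * (x ^ 3 + A * x + B) - (3 * x ^ 2 + A) ^ 2 = 0" using * unfolding psi by blast
      then have "3 * x ^ 2 + A = 0" unfolding f by simp
      then have A: "A = - (3 * x ^ 2)" by (simp add: eq_neg_iff_add_eq_0 add.commute)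
      then have "B = 2 * x ^ 3" using * by (simp add: poly_simps)
      then have "4 * A ^ 3 + 27 * B ^ 2 = 0" unfolding A by (simp add: poly_simps)
      then show False using assms by blast
    qed
    moreover have "Affine x y \<notin> torsion_points ?E 3"
      unfolding torsion_points_def mem_Collect_eq point_mult_3 using True by simp
    ultimately show ?thesis using True by auto
  next
    case False
    then have y2: "y + y \<noteq> 0" by (simp flip: mult_2)
    have dbl: "point_add ?E (Affine x y) (Affine x y) = Affine x3 (- (l * (x3 - x) + y))"
      using y2 unfolding x3_def l_def by (simp add: Let_def)
    have tri: "point_add ?E (Affine x y) (Affine x3 z) = At_Infinity \<longleftrightarrow> x = x3 \<and> y + z = 0" for z
      by (simp add: Let_def)
    have "Affine x y \<in> torsion_points ?E 3 \<longleftrightarrow> y ^ 2 = x ^ 3 + A * x + B \<and> x = x3"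
      unfolding torsion_points_def mem_Collect_eq point_mult_3 on dbl tri by auto
    also have "x = x3 \<longleftrightarrow> l ^ 2 = 3 * x" unfolding x3_def by (auto simp: algebra_simps)
    also have "\<dots> \<longleftrightarrow> (3 * x ^ 2 + A) ^ 2 = 12 * x * y ^ 2"
      using False unfolding l_def power_divide by (simp add: field_simps)
    finally show ?thesis unfolding psi by auto
  qed
qed

text \<open>Over Q(c) the division polynomial splits into two quadratics interchanged by c to -c,
  each with the square completed. A 3-torsion x-coordinate is thus -a c or a c plus one square
  root.\<close>

lemma three_division_factorization:
  fixes a b c x :: "'a::field_char_0"
  assumes c: "c ^ 2 = C_form a b"
  shows "3 * x ^ 4 + 6 * A_form a b * x ^ 2 + 12 * B_form a b * x - A_form a b ^ 2
    = 3 * (((x + a * c) ^ 2 - 2 * c ^ 2 * (a ^ 2 + 18 * b ^ 2 + c)) * ((x - a * c) ^ 2 - 2 * c ^ 2 * (a ^ 2 + 18 * b ^ 2 - c)))"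
proof -
  \<comment> \<open>The quadratics have constant terms -c^2 (u + 2 c) and -c^2 (u - 2 c). The
    relation u^2 - 4 c^2 = -3 s^2 makes their product match -A^2 / 3.\<close>
  define s u where "s = a ^ 2 + 12 * b ^ 2" and "u = a ^ 2 + 36 * b ^ 2"
  have AB: "A_form a b = - (3 * s * c ^ 2)" "B_form a b = 2 * a * c ^ 4"
    unfolding A_form_eq B_form_eq s_def by (simp_all flip: c power_mult)
  have 1: "(x + a * c) ^ 2 - 2 * c ^ 2 * (a ^ 2 + 18 * b ^ 2 + c) = x ^ 2 + 2 * a * c * x - c ^ 2 * (u + 2 * c)"
    and 2: "(x - a * c) ^ 2 - 2 * c ^ 2 * (a ^ 2 + 18 * b ^ 2 - c) = x ^ 2 - 2 * a * c * x - c ^ 2 * (u - 2 * c)"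
    unfolding u_def by (simp_all add: poly_simps)
  have p: "c ^ 2 * (u + 2 * a ^ 2) = 3 * s * c ^ 2" unfolding u_def s_def by (simp add: algebra_simps)
  have q: "u ^ 2 - 4 * c ^ 2 = - 3 * s ^ 2"
    unfolding c C_form_def u_def s_def by (simp add: poly_simps)
  have "(x ^ 2 + 2 * a * c * x - c ^ 2 * (u + 2 * c)) * (x ^ 2 - 2 * a * c * x - c ^ 2 * (u - 2 * c))
      = x ^ 4 - 2 * (c ^ 2 * (u + 2 * a ^ 2)) * x ^ 2 + 8 * a * c ^ 4 * x + c ^ 4 * (u ^ 2 - 4 * c ^ 2)"
    by (simp add: poly_simps)
  also have "\<dots> = x ^ 4 - 2 * (3 * s * c ^ 2) * x ^ 2 + 8 * a * c ^ 4 * x + c ^ 4 * (- 3 * s ^ 2)"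
    unfolding p q ..
  finally have prod: "(x ^ 2 + 2 * a * c * x - c ^ 2 * (u + 2 * c)) * (x ^ 2 - 2 * a * c * x - c ^ 2 * (u - 2 * c))
      = x ^ 4 - 2 * (3 * s * c ^ 2) * x ^ 2 + 8 * a * c ^ 4 * x + c ^ 4 * (- 3 * s ^ 2)" .
  show ?thesis unfolding 1 2 AB prod
    by (simp add: poly_simps)
qed

section \<open>The entanglement field\<close>

text \<open>The construction of \<open>division_field\<close> over an arbitrary base Q inside an
  arbitrary field, which frees the argument from the type \<open>rat alg_closure\<close>.\<close>

definition torsion_field :: "'a::field set \<Rightarrow> 'a weierstrass \<Rightarrow> nat \<Rightarrow> 'a set" where
  "torsion_field Q E n = generate_field ring_of_type_algebra
    (Q \<union> (\<Union>{{x, y} | x y. Affine x y \<in> torsion_points E n}))"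

lemma torsion_field_subset:
  assumes "subfield_set S" "Q \<subseteq> S" "\<And>x y. Affine x y \<in> torsion_points E n \<Longrightarrow> x \<in> S \<and> y \<in> S"
  shows "torsion_field Q E n \<subseteq> S"
  unfolding torsion_field_def using assms by (intro generate_field_subset) auto

lemma torsion_field_coords:
  assumes "Affine x y \<in> torsion_points E n"
  shows "x \<in> torsion_field Q E n" "y \<in> torsion_field Q E n"
proof -
  have "x \<in> \<Union>{{x, y} | x y. Affine x y \<in> torsion_points E n}" "y \<in> \<Union>{{x, y} | x y. Affine x y \<in> torsion_points E n}"
    using assms by blast+
  then show "x \<in> torsion_field Q E n" "y \<in> torsion_field Q E n"
    unfolding torsion_field_def by (blast intro: generate_field.incl)+
qed

lemma torsion_field_base: "Q \<subseteq> torsion_field Q E n"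
  unfolding torsion_field_def by (blast intro: generate_field.incl)

lemma subfield_set_torsion_field: "subfield_set (torsion_field Q E n)"
  unfolding torsion_field_def by (rule subfield_set_generate_field)

text \<open>With third root y' = -e - y one has 2 y + e = y - y' and 3 e^2 + A = (e - y) (e - y'),
  so the left side is the squared product of the root differences.\<close>

lemma cubic_other_root:
  fixes e :: "'a::field"
  assumes "e ^ 3 + A * e + B = 0" "y ^ 3 + A * y + B = 0" "y \<noteq> e"
  shows "((2 * y + e) * (3 * e ^ 2 + A)) ^ 2 = - (4 * A ^ 3 + 27 * B ^ 2)"
proof -
  have "(y - e) * (y ^ 2 + y * e + e ^ 2 + A) = (y ^ 3 + A * y + B) - (e ^ 3 + A * e + B)"
    by (simp add: poly_simps)
  then have y: "y ^ 2 + y * e + e ^ 2 + A = 0" using assms by simp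
  have B: "B = - (e ^ 3 + A * e)" using assms(1) by (simp only: eq_neg_iff_add_eq_0 add_ac)
  have "(2 * y + e) ^ 2 = 4 * (y ^ 2 + y * e + e ^ 2 + A) - 3 * e ^ 2 - 4 * A"
    by (simp add: poly_simps)
  then have "(2 * y + e) ^ 2 = - 3 * e ^ 2 - 4 * A" unfolding y by simp
  then have "((2 * y + e) * (3 * e ^ 2 + A)) ^ 2 = (- 3 * e ^ 2 - 4 * A) * (3 * e ^ 2 + A) ^ 2"
    by (simp only: power_mult_distrib)
  also have "\<dots> = - (4 * A ^ 3 + 27 * B ^ 2)" unfolding B by (simp add: poly_simps)
  finally show ?thesis .
qed

lemma cubic_simple_root:
  fixes e :: "'a::field"
  assumes "e ^ 3 + A * e + B = 0" "4 * A ^ 3 + 27 * B ^ 2 \<noteq> 0"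
  shows "3 * e ^ 2 + A \<noteq> 0"
proof
  assume "3 * e ^ 2 + A = 0"
  then have A: "A = - (3 * e ^ 2)" by (simp add: eq_neg_iff_add_eq_0 add.commute)
  have "B = - (e ^ 3 + A * e)" using assms(1) by (simp only: eq_neg_iff_add_eq_0 add_ac)
  then have "B = 2 * e ^ 3" unfolding A by (simp add: poly_simps)
  then have "4 * A ^ 3 + 27 * B ^ 2 = 0" unfolding A by (simp add: poly_simps)
  then show False using assms(2) by blast
qed

lemma sqrt_exists: "\<exists>w. w ^ 2 = (x :: 'a::alg_closed_field)"
  using nth_root_exists[of 2 x] by auto

lemma cubic_root_exists: "\<exists>e. e ^ 3 + A * e + B = (0 :: 'a::alg_closed_field)"
proof -
  have "Polynomial.degree [:B, A, 0, 1:] > 0" by simp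
  then obtain e where "poly [:B, A, 0, 1:] e = 0" using alg_closed_imp_poly_has_root by blast
  then show ?thesis by (intro exI[of _ e]) (simp add: poly_simps)
qed

lemma sqrt_tower_adjoin_sqrts:
  assumes "sqrt_tower S T" "subfield_set S" "set xs \<subseteq> T"
  shows "\<exists>U. sqrt_tower S U \<and> T \<subseteq> U \<and> (\<forall>y. y ^ 2 \<in> set xs \<longrightarrow> (y :: 'a::alg_closed_field) \<in> U)"
  using assms(3)
proof (induction xs)
  case Nil
  then show ?case using assms(1) by auto
next
  case (Cons x xs)
  then obtain U where U: "sqrt_tower S U" "T \<subseteq> U" "\<forall>y. y ^ 2 \<in> set xs \<longrightarrow> y \<in> U" by auto
  have sfU: "subfield_set U" using sqrt_tower_subfield U(1) assms(2) by blast
  obtain w where w: "w ^ 2 = x" using sqrt_exists by blast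
  have wU: "w ^ 2 \<in> U" using w Cons.prems U(2) by auto
  have sf: "subfield_set (quad_ext U w)" by (rule subfield_set_quad_ext[OF sfU wU])
  have incl: "U \<subseteq> quad_ext U w" "w \<in> quad_ext U w" using quad_ext_incl[OF sfU] by blast+
  have "y \<in> quad_ext U w" if "y ^ 2 = x" for y
  proof -
    have "y = w \<or> y = - w" using that w by (simp only: power2_eq_iff[symmetric])
    then show ?thesis using incl(2) subfield_setD(3)[OF sf] by auto
  qed
  then show ?case using sqrt_tower.step[OF U(1) wU] U(2,3) incl(1) by (intro exI[of _ "quad_ext U w"]) auto
qed

text \<open>
  The 3-division field lies in a tower of square roots over \<open>Q(\<surd>C)\<close>, while the 2-division field is
  generated over \<open>Q(\<surd>C)\<close> by a root of a cubic polynomial.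
\<close>
lemma torsion_fields_inter:
  fixes a b c :: "'a::{alg_closed_field, field_char_0}"
  assumes Q: "subfield_set Q" and ab: "a \<in> Q" "b \<in> Q" "a \<noteq> 0" "b \<noteq> 0"
    and c: "c ^ 2 = C_form a b" and c0: "c \<noteq> 0"
  defines "E \<equiv> Weierstrass 0 0 0 (A_form a b) (B_form a b)"
  shows "torsion_field Q E 2 \<inter> torsion_field Q E 3 = quad_ext Q c"
proof
  define A B where "A = A_form a b" and "B = B_form a b"
  have E: "E = Weierstrass 0 0 0 A B" unfolding E_def A_def B_def ..
  note QD = subfield_setD[OF Q]
  let ?L = "quad_ext Q c" and ?F2 = "torsion_field Q E 2" and ?F3 = "torsion_field Q E 3"
  have cQ: "c ^ 2 \<in> Q" unfolding c C_form_def using ab by (simp add: QD)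
  have L: "subfield_set ?L" by (rule subfield_set_quad_ext[OF Q cQ])
  note LD = subfield_setD[OF L]
  have QL: "Q \<subseteq> ?L" and cL: "c \<in> ?L" using quad_ext_incl[OF Q] by blast+
  have ABQ: "A \<in> Q" "B \<in> Q" unfolding A_def B_def A_form_def B_form_def C_form_def using ab by (simp_all add: QD)
  have ABL: "A \<in> ?L" "B \<in> ?L" using ABQ QL by blast+
  have abL: "a \<in> ?L" "b \<in> ?L" using ab QL by blast+
  \<comment> \<open>Chosen so that k c is a square root of the discriminant of the cubic.\<close>
  define k where "k = 432 * b ^ 3 * c ^ 2"
  have kL: "k \<in> ?L" unfolding k_def using abL cL by (simp add: LD)
  have k0: "k \<noteq> 0" unfolding k_def using ab c0 by simp
  have disc: "- (4 * A ^ 3 + 27 * B ^ 2) = (k * c) ^ 2"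
    unfolding A_def B_def discriminant_form k_def by (simp add: power_mult_distrib flip: c power_mult power_add)
  have disc0: "4 * A ^ 3 + 27 * B ^ 2 \<noteq> 0"
  proof
    assume "4 * A ^ 3 + 27 * B ^ 2 = 0"
    then have "(k * c) ^ 2 = 0" unfolding disc[symmetric] by simp
    then show False using k0 c0 by simp
  qed
  \<comment> \<open>A field with one root e and a square root of the discriminant contains every
    root, by solving \<open>cubic_other_root\<close> for y.\<close>
  have cubic_roots: "y \<in> S" if S: "subfield_set S" "?L \<subseteq> S" "e \<in> S" and e: "e ^ 3 + A * e + B = 0"
    and y: "y ^ 3 + A * y + B = 0" for S e y
  proof (cases "y = e")
    case False
    note SD = subfield_setD[OF S(1)]
    define d where "d = 3 * e ^ 2 + A"
    have d0: "d \<noteq> 0" unfolding d_def by (rule cubic_simple_root[OF e disc0])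
    have "((2 * y + e) * d) ^ 2 = (k * c) ^ 2"
      using cubic_other_root[OF e y False] disc unfolding d_def by simp
    then have "(2 * y + e) * d = k * c \<or> (2 * y + e) * d = - (k * c)" by (simp only: power2_eq_iff)
    then have "y = (k * c / d - e) / 2 \<or> y = (- (k * c) / d - e) / 2" using d0 by (auto simp: field_simps)
    moreover have "d \<in> S" "k \<in> S" "c \<in> S" unfolding d_def using S ABL kL cL by (auto simp: SD)
    then have "(k * c / d - e) / 2 \<in> S" "(- (k * c) / d - e) / 2 \<in> S" using S(3) by (simp_all add: SD)
    ultimately show ?thesis by metis
  qed (use S in simp)
  have t2: "Affine x y \<in> torsion_points E 2 \<longleftrightarrow> y = 0 \<and> x ^ 3 + A * x + B = 0" for x y
    unfolding E by (rule torsion_points_2_iff)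
  have t3: "Affine x y \<in> torsion_points E 3 \<longleftrightarrow> y ^ 2 = x ^ 3 + A * x + B \<and>
      ((x + a * c) ^ 2 - 2 * c ^ 2 * (a ^ 2 + 18 * b ^ 2 + c)) * ((x - a * c) ^ 2 - 2 * c ^ 2 * (a ^ 2 + 18 * b ^ 2 - c)) = 0" for x y
    unfolding E torsion_points_3_iff[OF disc0] unfolding A_def B_def three_division_factorization[OF c]
    by (simp only: mult_eq_0_iff zero_neq_numeral[symmetric] simp_thms)
  obtain e where e: "e ^ 3 + A * e + B = 0" using cubic_root_exists by blast
  show "?L \<subseteq> ?F2 \<inter> ?F3"
  proof (intro Int_greatest quad_ext_minimal subfield_set_torsion_field torsion_field_base)
    note F2 = subfield_setD[OF subfield_set_torsion_field[of Q E 2]]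
    \<comment> \<open>A second root comes from the quadratic formula for the cofactor of x - e; the
      two roots then express c through the root of the discriminant.\<close>
    obtain w where w: "w ^ 2 = - 3 * e ^ 2 - 4 * A" using sqrt_exists by blast
    define y where "y = (w - e) / 2"
    have yw: "2 * y + e = w" unfolding y_def by (simp add: field_simps)
    define z where "z = y ^ 2 + y * e + e ^ 2 + A"
    have "4 * z = w ^ 2 + 3 * e ^ 2 + 4 * A"
      unfolding yw[symmetric] z_def by (simp add: poly_simps)
    then have "z = 0" unfolding w by simp
    then have q: "y ^ 2 + y * e + e ^ 2 + A = 0" unfolding z_def .
    have "y ^ 3 + A * y + B = (y - e) * (y ^ 2 + y * e + e ^ 2 + A) + (e ^ 3 + A * e + B)"
      by (simp add: poly_simps)
    then have y: "y ^ 3 + A * y + B = 0" unfolding q e by simp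
    have yne: "y \<noteq> e"
    proof
      assume "y = e"
      then have "3 * e ^ 2 + A = 0" using q by (simp add: power2_eq_square)
      then show False using cubic_simple_root[OF e disc0] by blast
    qed
    have "((2 * y + e) * (3 * e ^ 2 + A)) ^ 2 = (k * c) ^ 2"
      using cubic_other_root[OF e y yne] disc by simp
    then have "(2 * y + e) * (3 * e ^ 2 + A) = k * c \<or> (2 * y + e) * (3 * e ^ 2 + A) = - (k * c)"
      by (simp only: power2_eq_iff)
    moreover define v where "v = (2 * y + e) * (3 * e ^ 2 + A)"
    ultimately have "v = k * c \<or> v = - (k * c)" by simp
    then have "c = v / k \<or> c = - v / k" using k0 by (auto simp: field_simps)
    moreover have "e \<in> ?F2" "y \<in> ?F2"
      using e y t2 torsion_field_coords(1)[of _ 0 E 2 Q] by simp_all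
    then have v: "v \<in> ?F2" unfolding v_def using subsetD[OF torsion_field_base ABQ(1)] by (simp add: F2)
    moreover have "k \<in> ?F2"
      unfolding k_def c C_form_def using subsetD[OF torsion_field_base ab(1)] subsetD[OF torsion_field_base ab(2)]
      by (simp add: F2)
    then have "v / k \<in> ?F2" "- v / k \<in> ?F2" using v by (simp_all add: F2)
    ultimately show "c \<in> ?F2" by metis
  next
    note F3 = subfield_setD[OF subfield_set_torsion_field[of Q E 3]]
    obtain m where m: "m ^ 2 = 2 * (a ^ 2 + 18 * b ^ 2 + c)" using sqrt_exists by blast
    have x3: "- (a * c) + c * m \<in> ?F3" "- (a * c) - c * m \<in> ?F3"
    proof -
      have "x \<in> ?F3" if "x + a * c = c * m \<or> x + a * c = - (c * m)" for x
      proof -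
        have "(x + a * c) ^ 2 = c ^ 2 * m ^ 2" using that by (auto simp: power_mult_distrib)
        moreover obtain y where "y ^ 2 = x ^ 3 + A * x + B" using sqrt_exists by blast
        ultimately have "Affine x y \<in> torsion_points E 3" unfolding t3 m by simp
        then show ?thesis by (rule torsion_field_coords)
      qed
      then show "- (a * c) + c * m \<in> ?F3" "- (a * c) - c * m \<in> ?F3" by simp_all
    qed
    \<comment> \<open>Both roots of the first quadratic factor are x-coordinates of 3-torsion
      points, and their sum is -2 a c; here a must be nonzero.\<close>
    have "c = - ((- (a * c) + c * m) + (- (a * c) - c * m)) / (2 * a)" using ab by simp
    moreover have "a \<in> ?F3" using torsion_field_base ab(1) by blast
    then have "- ((- (a * c) + c * m) + (- (a * c) - c * m)) / (2 * a) \<in> ?F3" 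
      by (intro F3 x3)
    ultimately show "c \<in> ?F3" by metis
  qed
  \<comment> \<open>If the cubic has a root in L, all its roots are in L and so is the 2-division
    field. Otherwise an element of both fields has coordinates on 1, e, e^2 and lies in a tower, so
    only the first coordinate survives.\<close>
  show "?F2 \<inter> ?F3 \<subseteq> ?L"
  proof (cases "\<exists>y\<in>?L. y ^ 3 + A * y + B = 0")
    case True
    then obtain y where y: "y \<in> ?L" "y ^ 3 + A * y + B = 0" by blast
    have "?F2 \<subseteq> ?L"
      by (rule torsion_field_subset[OF L QL]) (use cubic_roots[OF L _ y] LD(2) in \<open>auto simp: t2\<close>)
    then show ?thesis by blast
  next
    case False
    have M: "subfield_set (cubic_ext ?L e)" by (rule subfield_set_cubic_ext[OF L ABL e False])
    have LM: "?L \<subseteq> cubic_ext ?L e"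
      using cubic_extI[OF _ LD(2) LD(2), of _ e] by fastforce
    have eM: "e \<in> cubic_ext ?L e" using cubic_extI[OF LD(2) LD(1) LD(2), of e] by simp
    have F2: "?F2 \<subseteq> cubic_ext ?L e"
    proof (rule torsion_field_subset[OF M])
      show "Q \<subseteq> cubic_ext ?L e" using QL LM by blast
      show "x \<in> cubic_ext ?L e \<and> y \<in> cubic_ext ?L e" if "Affine x y \<in> torsion_points E 2" for x y
        using that cubic_roots[OF M LM eM e] subfield_setD(2)[OF M] by (auto simp: t2)
    qed
    let ?d1 = "2 * c ^ 2 * (a ^ 2 + 18 * b ^ 2 + c)" and ?d2 = "2 * c ^ 2 * (a ^ 2 + 18 * b ^ 2 - c)"
    have "?d1 \<in> ?L" "?d2 \<in> ?L" using abL cL by (simp_all add: LD)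
    then obtain U where U: "sqrt_tower ?L U" "?L \<subseteq> U" "\<forall>y. y ^ 2 \<in> {?d1, ?d2} \<longrightarrow> y \<in> U"
      using sqrt_tower_adjoin_sqrts[OF sqrt_tower.base L, of "[?d1, ?d2]"] by auto
    have sU: "subfield_set U" using sqrt_tower_subfield[OF U(1) L] by blast
    note UD = subfield_setD[OF sU]
    obtain w1 w2 where w: "w1 ^ 2 = ?d1" "w2 ^ 2 = ?d2" using sqrt_exists by metis
    have wU: "w1 \<in> U" "w2 \<in> U" using w U(3) by auto
    \<comment> \<open>All possible x-coordinates of 3-torsion points; a second round of square roots
      then supplies the y-coordinates.\<close>
    define xs where "xs = [w1 - a * c, - w1 - a * c, w2 + a * c, - w2 + a * c]"
    have XU: "x \<in> U" if "x \<in> set xs" for x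
      using that wU subsetD[OF U(2) cL] subsetD[OF U(2) abL(1)] unfolding xs_def by (auto simp: UD)
    have rhs: "set (map (\<lambda>x. x ^ 3 + A * x + B) xs) \<subseteq> U"
      using XU subsetD[OF U(2) ABL(1)] subsetD[OF U(2) ABL(2)] by (auto simp: UD)
    obtain V where V: "sqrt_tower ?L V" "U \<subseteq> V" "\<forall>y. y ^ 2 \<in> set (map (\<lambda>x. x ^ 3 + A * x + B) xs) \<longrightarrow> y \<in> V"
      using sqrt_tower_adjoin_sqrts[OF U(1) L rhs] by blast
    have sV: "subfield_set V" using sqrt_tower_subfield[OF V(1) L] by blast
    have F3: "?F3 \<subseteq> V"
    proof (rule torsion_field_subset[OF sV])
      show "Q \<subseteq> V" using QL U(2) V(2) by blast
      fix x y assume xy: "Affine x y \<in> torsion_points E 3"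
      then have "(x + a * c) ^ 2 = w1 ^ 2 \<or> (x - a * c) ^ 2 = w2 ^ 2" unfolding t3 w by auto
      then have "x \<in> set xs" unfolding xs_def power2_eq_iff by (auto simp: algebra_simps)
      then show "x \<in> V \<and> y \<in> V" using XU V(2,3) xy unfolding t3 by auto
    qed
    show ?thesis
    proof
      fix z assume z: "z \<in> ?F2 \<inter> ?F3"
      then obtain p q r where pqr: "z = p + q * e + r * e ^ 2" "p \<in> ?L" "q \<in> ?L" "r \<in> ?L"
        using F2 by (blast elim: cubic_extE)
      have "q = 0 \<and> r = 0"
        using sqrt_tower_cubic_element[OF V(1) L ABL e False pqr(2,3,4)] z F3 pqr(1) by blast
      then show "z \<in> ?L" using pqr by simp
    qed
  qed
qed

section \<open>The Galois group of a quadratic extension\<close>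

definition quad_conj :: "'a::field set \<Rightarrow> 'a \<Rightarrow> 'a \<Rightarrow> 'a" where
  "quad_conj S c x = (THE y. \<exists>p\<in>S. \<exists>q\<in>S. x = p + q * c \<and> y = p - q * c)"

lemma quad_ext_unique:
  assumes S: "subfield_set S" "c \<notin> S"
    and "p \<in> S" "q \<in> S" "p' \<in> S" "q' \<in> S" "p + q * c = p' + q' * c"
  shows "p = p' \<and> q = q'"
proof -
  have "q = q'"
  proof (rule ccontr)
    assume "q \<noteq> q'"
    then have "c = (p' - p) / (q - q')" using assms(7) by (simp add: field_simps)
    moreover have "(p' - p) / (q - q') \<in> S" using assms(3-6) by (simp add: subfield_setD[OF S(1)])
    ultimately show False using S(2) by metis
  qed
  then show ?thesis using assms(7) by simp
qed

lemma quad_conj_eq: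
  assumes "subfield_set S" "c \<notin> S" "p \<in> S" "q \<in> S"
  shows "quad_conj S c (p + q * c) = p - q * c"
  unfolding quad_conj_def
proof (rule the_equality)
  show "\<exists>p'\<in>S. \<exists>q'\<in>S. p + q * c = p' + q' * c \<and> p - q * c = p' - q' * c" using assms(3,4) by blast
  show "y = p - q * c" if "\<exists>p'\<in>S. \<exists>q'\<in>S. p + q * c = p' + q' * c \<and> y = p' - q' * c" for y
    using that quad_ext_unique[OF assms] by blast
qed

text \<open>An automorphism fixing S keeps c^2, so it sends c to c or -c, and this choice determines
  it.\<close>

lemma galois_group_quad_ext:
  fixes c :: "'a::field_char_0"
  assumes S: "subfield_set S" and c: "c ^ 2 \<in> S" "c \<notin> S"
  shows "galois_group (quad_ext S c) S \<cong> integer_mod_group 2"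
proof -
  note SD = subfield_setD[OF S]
  let ?K = "quad_ext S c"
  let ?R = "ring_of_type_algebra\<lparr>carrier := ?K\<rparr>"
  have K: "subfield_set ?K" by (rule subfield_set_quad_ext[OF S c(1)])
  note KD = subfield_setD[OF K]
  have SK: "S \<subseteq> ?K" and cK: "c \<in> ?K" using quad_ext_incl[OF S] by blast+
  \<comment> \<open>Elements of \<open>Bij\<close> are extensional, so both maps are restricted to K
    to have a fixed value outside.\<close>
  define id' where "id' = (\<lambda>x\<in>?K. x)"
  define cj where "cj = (\<lambda>x\<in>?K. quad_conj S c x)"
  have cj: "cj (p + q * c) = p - q * c" if "p \<in> S" "q \<in> S" for p q
    unfolding cj_def using quad_conj_eq[OF S c(2) that] quad_extI[OF that, of c] by simp
  have cjK: "cj x \<in> ?K" if xK: "x \<in> ?K" for x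
  proof -
    obtain p q where x: "x = p + q * c" "p \<in> S" "q \<in> S" by (rule quad_extE[OF xK])
    have "p + (- q) * c \<in> ?K" using x SD by (intro quad_extI)
    then show ?thesis using cj[OF x(2,3)] x(1) by simp
  qed
  have cjcj: "cj (cj x) = x" if xK: "x \<in> ?K" for x
  proof -
    obtain p q where x: "x = p + q * c" "p \<in> S" "q \<in> S" by (rule quad_extE[OF xK])
    show ?thesis using cj[OF x(2,3)] cj[OF x(2) SD(3)[OF x(3)]] x(1) by simp
  qed
  have cj_fix: "cj x = x" if "x \<in> S" for x using cj[OF that SD(2)] by simp
  have cj_add: "cj (x + y) = cj x + cj y" and cj_mult: "cj (x * y) = cj x * cj y" if xK: "x \<in> ?K" "y \<in> ?K" for x y
  proof -
    obtain p q where x: "x = p + q * c" "p \<in> S" "q \<in> S" by (rule quad_extE[OF xK(1)])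
    obtain p' q' where y: "y = p' + q' * c" "p' \<in> S" "q' \<in> S" by (rule quad_extE[OF xK(2)])
    have 1: "x + y = (p + p') + (q + q') * c" unfolding x y by (simp add: algebra_simps)
    have 2: "x * y = (p * p' + q * q' * c ^ 2) + (p * q' + q * p') * c"
      unfolding x y by (simp add: algebra_simps power2_eq_square)
    have cx: "cj x = p - q * c" unfolding x(1) by (rule cj[OF x(2,3)])
    have cy: "cj y = p' - q' * c" unfolding y(1) by (rule cj[OF y(2,3)])
    have "cj (x + y) = (p + p') - (q + q') * c" unfolding 1 by (rule cj) (use x y in \<open>simp_all add: SD\<close>)
    then show "cj (x + y) = cj x + cj y" unfolding cx cy by (simp add: algebra_simps)
    have "cj (x * y) = (p * p' + q * q' * c ^ 2) - (p * q' + q * p') * c"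
      unfolding 2 by (rule cj) (use x y c(1) in \<open>simp_all add: SD\<close>)
    then show "cj (x * y) = cj x * cj y"
      unfolding cx cy by (simp add: algebra_simps power2_eq_square)
  qed
  have "bij_betw cj ?K ?K"
    by (rule bij_betw_byWitness[of _ cj]) (use cjcj cjK in auto)
  then have bij: "id' \<in> Bij ?K" "cj \<in> Bij ?K"
    unfolding id'_def using id_Bij[of ?K] by (simp_all add: Bij_def cj_def)
  have ops: "carrier ?R = ?K" "mult ?R = (*)" "add ?R = (+)" "one ?R = 1" by (simp_all add: ring_of_type_algebra_def)
  define G where "G = carrier (galois_group ?K S)"
  have G: "\<sigma> \<in> G \<longleftrightarrow> \<sigma> \<in> Bij ?K \<and> (\<forall>x\<in>?K. \<forall>y\<in>?K. \<sigma> (x * y) = \<sigma> x * \<sigma> y \<and> \<sigma> (x + y) = \<sigma> x + \<sigma> y)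
      \<and> \<sigma> 1 = 1 \<and> (\<forall>x\<in>S. \<sigma> x = x)" for \<sigma>
  proof -
    have "\<sigma> \<in> Bij ?K \<Longrightarrow> bij_betw \<sigma> ?K ?K \<and> (\<forall>x\<in>?K. \<sigma> x \<in> ?K)" by (auto simp: Bij_def bij_betw_def)
    moreover have "G = {\<sigma> \<in> Bij ?K. \<sigma> \<in> ring_iso ?R ?R \<and> (\<forall>x\<in>S. \<sigma> x = x)}"
      unfolding G_def galois_group_def by simp
    ultimately show ?thesis
      unfolding ring_iso_def ring_hom_def mem_Collect_eq ops Pi_iff by blast
  qed
  have carrier: "G = {id', cj}"
  proof (intro equalityI subsetI)
    fix \<sigma> assume "\<sigma> \<in> G"
    then have s: "\<sigma> \<in> Bij ?K" "\<And>x y. x \<in> ?K \<Longrightarrow> y \<in> ?K \<Longrightarrow> \<sigma> (x * y) = \<sigma> x * \<sigma> y"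
      "\<And>x y. x \<in> ?K \<Longrightarrow> y \<in> ?K \<Longrightarrow> \<sigma> (x + y) = \<sigma> x + \<sigma> y" "\<And>x. x \<in> S \<Longrightarrow> \<sigma> x = x"
      unfolding G by blast+
    have "\<sigma> c ^ 2 = \<sigma> (c ^ 2)" using s(2)[OF cK cK] by (simp add: power2_eq_square)
    also have "\<dots> = c ^ 2" by (rule s(4)[OF c(1)])
    finally have sc: "\<sigma> c = c \<or> \<sigma> c = - c" by (simp only: power2_eq_iff)
    have val: "\<sigma> (p + q * c) = p + q * \<sigma> c" if "p \<in> S" "q \<in> S" for p q
      using s(3)[OF subsetD[OF SK that(1)] KD(6)[OF subsetD[OF SK that(2)] cK]] s(2)[OF subsetD[OF SK that(2)] cK]
        s(4)[OF that(1)] s(4)[OF that(2)] by simp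
    have ext: "\<sigma> \<in> extensional ?K" using s(1) by (simp add: Bij_def)
    show "\<sigma> \<in> {id', cj}"
    proof (cases "\<sigma> c = c")
      case True
      have "\<sigma> = id'"
      proof (rule extensionalityI[OF ext])
        show "id' \<in> extensional ?K" unfolding id'_def by simp
        fix x assume x: "x \<in> ?K"
        then obtain p q where pq: "x = p + q * c" "p \<in> S" "q \<in> S" by (rule quad_extE)
        show "\<sigma> x = id' x" using val[OF pq(2,3)] True pq(1) x unfolding id'_def by simp
      qed
      then show ?thesis by simp
    next
      case False
      have "\<sigma> = cj"
      proof (rule extensionalityI[OF ext])
        show "cj \<in> extensional ?K" unfolding cj_def by simp
        fix x assume x: "x \<in> ?K"
        then obtain p q where pq: "x = p + q * c" "p \<in> S" "q \<in> S" by (rule quad_extE)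
        show "\<sigma> x = cj x" using val[OF pq(2,3)] cj[OF pq(2,3)] False sc pq(1) by simp
      qed
      then show ?thesis by simp
    qed
  next
    fix \<sigma> assume "\<sigma> \<in> {id', cj}"
    then show "\<sigma> \<in> G"
    proof
      assume "\<sigma> = id'"
      then show ?thesis unfolding G using bij(1) KD SK by (auto simp: id'_def)
    next
      assume "\<sigma> \<in> {cj}"
      then have "\<sigma> = cj" by simp
      then show ?thesis unfolding G using bij(2) cj_add cj_mult cj_fix cj_fix[OF SD(1)] by blast
    qed
  qed
  have ne: "id' \<noteq> cj"
  proof
    assume "id' = cj"
    then have "cj c = c" using cK unfolding id'_def by (metis restrict_apply')
    then have "c = - c" using cj[OF SD(2,1)] by simp
    then have "c = 0" by (simp add: eq_neg_iff_add_eq_0 flip: mult_2)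
    then show False using c(2) SD(2) by simp
  qed
  have mult: "mult (galois_group ?K S) \<sigma> \<tau> = compose ?K \<sigma> \<tau>" if "\<sigma> \<in> G" "\<tau> \<in> G" for \<sigma> \<tau>
    using that G unfolding galois_group_def BijGroup_def by simp
  have comp: "compose ?K id' id' = id'" "compose ?K id' cj = cj" "compose ?K cj id' = cj" "compose ?K cj cj = id'"
    unfolding compose_def id'_def using cjK cjcj by (auto simp: fun_eq_iff restrict_def cj_def)
  define h :: "('a \<Rightarrow> 'a) \<Rightarrow> int" where "h \<sigma> = (if \<sigma> = id' then 0 else 1)" for \<sigma>
  have h: "h id' = 0" "h cj = 1" unfolding h_def using ne by auto
  have Z: "carrier (integer_mod_group 2) = {0, 1}" by (auto simp: carrier_integer_mod_group)
  have "h \<in> iso (galois_group ?K S) (integer_mod_group 2)"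
    unfolding iso_def hom_def mem_Collect_eq G_def[symmetric] Z
  proof (intro conjI ballI funcsetI)
    show "bij_betw h G {0, 1}" unfolding carrier bij_betw_def using h ne by (auto simp: inj_on_def)
    show "h \<sigma> \<in> {0, 1}" for \<sigma> unfolding h_def by simp
    fix \<sigma> \<tau> assume st: "\<sigma> \<in> G" "\<tau> \<in> G"
    then show "h (\<sigma> \<otimes>\<^bsub>galois_group ?K S\<^esub> \<tau>) = h \<sigma> \<otimes>\<^bsub>integer_mod_group 2\<^esub> h \<tau>"
      unfolding mult[OF st] unfolding carrier by (auto simp: comp h integer_mod_group_def)
  qed
  then show ?thesis unfolding is_iso_def by blast
qed

section \<open>Entanglement for the curves of the family\<close>

lemma forms_to_ac:
  "map_weierstrass to_ac (short_model (A_form a b) (B_form a b))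
    = Weierstrass 0 0 0 (A_form (of_int a) (of_int b)) (B_form (of_int a) (of_int b))"
  unfolding short_model_def A_form_def B_form_def C_form_def by simp

text \<open>2 is a nonresidue modulo 5: p^2 = 2 q^2 modulo 5 forces 5 to divide both p and q,
  against lowest terms.\<close>

lemma not_square_if_mod_5:
  fixes r :: rat and n :: int
  assumes "n mod 5 = 2"
  shows "r ^ 2 \<noteq> of_int n"
proof
  assume r: "r ^ 2 = of_int n"
  obtain p q where pq: "r = of_int p / of_int q" "q > 0" "coprime p q" by (rule rat_lowest_terms)
  have "of_int (p ^ 2) = (of_int (n * q ^ 2) :: rat)"
    using r pq(2) unfolding pq(1) by (simp add: field_simps)
  then have eq: "p ^ 2 = n * q ^ 2" by (simp only: of_int_eq_iff)
  have "(p mod 5) ^ 2 mod 5 = (2 * (q mod 5) ^ 2) mod 5"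
    using arg_cong[OF eq, of "\<lambda>x. x mod 5"] assms by (metis mod_mult_eq power_mod mod_mult_right_eq mod_mult_left_eq)
  moreover have "p mod 5 \<in> {0, 1, 2, 3, 4}" "q mod 5 \<in> {0, 1, 2, 3, 4}" by auto
  ultimately have "p mod 5 = 0 \<and> q mod 5 = 0" by auto
  then have "5 dvd p" "5 dvd q" by auto
  then have "is_unit (5::int)" using pq(3) coprime_common_divisor by blast
  then show False by simp
qed

lemma entanglement_of_forms:
  fixes a b :: int
  assumes "a \<noteq> 0" "b \<noteq> 0" "C_form a b mod 5 = 2"
  shows "has_entanglement_2_3_Z2 (short_model (A_form a b) (B_form a b))"
proof -
  let ?a = "of_int a :: rat alg_closure" and ?b = "of_int b :: rat alg_closure"
  let ?E = "short_model (A_form a b) (B_form a b)"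
  have Q: "subfield_set rationals_ac"
    unfolding subfield_set_def
    by (auto simp flip: to_ac_1 to_ac_add to_ac_mult to_ac_minus to_ac_inverse)
  have of_int: "of_int z \<in> rationals_ac" for z by (metis rangeI to_ac_of_int)
  obtain c where c: "c ^ 2 = C_form ?a ?b" using sqrt_exists by blast
  have C: "C_form ?a ?b = to_ac (of_int (C_form a b))" unfolding C_form_def by simp
  have cQ: "c \<notin> rationals_ac"
  proof
    assume "c \<in> rationals_ac"
    then obtain r where "c = to_ac r" by blast
    then have "to_ac (r ^ 2) = to_ac (of_int (C_form a b))" using c C by simp
    then show False using not_square_if_mod_5[OF assms(3)] by (simp only: to_ac_eq_iff)
  qed
  then have c0: "c \<noteq> 0" using subfield_setD(2)[OF Q] by auto
  have div: "division_field ?E n = torsion_field rationals_ac (Weierstrass 0 0 0 (A_form ?a ?b) (B_form ?a ?b)) n" for n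
    unfolding division_field_def torsion_field_def forms_to_ac ..
  have K: "division_field ?E 2 \<inter> division_field ?E 3 = quad_ext rationals_ac c"
    unfolding div using assms by (intro torsion_fields_inter[OF Q of_int of_int _ _ c c0]) auto
  have "c ^ 2 \<in> rationals_ac" unfolding c C by blast
  then show ?thesis
    unfolding has_entanglement_2_3_Z2_def Let_def K
    using galois_group_quad_ext[OF Q _ cQ] quad_ext_incl(2)[OF Q, of c] cQ by auto
qed

section \<open>The lower bound for the number of classes\<close>

text \<open>The condition at 5 is sharpened so that C is 2 modulo 5, which makes it a nonsquare; it
  still implies \<open>local_good\<close> and is periodic modulo 5^4.\<close>

definition entangled_good :: "nat \<Rightarrow> nat \<Rightarrow> nat \<Rightarrow> bool" where
  "entangled_good p = (if p = 5 then (\<lambda>a b. 5 dvd a \<and> \<not> 5 dvd b) else local_good p)"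

lemma fourth_power_mod_5:
  fixes b :: nat
  assumes "\<not> 5 dvd b"
  shows "b ^ 4 mod 5 = 1"
proof -
  have "b mod 5 \<noteq> 0" using assms by (simp add: dvd_eq_mod_eq_0)
  moreover have "b mod 5 < 5" by simp
  ultimately have "b mod 5 \<in> {1, 2, 3, 4}" by (simp only: insert_iff empty_iff) linarith
  then have "(b mod 5) ^ 4 mod 5 = 1" by auto
  then show ?thesis by (simp only: power_mod)
qed

text \<open>For 5 | a only 432 b^4 survives modulo 5; 432 is 2 there, and b^4 is 1 by
  Fermat.\<close>

lemma quartic_mod_5:
  assumes "5 dvd a" "\<not> 5 dvd b"
  shows "quartic a b mod 5 = 2"
proof -
  obtain c where a: "a = 5 * c" using assms(1) by (rule dvdE)
  have "quartic a b = 5 * (125 * c ^ 4 + 180 * c ^ 2 * b ^ 2 + 86 * b ^ 4) + 2 * b ^ 4"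
    unfolding quartic_def a by (simp add: poly_simps)
  then have "quartic a b mod 5 = (2 * b ^ 4) mod 5" by (simp only: mod_mult_self4)
  also have "\<dots> = (2 * (b ^ 4 mod 5)) mod 5" by (simp only: mod_mult_right_eq)
  also have "\<dots> = 2" unfolding fourth_power_mod_5[OF assms(2)] by simp
  finally show ?thesis .
qed

lemma entangled_good_imp_local_good:
  assumes "entangled_good p a b"
  shows "local_good p a b"
proof (cases "p = 5")
  case True
  then have ab: "5 dvd a" "\<not> 5 dvd b" using assms by (auto simp: entangled_good_def)
  have "\<not> 5 ^ 4 dvd quartic a b"
  proof
    assume "5 ^ 4 dvd quartic a b"
    then have "5 dvd quartic a b" by (rule dvd_trans[rotated]) simp
    then show False using quartic_mod_5[OF ab] by simp
  qed
  then show ?thesis using True ab by (simp add: local_good_def)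
qed (use assms in \<open>simp add: entangled_good_def\<close>)

lemma periodic2_entangled_good: "periodic2 (p ^ 4) (entangled_good p)"
proof (cases "p = 5")
  case True
  have "5 dvd a mod 5 ^ 4 \<longleftrightarrow> 5 dvd a" for a :: nat by (rule dvd_mod_power_iff) simp
  then show ?thesis unfolding periodic2_def entangled_good_def True by simp
qed (simp add: entangled_good_def periodic2_local_good)

text \<open>Equal A and B give equal j = (s / b^2)^3 with s = a^2 + 12 b^2. The base of the cube is
  nonnegative and hence determined, so a / b is determined, and coprimality recovers a and
  b.\<close>

lemma forms_inj:
  fixes a b a' b' :: nat
  assumes pos: "a > 0" "b > 0" "a' > 0" "b' > 0" and cop: "coprime a b" "coprime a' b'"
    and A: "A_form (int a) (int b) = A_form (int a') (int b')"
    and B: "B_form (int a) (int b) = B_form (int a') (int b')"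
  shows "a = a' \<and> b = b'"
proof -
  define s s' where "s = int a ^ 2 + 12 * int b ^ 2" and "s' = int a' ^ 2 + 12 * int b' ^ 2"
  define C C' where "C = C_form (int a) (int b)" and "C' = C_form (int a') (int b')"
  have C0: "C \<noteq> 0" "C' \<noteq> 0" unfolding C_def C'_def using C_form_pos[of "int b" "int a"] C_form_pos[of "int b'" "int a'"] pos by auto
  have 1: "s * C = s' * C'" using A unfolding A_form_eq s_def [symmetric] s'_def [symmetric] C_def [symmetric] C'_def [symmetric] by simp
  have "- (186624 * int b ^ 6 * C ^ 3) = - (186624 * int b' ^ 6 * C' ^ 3)"
    unfolding C_def C'_def using discriminant_form[of "int a" "int b"] discriminant_form[of "int a'" "int b'"] A B by simp
  then have 2: "int b ^ 6 * C ^ 3 = int b' ^ 6 * C' ^ 3" by simp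
  have "(s * int b' ^ 2) ^ 3 * (C * C') ^ 3 = (s * C) ^ 3 * (int b' ^ 6 * C' ^ 3)"
    by (simp add: power_mult_distrib flip: power_mult)
  also have "\<dots> = (s' * C') ^ 3 * (int b ^ 6 * C ^ 3)" unfolding 1 2 ..
  also have "\<dots> = (s' * int b ^ 2) ^ 3 * (C * C') ^ 3"
    by (simp add: power_mult_distrib flip: power_mult)
  finally have "(s * int b' ^ 2) ^ 3 = (s' * int b ^ 2) ^ 3" using C0 by simp
  moreover have "s * int b' ^ 2 \<ge> 0" "s' * int b ^ 2 \<ge> 0" unfolding s_def s'_def by simp_all
  ultimately have "s * int b' ^ 2 = s' * int b ^ 2" by (metis power_eq_imp_eq_base zero_less_numeral)
  then have "(int a * int b') ^ 2 = (int a' * int b) ^ 2"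
    unfolding s_def s'_def by (simp add: algebra_simps power_mult_distrib)
  then have "int a * int b' = int a' * int b" by (rule power2_eq_imp_eq) simp_all
  then have eq: "a * b' = a' * b" by (simp only: of_nat_mult[symmetric] of_nat_eq_iff)
  then have "a dvd a' * b" "a' dvd a * b'" by (metis dvd_triv_left)+
  then have "a dvd a'" "a' dvd a" using cop by (simp_all add: coprime_dvd_mult_left_iff)
  then have "a = a'" by (rule dvd_antisym)
  then show ?thesis using eq pos by simp
qed

lemma card_points_le_entangled_class_count:
  assumes "x > 0"
  shows "card (sieved entangled_good (x powr (1 / 18)))
    \<le> entangled_class_count x"
proof -
  let ?P = "sieved entangled_good (x powr (1 / 18))"
  let ?f = "\<lambda>(a, b). (A_form (int a) (int b), B_form (int a) (int b))"
  have T: "x powr (1 / 18) > 0" using assms by simp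
  have P: "a > 0" "b > 0" "coprime a b" "minimal_pair (A_form (int a) (int b)) (B_form (int a) (int b))"
    "real_of_int (H_form (int a) (int b)) \<le> x" "quartic a b mod 5 = 2" if ab: "(a, b) \<in> ?P" for a b
  proof -
    show pos: "a > 0" "b > 0" using quadrant.points_bounded[OF T ab] by auto
    have good: "entangled_good p a b" if "prime p" for p using ab that unfolding quadrant.points_def by blast
    then have "\<forall>p. prime p \<longrightarrow> local_good p a b" using entangled_good_imp_local_good by blast
    then show "coprime a b" "minimal_pair (A_form (int a) (int b)) (B_form (int a) (int b))"
      using minimal_pair_forms_iff[OF pos(2), of a] by blast+
    show "real_of_int (H_form (int a) (int b)) \<le> x"
      using ab unfolding pair_height_le_iff[OF assms pos] quadrant.points_def by blast
    have "prime (5::nat)" by simp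
    from good[OF this] show "quartic a b mod 5 = 2" by (simp add: entangled_good_def quartic_mod_5)
  qed
  have "inj_on ?f ?P"
  proof (rule inj_onI)
    fix y z assume yz: "y \<in> ?P" "z \<in> ?P" "?f y = ?f z"
    obtain a b a' b' where e: "y = (a, b)" "z = (a', b')" by (metis surj_pair)
    then have ab: "(a, b) \<in> ?P" "(a', b') \<in> ?P" using yz by blast+
    show "y = z"
      using forms_inj[OF P(1,2)[OF ab(1)] P(1,2)[OF ab(2)] P(3)[OF ab(1)] P(3)[OF ab(2)]] yz(3) e by simp
  qed
  then have "card ?P = card (?f ` ?P)" by (simp add: card_image)
  also have "\<dots> \<le> entangled_class_count x"
  proof (rule entangled_class_count_ge)
    show "finite (?f ` ?P)" using quadrant.finite_points[OF T] by simp
    fix A B assume "(A, B) \<in> ?f ` ?P"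
    then obtain a b where ab: "(a, b) \<in> ?P" and AB: "A = A_form (int a) (int b)" "B = B_form (int a) (int b)"
      by auto
    note P = P[OF ab]
    have "4 * A ^ 3 + 27 * B ^ 2 \<noteq> 0"
      unfolding AB discriminant_form using P(2) C_form_pos[of "int b" "int a"] by simp
    moreover have "int (quartic a b) mod 5 = 2" using P(6) by presburger
    then have "C_form (int a) (int b) mod 5 = 2" by (simp only: quartic_C_form)
    then have "has_entanglement_2_3_Z2 (short_model A B)"
      unfolding AB using P(1,2) by (intro entanglement_of_forms) auto
    ultimately show "minimal_pair A B \<and> 4 * A ^ 3 + 27 * B ^ 2 \<noteq> 0 \<and>
        real_of_int (pair_height A B) \<le> x \<and> has_entanglement_2_3_Z2 (short_model A B)"
      using P(4,5) unfolding AB H_form_def by blast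
  qed
  finally show ?thesis .
qed

lemma entangled_class_count_lower:
  "(\<lambda>x. real (entangled_class_count x)) \<in> \<Omega>[at_top](\<lambda>x. x powr (1 / 9))"
proof -
  let ?P = "sieved entangled_good"
  define d where "d = euler_product * (\<Prod>p | prime p \<and> p \<le> max 3 5. local_density (entangled_good p) p / euler_term p)"
  define L where "L = d * measure lborel quadrant_region"
  have lim: "(\<lambda>z. \<Prod>p | prime p \<and> p \<le> z. local_density (entangled_good p) p) \<longlonglongrightarrow> d"
    unfolding d_def by (rule density_product_limit) (simp add: entangled_good_def)
  have "((\<lambda>T. real (card (?P T)) / T ^ 2) \<longlongrightarrow> L) at_top"
    unfolding L_def
  proof (rule quadrant.sieve_asymp[OF periodic2_entangled_good _ _ _ lim])
    show "entangled_good p a b \<Longrightarrow> \<not> (p dvd a \<and> p dvd b)" for p a b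
      by (auto simp: entangled_good_def local_good_def split: if_splits)
    show "entangled_good p = local_good p" if "p > 5" for p using that by (simp add: entangled_good_def)
    show "(3::nat) \<le> 5" by simp
  qed
  from tendsto_powr_18[OF this]
  have lim': "((\<lambda>x. real (card (?P (x powr (1 / 18)))) / x powr (1 / 9)) \<longlongrightarrow> L) at_top" .
  \<comment> \<open>The limit must be positive for the bound to say anything; at 5 the sharpened
    condition still has density 4/25.\<close>
  have dens: "local_density (entangled_good p) p > 0" if p: "prime p" for p
  proof (cases "p = 5")
    case True
    then show ?thesis using local_density_dvd_not_dvd[of 5] by (simp add: entangled_good_def)
  next
    case False
    have "local_density (local_good p) p > 0"
    proof (cases "p = 2 \<or> p = 3")
      case True
      then show ?thesis using local_density_2_3[OF True] by auto
    next
      case F: False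
      then have "local_density (local_good p) p = euler_term p"
        using local_density_euler_factor[OF p] p by (simp add: euler_term_def)
      then show ?thesis using euler_term_bounds(2) by simp
    qed
    then show ?thesis using False by (simp add: entangled_good_def)
  qed
  have "d > 0" unfolding d_def using dens euler_term_bounds(2)
    by (intro mult_pos_pos euler_product_pos prod_pos) auto
  then have "L > 0" unfolding L_def using measure_quadrant_region_pos by simp
  then have "eventually (\<lambda>x. L / 2 < real (card (?P (x powr (1 / 18)))) / x powr (1 / 9)) at_top"
    using order_tendstoD(1)[OF lim', of "L / 2"] by simp
  then have "eventually (\<lambda>x. L / 2 * norm (x powr (1 / 9)) \<le> norm (real (entangled_class_count x))) at_top"
    using eventually_gt_at_top[of 0]
  proof eventually_elim
    case (elim x)
    then have "L / 2 * x powr (1 / 9) \<le> real (card (?P (x powr (1 / 18))))" by (simp add: field_simps)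
    also have "\<dots> \<le> real (entangled_class_count x)"
      using card_points_le_entangled_class_count[OF elim(2)] by simp
    finally show ?case by simp
  qed
  then show ?thesis using \<open>L > 0\<close> by (intro landau_omega.bigI[of "L / 2"]) simp_all
qed

theorem theorem4p4:
  shows "((\<lambda>x::real. real (N1 x)) \<sim>[at_top]
           (\<lambda>x. 1 / 2 * (2 / 3) * euler_product * measure lborel region_R * x powr (1 / 9)))
         \<and> (\<lambda>x::real. real (entangled_class_count x)) \<in> \<Omega>[at_top](\<lambda>x. x powr (1 / 9))"
  using N1_asymp entangled_class_count_lower by blast

end
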